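(* Let $d$ be a positive integer, $\beta>0$, $\delta\in(0,2)$ and $\lambda>0$. Let $\mathcal{C}(t;\delta,\lambda)=(1+t^{\delta})^{-\lambda/\delta}$, $t\ge 0$, be the Generalized Cauchy covariance function, and let $\widehat{\mathcal{C}}_{d,\beta}(\cdot;\delta,\lambda)$ denote the $d$-dimensional radial Fourier transform of the rescaled function $t\mapsto\mathcal{C}(t/\beta;\delta,\lambda)$. Then, for every $z>0$, $$ \begin{aligned} \widehat{\mathcal{C}}_{d,\beta}(z;\delta,\lambda) &=\frac{z^{-d}}{\pi^{d/2}}\frac{1}{\Gamma(\frac{\lambda}{\delta})}\sum_{n=0}^{\infty}\frac{(-1)^n}{n!}\,\frac{\Gamma\left(\frac{\lambda}{\delta}+n\right)\Gamma\left(\frac d2-\left(\frac{\lambda}{\delta}+n\right)\frac{\delta}{2}\right)}{\Gamma\left(\left(\frac{\lambda}{\delta}+n\right)\frac{\delta}{2}\right)}\left(\frac{z\beta}{2}\right)^{\left(\frac{\lambda}{\delta}+n\right)\delta}\\ &\quad+\frac{z^{-d}}{\pi^{d/2}\delta}\frac{2}{\Gamma(\frac{\lambda}{\delta})}\sum_{n=0}^{\infty}\frac{(-1)^n}{n!}\,\frac{\Gamma\left(\frac{2n+d}{\delta}\right)\Gamma\left(\frac{\lambda}{\delta}-\frac{2n+d}{\delta}\right)}{\Gamma\left(n+\frac d2\right)}\left(\frac{z\beta}{2}\right)^{2n+d}. \end{aligned} $$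
   Context: For a function $\phi:[0,\infty)\to\mathbb{R}$, its $d$-dimensional radial Fourier transform is $$\widehat{\phi}_d(z)=\frac{z^{1-d/2}}{(2\pi)^{d/2}}\int_0^\infty t^{d/2}J_{d/2-1}(tz)\,\phi(t)\,dt,$$ where $J_\nu$ is the Bessel function of the first kind of order $\nu$; equivalently $\widehat\phi_d(\|\boldsymbol z\|)=(2\pi)^{-d}\int_{\mathbb{R}^d}e^{\mathsf{i}\langle \boldsymbol z,\boldsymbol x\rangle}\phi(\|\boldsymbol x\|)\,d\boldsymbol x$. For a scale parameter $\beta>0$, the transform of $\phi(\cdot/\beta)$ is $\widehat\phi_{d,\beta}(z)=\beta^d\widehat\phi_d(\beta z)$. $\Gamma$ is the Gamma function.
   Formalization: Assumes no Gamma argument is a pole (λ+nδ ≠ d+2m for all n,m ≥ 0) and that both series converge at the given z; the transform's integral is read as an Abel limit, which equals the ordinary improper integral whenever that converges (it diverges for λ ≤ (d−1)/2). *)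

theory Defs
  imports "HOL-Analysis.Analysis"
begin

text \<open>Bessel function of the first kind of real order, for \<open>x > 0\<close>. The entire function
  \<open>rGamma = 1 / \<Gamma>\<close> makes the series correct at the poles of \<open>\<Gamma>\<close> too.\<close>

definition bessel_J :: "real \<Rightarrow> real \<Rightarrow> real" where
  "bessel_J \<nu> x =
     (\<Sum>k. (-1) ^ k / fact k * rGamma (real k + \<nu> + 1) * (x / 2) powr (2 * real k + \<nu>))"

definition radial_integrand :: "nat \<Rightarrow> (real \<Rightarrow> real) \<Rightarrow> real \<Rightarrow> real \<Rightarrow> real" where
  "radial_integrand d \<phi> z t = t powr (real d / 2) * bessel_J (real d / 2 - 1) (t * z) * \<phi> t"

definition radial_factor :: "nat \<Rightarrow> real \<Rightarrow> real" where
  "radial_factor d z = z powr (1 - real d / 2) / (2 * pi) powr (real d / 2)"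

text \<open>The transform with the integral taken literally. The gauge integral over
  \<open>[0,\<infinity>)\<close> is the improper integral \<open>lim\<^bsub>T\<rightarrow>\<infinity>\<^esub> \<integral>\<^sub>0\<^sup>T\<close>, see
  \<open>has_integral_atLeast_iff\<close> below; it need not converge absolutely.\<close>

definition radial_ft :: "nat \<Rightarrow> (real \<Rightarrow> real) \<Rightarrow> real \<Rightarrow> real" where
  "radial_ft d \<phi> z = radial_factor d z * integral {0..} (radial_integrand d \<phi> z)"

text \<open>For a function decaying like \<open>t powr -\<lambda>\<close> the integrand oscillates with amplitude of order
  \<open>t powr ((d - 1) / 2 - \<lambda>)\<close>, so for \<open>\<lambda> \<le> (d - 1) / 2\<close> the improper integral diverges and
  the transform has to be read with a summation method. We use Abel's: \<open>f\<close> has the value \<open>I\<close> if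
  \<open>\<integral>\<^sub>0\<^sup>\<infinity> exp (-\<epsilon>t) f(t) dt\<close> exists for all \<open>\<epsilon> > 0\<close> and tends to \<open>I\<close> as \<open>\<epsilon>\<close> decreases to \<open>0\<close>.
  It agrees with the improper integral whenever the latter converges, so it does not change the
  transform where the literal definition applies: see \<open>has_radial_ft_iff_radial_ft\<close>.\<close>

definition has_abel_integral :: "(real \<Rightarrow> real) \<Rightarrow> real \<Rightarrow> bool" where
  "has_abel_integral f I \<longleftrightarrow>
     (\<forall>\<epsilon>>0. (\<lambda>t. exp (- \<epsilon> * t) * f t) integrable_on {0..}) \<and>
     ((\<lambda>\<epsilon>. integral {0..} (\<lambda>t. exp (- \<epsilon> * t) * f t)) \<longlongrightarrow> I) (at_right 0)"

definition has_radial_ft :: "nat \<Rightarrow> (real \<Rightarrow> real) \<Rightarrow> real \<Rightarrow> real \<Rightarrow> bool" where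
  "has_radial_ft d \<phi> z v \<longleftrightarrow>
     (\<exists>I. has_abel_integral (radial_integrand d \<phi> z) I \<and> v = radial_factor d z * I)"

definition gen_cauchy :: "real \<Rightarrow> real \<Rightarrow> real \<Rightarrow> real" where
  "gen_cauchy \<delta> l t = (1 + t powr \<delta>) powr (- l / \<delta>)"

text \<open>The summands of the two series, with \<open>x = z\<beta>/2\<close>.\<close>

definition cauchy_term1 :: "nat \<Rightarrow> real \<Rightarrow> real \<Rightarrow> real \<Rightarrow> nat \<Rightarrow> real" where
  "cauchy_term1 d \<delta> l x n =
     (-1) ^ n / fact n *
     (Gamma (l / \<delta> + real n) * Gamma (real d / 2 - (l / \<delta> + real n) * \<delta> / 2)
        / Gamma ((l / \<delta> + real n) * \<delta> / 2)) *
     x powr ((l / \<delta> + real n) * \<delta>)"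

definition cauchy_term2 :: "nat \<Rightarrow> real \<Rightarrow> real \<Rightarrow> real \<Rightarrow> nat \<Rightarrow> real" where
  "cauchy_term2 d \<delta> l x n =
     (-1) ^ n / fact n *
     (Gamma (real (2 * n + d) / \<delta>) * Gamma (l / \<delta> - real (2 * n + d) / \<delta>)
        / Gamma (real n + real d / 2)) *
     x ^ (2 * n + d)"


subsection \<open>Agreement of the two readings of the transform\<close>

lemma has_integral_atLeast_iff:
  fixes f :: "real \<Rightarrow> real"
  shows "(f has_integral L) {0..} \<longleftrightarrow>
    (\<forall>T. f integrable_on {0..T}) \<and> ((\<lambda>T. integral {0..T} f) \<longlongrightarrow> L) at_top"
proof -
  let ?g = "\<lambda>x. if x \<in> {0..} then f x else 0"
  have int_iff: "?g integrable_on {a..b} \<longleftrightarrow> f integrable_on {max 0 a..b}" for a b :: real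
  proof -
    have "{a..b} \<inter> {0..} = {max 0 a..b}" by auto
    then show ?thesis
      using integrable_restrict_Int[of "{0..}" f "{a..b}"] by (simp add: Int_commute)
  qed
  have int_eq: "integral {a..b} ?g = integral {max 0 a..b} f" for a b :: real
  proof -
    have "{a..b} \<inter> {0..} = {max 0 a..b}" by auto
    then show ?thesis
      using integral_restrict_Int[of "{a..b}" "{0..}" f] by (simp add: Int_commute)
  qed
  have A: "(\<forall>a b. ?g integrable_on cbox a b) \<longleftrightarrow> (\<forall>T. f integrable_on {0..T})"
    unfolding cbox_interval int_iff
  proof (intro iffI allI)
    fix T assume "\<forall>a b. f integrable_on {max 0 a..b}"
    then have "f integrable_on {max 0 0..T}" by blast
    then show "f integrable_on {0..T}" by simp
  next
    fix a b assume "\<forall>T. f integrable_on {0..T}"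
    then have "f integrable_on {0..b}" by blast
    then show "f integrable_on {max 0 a..b}"
      by (rule integrable_on_subinterval) auto
  qed
  have B: "(\<forall>e>0. \<exists>B>0. \<forall>a b. ball 0 B \<subseteq> cbox a b \<longrightarrow> norm (integral (cbox a b) ?g - L) < e)
      \<longleftrightarrow> ((\<lambda>T. integral {0..T} f) \<longlongrightarrow> L) at_top" (is "?l \<longleftrightarrow> ?r")
  proof
    assume l: ?l
    show ?r
    proof (rule tendstoI)
      fix e :: real assume "e > 0"
      then obtain B where B: "B > 0"
        "\<And>a b. ball 0 B \<subseteq> cbox a b \<Longrightarrow> norm (integral (cbox a b) ?g - L) < e"
        using l by blast
      have "dist (integral {0..T} f) L < e" if "T \<ge> B" for T
      proof -
        have "ball 0 B \<subseteq> cbox (-T) T" using that by (auto simp: dist_norm)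
        from B(2)[OF this] show ?thesis
          using B(1) that unfolding cbox_interval int_eq by (simp add: dist_norm)
      qed
      then show "eventually (\<lambda>T. dist (integral {0..T} f) L < e) at_top"
        by (auto simp: eventually_at_top_linorder)
    qed
  next
    assume r: ?r
    show ?l
    proof (intro allI impI)
      fix e :: real assume "e > 0"
      from tendstoD[OF r this] obtain B0 where
        B0: "\<And>T. T \<ge> B0 \<Longrightarrow> dist (integral {0..T} f) L < e"
        by (auto simp: eventually_at_top_linorder)
      define B where "B = max B0 1"
      have "norm (integral (cbox a b) ?g - L) < e" if "ball 0 B \<subseteq> cbox a b" for a b
      proof -
        have "B > 0" by (simp add: B_def)
        have cl: "closure (ball 0 B) \<subseteq> cbox a b"
          using that by (simp add: closure_minimal)
        then have "cball 0 B \<subseteq> cbox a b" using \<open>B > 0\<close> by simp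
        moreover have "B \<in> cball 0 B" "-B \<in> cball 0 B" using \<open>B > 0\<close> by auto
        ultimately have "B \<in> cbox a b" "-B \<in> cbox a b" by blast+
        then have "a \<le> 0" "b \<ge> B0" using \<open>B > 0\<close> by (auto simp: B_def)
        then show ?thesis
          using B0[of b] unfolding cbox_interval int_eq by (simp add: dist_norm max_absorb1)
      qed
      moreover have "B > 0" by (simp add: B_def)
      ultimately show "\<exists>B>0. \<forall>a b. ball 0 B \<subseteq> cbox a b \<longrightarrow>
          norm (integral (cbox a b) ?g - L) < e" by blast
    qed
  qed
  show ?thesis unfolding has_integral_alt' A B ..
qed

theorem has_integral_imp_has_abel_integral:
  fixes f :: "real \<Rightarrow> real"
  assumes "(f has_integral L) {0..}"
  shows "has_abel_integral f L"
proof -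
  define F where "F T = integral {0..T} f" for T
  have fi: "f integrable_on {a..b}" if "a \<ge> 0" for a b
  proof -
    have "f integrable_on {0..b}" using assms unfolding has_integral_atLeast_iff by blast
    then show ?thesis by (rule integrable_on_subinterval) (use that in auto)
  qed
  have F: "(F \<longlongrightarrow> L) at_top"
    using assms unfolding has_integral_atLeast_iff F_def by blast
  have diff: "integral {a..b} f = F b - F a" if "0 \<le> a" "a \<le> b" for a b
    using Henstock_Kurzweil_Integration.integral_combine[of 0 a b f] fi that
    unfolding F_def by simp
  have "bounded (F ` {0..T})" for T
    using indefinite_integral_continuous_1[OF fi, of 0 T] unfolding F_def
    by (intro compact_imp_bounded compact_continuous_image) auto
  have small: "\<exists>A\<ge>0. \<forall>x\<ge>A. \<forall>y\<ge>A. \<bar>F x - F y\<bar> \<le> e" if "e > 0" for e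
  proof -
    from tendstoD[OF F, of "e/2"] that obtain A where A: "\<And>x. x \<ge> A \<Longrightarrow> dist (F x) L < e/2"
      by (auto simp: eventually_at_top_linorder)
    have "\<bar>F x - F y\<bar> \<le> e" if "x \<ge> max A 0" "y \<ge> max A 0" for x y
      using A[of x] A[of y] that by (auto simp: dist_real_def abs_if split: if_splits)
    then show ?thesis by (intro exI[of _ "max A 0"]) auto
  qed
  define g where "g \<epsilon> t = 1 - exp (- \<epsilon> * t)" for \<epsilon> t :: real
  have mv: "\<exists>c\<in>{a..b}. ((\<lambda>t. g \<epsilon> t * f t) has_integral
      (g \<epsilon> a * (F c - F a) + g \<epsilon> b * (F b - F c))) {a..b}"
    if e: "\<epsilon> > 0" and a: "0 \<le> a" and ab: "a \<le> b" for \<epsilon> a b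
  proof -
    have g: "g \<epsilon> x \<le> g \<epsilon> y" if "a \<le> x" "x \<le> y" "y \<le> b" for x y
      using \<open>\<epsilon> > 0\<close> that by (simp add: g_def)
    obtain c where c: "c \<in> {a..b}" "((\<lambda>x. g \<epsilon> x * f x) has_integral
        (g \<epsilon> a * integral {a..c} f + g \<epsilon> b * integral {c..b} f)) {a..b}"
      by (rule second_mean_value_theorem_full[where g = "g \<epsilon>", OF fi[OF a] ab g])
    then show ?thesis using a ab by (intro bexI[of _ c]) (simp_all add: diff)
  qed
  define G where "G \<epsilon> T = integral {0..T} (\<lambda>t. g \<epsilon> t * f t)" for \<epsilon> T
  have gfi: "(\<lambda>t. g \<epsilon> t * f t) integrable_on {a..b}" if "\<epsilon> > 0" "0 \<le> a" for \<epsilon> a b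
    using mv[of \<epsilon> a b] that
    by (cases "a \<le> b") (auto simp: integrable_on_def intro: has_integral_empty)
  have Gdiff: "G \<epsilon> b - G \<epsilon> a = integral {a..b} (\<lambda>t. g \<epsilon> t * f t)"
    if "\<epsilon> > 0" "0 \<le> a" "a \<le> b" for \<epsilon> a b
    using Henstock_Kurzweil_Integration.integral_combine[of 0 a b "\<lambda>t. g \<epsilon> t * f t"]
      gfi[of \<epsilon> 0 b] that unfolding G_def by simp
  have g01: "0 \<le> g \<epsilon> t" "g \<epsilon> t \<le> 1" if "\<epsilon> > 0" "t \<ge> 0" for \<epsilon> t
    using that by (auto simp: g_def)
  have tail: "\<bar>G \<epsilon> b - G \<epsilon> a\<bar> \<le> 2 * e"
    if h: "\<epsilon> > 0" "0 \<le> A" "A \<le> a" "a \<le> b" and A: "\<forall>x\<ge>A. \<forall>y\<ge>A. \<bar>F x - F y\<bar> \<le> e" for \<epsilon> a b A e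
  proof -
    obtain c where c: "c \<in> {a..b}" "((\<lambda>t. g \<epsilon> t * f t) has_integral
      (g \<epsilon> a * (F c - F a) + g \<epsilon> b * (F b - F c))) {a..b}"
      using mv[of \<epsilon> a b] h by auto
    have "\<bar>g \<epsilon> a * (F c - F a)\<bar> \<le> 1 * e" unfolding abs_mult
      using A that c g01[of \<epsilon> a] by (intro mult_mono) auto
    moreover have "\<bar>g \<epsilon> b * (F b - F c)\<bar> \<le> 1 * e" unfolding abs_mult
      using A that c g01[of \<epsilon> b] by (intro mult_mono) auto
    ultimately show ?thesis
      using Gdiff[of \<epsilon> a b] integral_unique[OF c(2)] that by linarith
  qed
  have Gconv: "\<exists>S. (G \<epsilon> \<longlongrightarrow> S) at_top" if "\<epsilon> > 0" for \<epsilon>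
  proof -
    have "\<exists>P. eventually P at_top \<and> (\<forall>x y. P x \<and> P y \<longrightarrow> dist (G \<epsilon> x) (G \<epsilon> y) < e)"
      if e: "e > 0" for e
    proof -
      obtain A where A: "A \<ge> 0" "\<forall>x\<ge>A. \<forall>y\<ge>A. \<bar>F x - F y\<bar> \<le> e/4"
        using small[of "e/4"] e by auto
      have "dist (G \<epsilon> x) (G \<epsilon> y) < e" if "A \<le> x" "A \<le> y" for x y
        using tail[of \<epsilon> A x y "e/4"] tail[of \<epsilon> A y x "e/4"] A that \<open>\<epsilon> > 0\<close> \<open>e > 0\<close>
        by (cases "x \<le> y") (auto simp: dist_real_def abs_if split: if_splits)
      then show ?thesis by (intro exI[of _ "\<lambda>x. A \<le> x"]) (auto simp: eventually_ge_at_top)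
    qed
    then have "cauchy_filter (filtermap (G \<epsilon>) at_top)"
      by (simp add: cauchy_filter_metric_filtermap)
    moreover have "filtermap (G \<epsilon>) at_top \<noteq> bot" by (simp add: filtermap_bot_iff)
    moreover have "filtermap (G \<epsilon>) at_top \<le> principal UNIV" by simp
    ultimately obtain S where "filtermap (G \<epsilon>) at_top \<le> nhds S"
      using complete_UNIV[where 'a = real] unfolding complete_uniform by metis
    then show ?thesis unfolding filterlim_def by blast
  qed
  then obtain S where S: "\<And>\<epsilon>. \<epsilon> > 0 \<Longrightarrow> (G \<epsilon> \<longlongrightarrow> S \<epsilon>) at_top" by metis
  have hi: "((\<lambda>t. exp (- \<epsilon> * t) * f t) has_integral (L - S \<epsilon>)) {0..}" if "\<epsilon> > 0" for \<epsilon>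
  proof -
    have "((\<lambda>t. g \<epsilon> t * f t) has_integral S \<epsilon>) {0..}"
      using S[OF that] gfi[OF that, of 0] unfolding has_integral_atLeast_iff G_def by blast
    from has_integral_diff[OF assms this] show ?thesis
      by (simp add: g_def algebra_simps)
  qed
  have "(S \<longlongrightarrow> 0) (at_right 0)"
  proof (rule tendstoI)
    fix e :: real assume "e > 0"
    obtain A where A: "A \<ge> 0" "\<forall>x\<ge>A. \<forall>y\<ge>A. \<bar>F x - F y\<bar> \<le> e/8"
      using small[of "e/8"] \<open>e > 0\<close> by auto
    obtain M where M: "\<forall>x\<in>{0..A}. \<bar>F x\<bar> \<le> M"
      using \<open>\<And>T. bounded (F ` {0..T})\<close>[of A] unfolding bounded_iff by auto
    have head: "\<bar>G \<epsilon> A\<bar> \<le> g \<epsilon> A * (2 * M)" if \<epsilon>: "\<epsilon> > 0" for \<epsilon>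
    proof -
      obtain c where c: "c \<in> {0..A}" "((\<lambda>t. g \<epsilon> t * f t) has_integral
        (g \<epsilon> 0 * (F c - F 0) + g \<epsilon> A * (F A - F c))) {0..A}"
        using mv[of \<epsilon> 0 A] \<epsilon> A by auto
      have "G \<epsilon> A = g \<epsilon> A * (F A - F c)"
        using integral_unique[OF c(2)] by (simp add: G_def g_def)
      moreover have "\<bar>F A - F c\<bar> \<le> 2 * M" using bspec[OF M, of A] bspec[OF M, of c] c A by auto
      ultimately show ?thesis
        using g01[OF \<epsilon> A(1)] by (simp add: abs_mult mult_left_mono)
    qed
    have bd: "\<bar>S \<epsilon>\<bar> \<le> g \<epsilon> A * (2 * M) + e/4" if "\<epsilon> > 0" for \<epsilon>
    proof -
      have "\<bar>G \<epsilon> T\<bar> \<le> g \<epsilon> A * (2 * M) + e/4" if "T \<ge> A" for T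
      proof -
        have "\<bar>G \<epsilon> T - G \<epsilon> A\<bar> \<le> 2 * (e/8)"
          using A that by (intro tail[OF \<open>\<epsilon> > 0\<close>, of A]) auto
        then show ?thesis using head[OF \<open>\<epsilon> > 0\<close>] by linarith
      qed
      then have "eventually (\<lambda>T. \<bar>G \<epsilon> T\<bar> \<le> g \<epsilon> A * (2 * M) + e/4) at_top"
        by (auto simp: eventually_at_top_linorder)
      from tendsto_upperbound[OF tendsto_rabs[OF S[OF that]] this] show ?thesis by simp
    qed
    have "((\<lambda>\<epsilon>. g \<epsilon> A * (2 * M)) \<longlongrightarrow> (1 - exp (- 0 * A)) * (2 * M)) (at_right 0)"
      unfolding g_def by (intro tendsto_intros)
    then have "((\<lambda>\<epsilon>. g \<epsilon> A * (2 * M)) \<longlongrightarrow> 0) (at_right 0)" by simp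
    from tendstoD[OF this, of "e/2"] \<open>e > 0\<close>
    have "eventually (\<lambda>\<epsilon>. \<bar>g \<epsilon> A * (2 * M)\<bar> < e/2) (at_right 0)" by simp
    moreover have "eventually (\<lambda>\<epsilon>::real. \<epsilon> > 0) (at_right 0)"
      by (simp add: eventually_at_right_less)
    ultimately show "eventually (\<lambda>\<epsilon>. dist (S \<epsilon>) 0 < e) (at_right 0)"
    proof eventually_elim
      case (elim \<epsilon>)
      then show ?case using bd[of \<epsilon>] \<open>e > 0\<close> by auto
    qed
  qed
  from tendsto_diff[OF tendsto_const[of L] this]
  have "((\<lambda>\<epsilon>. L - S \<epsilon>) \<longlongrightarrow> L) (at_right 0)" by simp
  moreover have "eventually (\<lambda>\<epsilon>. L - S \<epsilon> = integral {0..} (\<lambda>t. exp (- \<epsilon> * t) * f t)) (at_right 0)"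
    by (rule eventually_at_rightI[of 0 1], rule integral_unique[OF hi, symmetric]) auto
  ultimately have "((\<lambda>\<epsilon>. integral {0..} (\<lambda>t. exp (- \<epsilon> * t) * f t)) \<longlongrightarrow> L) (at_right 0)"
    by (rule Lim_transform_eventually)
  moreover have "(\<lambda>t. exp (- \<epsilon> * t) * f t) integrable_on {0..}" if "\<epsilon> > 0" for \<epsilon>
    using hi[OF that] by (rule has_integral_integrable)
  ultimately show ?thesis unfolding has_abel_integral_def by simp
qed

lemma has_abel_integral_unique:
  "has_abel_integral f I \<Longrightarrow> has_abel_integral f J \<Longrightarrow> I = J"
  unfolding has_abel_integral_def by (elim conjE) (rule tendsto_unique[OF trivial_limit_at_right_real])

corollary has_radial_ft_iff_radial_ft:
  assumes "radial_integrand d \<phi> z integrable_on {0..}"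
  shows "has_radial_ft d \<phi> z v \<longleftrightarrow> radial_ft d \<phi> z = v"
proof -
  have "has_abel_integral (radial_integrand d \<phi> z) (integral {0..} (radial_integrand d \<phi> z))"
    by (rule has_integral_imp_has_abel_integral[OF integrable_integral[OF assms]])
  then have "has_abel_integral (radial_integrand d \<phi> z) I \<longleftrightarrow>
      I = integral {0..} (radial_integrand d \<phi> z)" for I
    by (metis has_abel_integral_unique)
  then show ?thesis
    unfolding has_radial_ft_def radial_ft_def by auto
qed

end

theory Submission
  imports Defs "HOL-Complex_Analysis.Complex_Analysis" "HOL-Real_Asymp.Real_Asymp"
begin

text \<open>Write \<open>\<alpha> = l / \<delta>\<close>. The proof rests on two Mellin--Barnes integrals.

The first one is \<open>(1 + x) powr -\<alpha> = 1 / (2 \<pi> \<i> \<Gamma>(\<alpha>)) \<integral> \<Gamma>(s) \<Gamma>(\<alpha> - s) x^(-s) ds\<close> over a line \<open>Re s = c\<close>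
with \<open>0 < c < \<alpha>\<close> (\<open>mellin_barnes_binomial\<close>). For \<open>x = (t/\<beta>) powr \<delta>\<close> the power \<open>x^(-s)\<close> is, up to the factor
\<open>1 / \<Gamma>(\<delta> s)\<close>, the Laplace transform of \<open>r^(\<delta> s - 1)\<close>, so the Cauchy function is itself a Laplace transform,
\<open>C(t/\<beta>) = \<integral> exp(-t r) \<mu>(r) dr\<close> with \<open>\<bar>\<mu>(r)\<bar> \<le> W r powr (\<delta> c - 1)\<close>. This is where \<open>\<delta> < 2\<close> enters:
\<open>\<Gamma>(s) \<Gamma>(\<alpha> - s)\<close> decays like \<open>exp(-\<pi> \<bar>Im s\<bar>)\<close>, while \<open>1 / \<Gamma>(\<delta> s)\<close> grows like \<open>exp(\<pi> \<delta> \<bar>Im s\<bar> / 2)\<close>.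

The factor \<open>exp(-\<epsilon> t)\<close> of Abel's method shifts \<open>r\<close> to \<open>r + \<epsilon>\<close>. The regularised integral is therefore
\<open>\<integral> \<mu>(r) P(r + \<epsilon>) dr\<close>, where \<open>P\<close> is the Laplace transform of the Bessel kernel. It has the closed form
\<open>P(p) = const p (p^2 + z^2) powr (-(d+1)/2)\<close>, which stays bounded near \<open>0\<close> and is \<open>O(p^(-d))\<close>. If \<open>\<delta> c < d\<close>, dominated
convergence gives the limit \<open>\<integral> \<mu>(r) P(r) dr\<close>, whether or not the unregularised integral converges
(\<open>abel_integral_bessel_mixture\<close>). Inserting the formula for \<open>\<mu>\<close>, the moments of \<open>P\<close> are beta integrals, and
Legendre's duplication formula turns the transform into the second Mellin--Barnes integral, that of
\<open>\<Gamma>(s) \<Gamma>(\<alpha> - s) \<Gamma>((d - \<delta> s)/2) / \<Gamma>(\<delta> s/2) (z \<beta>/2)^(\<delta> s)\<close> over \<open>Re s = c\<close>.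

The line is then moved to the right (\<open>cauchy_contour_closing\<close>). The residues at \<open>s = \<alpha> + n\<close> and at \<open>s = (d + 2n)/\<delta>\<close>
are the summands of the two series. By the reflection formula the integral over \<open>Re s = R\<close> is at most of order
\<open>R^M (z \<beta>/2)^(\<delta> R) / \<Gamma>(\<delta> R/2)\<close> as long as \<open>R\<close> keeps away from both families of poles, hence it vanishes
along a suitable sequence of \<open>R\<close>. Poles of different families may come arbitrarily close to each other, so this
only shows that the partial sums of both series taken together converge along that sequence; as each series is
summable, the limit is the sum of the two values.\<close>

section \<open>The Gamma function on vertical lines\<close>

text \<open>In Gauss's product for \<open>\<bar>\<Gamma>(x + iy)\<bar> / \<Gamma>(x)\<close> the factors are \<open>(x + k) / \<bar>x + k + iy\<bar>\<close>, and each of them increases with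
\<open>x\<close>. Together with the explicit value on \<open>Re s = 1/2\<close> this replaces Stirling's formula on vertical lines.\<close>

lemma norm_Gamma_ratio_mono:
  fixes x x' y :: real
  assumes "0 < x" "x \<le> x'"
  shows "norm (Gamma (Complex x y)) * Gamma x' \<le> Gamma x * norm (Gamma (Complex x' y))"
proof -
  have poch: "norm (pochhammer (Complex x' y) n) * pochhammer x n
      \<le> norm (pochhammer (Complex x y) n) * pochhammer x' n" for n
  proof (induction n)
    case 0
    show ?case by simp
  next
    case (Suc n)
    let ?a = "x + real n" and ?b = "x' + real n"
    have ab: "0 < ?a" "?a \<le> ?b" using assms by auto
    have "(norm (Complex ?b y) * ?a)\<^sup>2 \<le> (norm (Complex ?a y) * ?b)\<^sup>2"
    proof -
      have "y\<^sup>2 * ?a\<^sup>2 \<le> y\<^sup>2 * ?b\<^sup>2" using ab by (intro mult_left_mono power_mono) auto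
      then show ?thesis unfolding cmod_def complex.sel power_mult_distrib
        by (simp add: algebra_simps)
    qed
    then have "norm (Complex ?b y) * ?a \<le> norm (Complex ?a y) * ?b"
      by (rule power2_le_imp_le) (use ab in auto)
    then have step: "norm (Complex x' y + of_nat n) * (x + real n)
        \<le> norm (Complex x y + of_nat n) * (x' + real n)"
      by (simp add: cmod_def)
    have "norm (pochhammer (Complex x' y) (Suc n)) * pochhammer x (Suc n)
        = (norm (pochhammer (Complex x' y) n) * pochhammer x n)
          * (norm (Complex x' y + of_nat n) * (x + real n))"
      by (simp add: pochhammer_Suc norm_mult)
    also have "\<dots> \<le> (norm (pochhammer (Complex x y) n) * pochhammer x' n)
          * (norm (Complex x y + of_nat n) * (x' + real n))"
      using assms by (intro mult_mono Suc step) (auto intro!: mult_nonneg_nonneg pochhammer_nonneg)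
    finally show ?case by (simp add: pochhammer_Suc norm_mult mult_ac)
  qed
  have norm_series: "norm (Gamma_series (Complex a y) n)
      = fact n * exp (a * ln (real n)) / norm (pochhammer (Complex a y) (n + 1))" for a n
    by (simp add: Gamma_series_def norm_divide norm_mult)
  have real_series: "Gamma_series a n = fact n * exp (a * ln (real n)) / pochhammer a (n + 1)"
    for a n by (simp add: Gamma_series_def)
  have series: "norm (Gamma_series (Complex x y) n) * Gamma_series x' n
      \<le> Gamma_series x n * norm (Gamma_series (Complex x' y) n)" for n
  proof -
    have pos: "0 < pochhammer a (n + 1)" if "a > 0" for a :: real
      using that by (rule pochhammer_pos)
    have pos': "0 < norm (pochhammer (Complex a y) (n + 1))" if "a > 0" for a
      using that by (simp only: zero_less_norm_iff pochhammer_eq_0_iff) (auto simp: complex_eq_iff)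
    have P: "0 < pochhammer x (n+1)" "0 < pochhammer x' (n+1)"
      "0 < norm (pochhammer (Complex x y) (n + 1))" "0 < norm (pochhammer (Complex x' y) (n + 1))"
      using assms pos[of x] pos[of x'] pos'[of x] pos'[of x'] by simp_all
    have key: "u / A * (v / B) \<le> u / C * (v / D)"
      if "0 < A" "0 < B" "0 < C" "0 < D" "D * C \<le> A * B" "0 < u" "0 < v" for A B C D u v :: real
    proof -
      have "inverse (A * B) \<le> inverse (D * C)" using that by (intro le_imp_inverse_le) auto
      then have "(u * v) * inverse (A * B) \<le> (u * v) * inverse (D * C)"
        using that by (intro mult_left_mono) auto
      then show ?thesis using that by (simp add: field_simps)
    qed
    show ?thesis unfolding norm_series real_series
      by (rule key) (use poch[of "n+1"] P in auto)
  qed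
  show ?thesis
    by (rule LIMSEQ_le[OF tendsto_mult[OF tendsto_norm[OF Gamma_series_LIMSEQ] Gamma_series_LIMSEQ]
          tendsto_mult[OF Gamma_series_LIMSEQ tendsto_norm[OF Gamma_series_LIMSEQ]]])
      (use series in auto)
qed

text \<open>The reflection formula at \<open>1/2 + iy\<close>, where \<open>1 - s\<close> is the conjugate of \<open>s\<close>.\<close>

lemma norm_Gamma_half_sq: "(norm (Gamma (Complex (1/2) y)))\<^sup>2 = pi / cosh (pi * y)"
proof -
  have c: "1 - Complex (1/2) y = cnj (Complex (1/2) y)" by (simp add: complex_eq_iff)
  have s: "sin (of_real pi * Complex (1/2) y) = of_real (cosh (pi * y))"
    by (simp add: complex_eq_iff Re_sin Im_sin cosh_def)
  have "Gamma (Complex (1/2) y) * cnj (Gamma (Complex (1/2) y)) = of_real (pi / cosh (pi * y))"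
    using Gamma_reflection_complex[of "Complex (1/2) y"] unfolding c s
    by (simp add: cnj_Gamma)
  then have "of_real ((norm (Gamma (Complex (1/2) y)))\<^sup>2) = complex_of_real (pi / cosh (pi * y))"
    by (simp only: complex_norm_square)
  then show ?thesis by (simp only: of_real_eq_iff)
qed

lemma cosh_bounds: "exp \<bar>t\<bar> / 2 \<le> cosh t" "cosh t \<le> exp \<bar>t\<bar>" for t :: real
proof -
  show "exp \<bar>t\<bar> / 2 \<le> cosh t" by (cases "t \<ge> 0") (auto simp: cosh_def)
  have "exp t \<le> exp \<bar>t\<bar>" "exp (-t) \<le> exp \<bar>t\<bar>" by auto
  then have "exp t + exp (- t) \<le> 2 * exp \<bar>t\<bar>" by linarith
  then show "cosh t \<le> exp \<bar>t\<bar>" unfolding cosh_def by simp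
qed

lemma norm_Gamma_half_upper: "norm (Gamma (Complex (1/2) y)) \<le> sqrt (2 * pi) * exp (- (pi / 2) * \<bar>y\<bar>)"
proof (rule power2_le_imp_le)
  have "pi / cosh (pi * y) \<le> pi / (exp \<bar>pi * y\<bar> / 2)"
    by (intro divide_left_mono cosh_bounds) auto
  also have "\<dots> = (sqrt (2 * pi) * exp (- (pi / 2) * \<bar>y\<bar>))\<^sup>2"
    by (simp add: power_mult_distrib exp_minus abs_mult field_simps flip: exp_double)
  finally show "(norm (Gamma (Complex (1/2) y)))\<^sup>2 \<le> (sqrt (2 * pi) * exp (- (pi / 2) * \<bar>y\<bar>))\<^sup>2"
    by (simp only: norm_Gamma_half_sq)
qed auto

lemma norm_Gamma_half_lower: "sqrt pi * exp (- (pi / 2) * \<bar>y\<bar>) \<le> norm (Gamma (Complex (1/2) y))"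
proof (rule power2_le_imp_le)
  have "(sqrt pi * exp (- (pi / 2) * \<bar>y\<bar>))\<^sup>2 = pi / exp \<bar>pi * y\<bar>"
    by (simp add: power_mult_distrib exp_minus abs_mult field_simps flip: exp_double)
  also have "\<dots> \<le> pi / cosh (pi * y)"
    by (intro divide_left_mono cosh_bounds) auto
  finally show "(sqrt pi * exp (- (pi / 2) * \<bar>y\<bar>))\<^sup>2 \<le> (norm (Gamma (Complex (1/2) y)))\<^sup>2"
    by (simp only: norm_Gamma_half_sq)
qed auto

lemma norm_Gamma_le: "norm (Gamma s) \<le> Gamma (Re s)" if "Re s > 0"
proof -
  have "norm (Gamma_series s n) \<le> Gamma_series (Re s) n" for n
  proof -
    have "pochhammer (Re s) m \<le> norm (pochhammer s m)" for m
    proof (induction m)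
      case (Suc m)
      have "Re s + real m \<le> norm (s + of_nat m)"
        using complex_Re_le_cmod[of "s + of_nat m"] by simp
      then show ?case using Suc that
        by (auto simp: pochhammer_Suc norm_mult intro!: mult_mono pochhammer_nonneg)
    qed simp
    from this[of "n+1"] pochhammer_pos[OF that, of "n+1"]
    have "fact n * exp (Re s * ln (real n)) / norm (pochhammer s (n + 1))
        \<le> fact n * exp (Re s * ln (real n)) / pochhammer (Re s) (n + 1)"
      by (intro divide_left_mono mult_pos_pos) auto
    then show ?thesis
      by (simp add: Gamma_series_def norm_divide norm_mult)
  qed
  then show ?thesis
    by (intro LIMSEQ_le[OF tendsto_norm[OF Gamma_series_LIMSEQ] Gamma_series_LIMSEQ]) auto
qed

text \<open>Among the lines \<open>Re s \<ge> 1/2\<close>, the modulus of \<open>\<Gamma>\<close> falls off fastest from its value on the real axis on \<open>Re s = 1/2\<close>.\<close>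

lemma norm_rGamma_le:
  assumes "Re s \<ge> 1/2"
  shows "norm (rGamma s) \<le> exp (pi / 2 * \<bar>Im s\<bar>) / Gamma (Re s)"
proof -
  have s: "s = Complex (Re s) (Im s)" by simp
  have g: "Gamma (Re s) > 0" using assms by (intro Gamma_real_pos) auto
  have "sqrt pi * exp (- (pi / 2) * \<bar>Im s\<bar>) * Gamma (Re s)
      \<le> norm (Gamma (Complex (1/2) (Im s))) * Gamma (Re s)"
    using g by (intro mult_right_mono norm_Gamma_half_lower) auto
  also have "\<dots> \<le> Gamma (1/2) * norm (Gamma (Complex (Re s) (Im s)))"
    using assms by (intro norm_Gamma_ratio_mono) auto
  finally have le: "exp (- (pi / 2) * \<bar>Im s\<bar>) * Gamma (Re s) \<le> norm (Gamma s)"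
    by (simp add: Gamma_one_half_real)
  moreover have "norm (rGamma s) = inverse (norm (Gamma s))"
    by (simp add: rGamma_inverse_Gamma norm_inverse)
  moreover have "inverse (norm (Gamma s)) \<le> inverse (exp (- (pi / 2) * \<bar>Im s\<bar>) * Gamma (Re s))"
    using le g by (intro le_imp_inverse_le) auto
  ultimately show ?thesis by (simp add: exp_minus field_simps)
qed

text \<open>\<open>strip_bound \<kappa> f\<close> says that \<open>f\<close> decays like \<open>exp(-\<kappa> \<bar>Im s\<bar>)\<close>, up to a power of \<open>\<bar>Im s\<bar>\<close>, in every vertical strip. The
bound starts at a height \<open>Y\<close>, so poles at small height are no obstacle. Exponents add under products, which makes
the decay of a product of Gamma factors a matter of adding multiples of \<open>\<pi>/2\<close>.\<close>

definition strip_bound :: "real \<Rightarrow> (complex \<Rightarrow> complex) \<Rightarrow> bool" where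
  "strip_bound \<kappa> f \<longleftrightarrow> (\<forall>a b. \<exists>C N Y. 0 \<le> C \<and> (\<forall>u. a \<le> Re u \<longrightarrow> Re u \<le> b \<longrightarrow> Y \<le> \<bar>Im u\<bar> \<longrightarrow>
     norm (f u) \<le> C * (1 + \<bar>Im u\<bar>) ^ N * exp (- \<kappa> * \<bar>Im u\<bar>)))"

lemma strip_bound_mult:
  assumes "strip_bound \<kappa> f" "strip_bound \<mu> g"
  shows "strip_bound (\<kappa> + \<mu>) (\<lambda>s. f s * g s)"
  unfolding strip_bound_def
proof (intro allI)
  fix a b
  obtain C N Y where 1: "0 \<le> C" "\<And>u. a \<le> Re u \<Longrightarrow> Re u \<le> b \<Longrightarrow> Y \<le> \<bar>Im u\<bar> \<Longrightarrow>
     norm (f u) \<le> C * (1 + \<bar>Im u\<bar>) ^ N * exp (- \<kappa> * \<bar>Im u\<bar>)"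
    using assms(1) unfolding strip_bound_def by metis
  obtain D M Z where 2: "0 \<le> D" "\<And>u. a \<le> Re u \<Longrightarrow> Re u \<le> b \<Longrightarrow> Z \<le> \<bar>Im u\<bar> \<Longrightarrow>
     norm (g u) \<le> D * (1 + \<bar>Im u\<bar>) ^ M * exp (- \<mu> * \<bar>Im u\<bar>)"
    using assms(2) unfolding strip_bound_def by metis
  have "norm (f u * g u) \<le> (C * D) * (1 + \<bar>Im u\<bar>) ^ (N + M) * exp (- (\<kappa> + \<mu>) * \<bar>Im u\<bar>)"
    if "a \<le> Re u" "Re u \<le> b" "max Y Z \<le> \<bar>Im u\<bar>" for u
  proof -
    have "norm (f u * g u) \<le> (C * (1 + \<bar>Im u\<bar>) ^ N * exp (- \<kappa> * \<bar>Im u\<bar>)) *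
        (D * (1 + \<bar>Im u\<bar>) ^ M * exp (- \<mu> * \<bar>Im u\<bar>))"
      unfolding norm_mult using that 1 2 by (intro mult_mono) auto
    also have "\<dots> = (C * D) * (1 + \<bar>Im u\<bar>) ^ (N + M) * exp (- (\<kappa> + \<mu>) * \<bar>Im u\<bar>)"
      by (simp add: power_add algebra_simps flip: exp_add)
    finally show ?thesis .
  qed
  with 1(1) 2(1) show "\<exists>C N Y. 0 \<le> C \<and> (\<forall>u. a \<le> Re u \<longrightarrow> Re u \<le> b \<longrightarrow> Y \<le> \<bar>Im u\<bar> \<longrightarrow>
     norm (f u * g u) \<le> C * (1 + \<bar>Im u\<bar>) ^ N * exp (- (\<kappa> + \<mu>) * \<bar>Im u\<bar>))"
    by (intro exI[of _ "C * D"] exI[of _ "N + M"] exI[of _ "max Y Z"]) auto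
qed

lemma strip_bound_affine:
  fixes p q :: real
  assumes "strip_bound \<kappa> f" "q \<noteq> 0"
  shows "strip_bound (\<kappa> * \<bar>q\<bar>) (\<lambda>s. f (of_real p + of_real q * s))"
  unfolding strip_bound_def
proof (intro allI)
  fix a b
  define A where "A = min (p + q * a) (p + q * b)"
  define B where "B = max (p + q * a) (p + q * b)"
  obtain C N Y where 1: "0 \<le> C" "\<And>u. A \<le> Re u \<Longrightarrow> Re u \<le> B \<Longrightarrow> Y \<le> \<bar>Im u\<bar> \<Longrightarrow>
     norm (f u) \<le> C * (1 + \<bar>Im u\<bar>) ^ N * exp (- \<kappa> * \<bar>Im u\<bar>)"
    using assms(1) unfolding strip_bound_def by metis
  have "norm (f (of_real p + of_real q * u))
      \<le> (C * (1 + \<bar>q\<bar>) ^ N) * (1 + \<bar>Im u\<bar>) ^ N * exp (- (\<kappa> * \<bar>q\<bar>) * \<bar>Im u\<bar>)"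
    if u: "a \<le> Re u" "Re u \<le> b" "Y / \<bar>q\<bar> \<le> \<bar>Im u\<bar>" for u
  proof -
    define v where "v = of_real p + of_real q * u"
    have re: "Re v = p + q * Re u" and im: "\<bar>Im v\<bar> = \<bar>q\<bar> * \<bar>Im u\<bar>" by (simp_all add: v_def abs_mult)
    have "A \<le> Re v" "Re v \<le> B"
      using mult_left_mono[OF u(1), of q] mult_left_mono[OF u(2), of q]
        mult_left_mono_neg[OF u(1), of q] mult_left_mono_neg[OF u(2), of q]
      by (cases "q \<ge> 0"; simp add: re A_def B_def)+
    moreover have "Y \<le> \<bar>Im v\<bar>" using u(3) assms(2) by (simp add: im field_simps)
    ultimately have "norm (f v) \<le> C * (1 + \<bar>Im v\<bar>) ^ N * exp (- \<kappa> * \<bar>Im v\<bar>)" by (rule 1(2))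
    also have "\<dots> \<le> C * ((1 + \<bar>q\<bar>) * (1 + \<bar>Im u\<bar>)) ^ N * exp (- \<kappa> * \<bar>Im v\<bar>)"
      using 1(1) unfolding im
      by (intro mult_right_mono mult_left_mono power_mono) (auto simp: algebra_simps)
    finally show ?thesis
      unfolding im v_def[symmetric] by (simp add: power_mult_distrib mult_ac)
  qed
  then show "\<exists>C N Y. 0 \<le> C \<and> (\<forall>u. a \<le> Re u \<longrightarrow> Re u \<le> b \<longrightarrow> Y \<le> \<bar>Im u\<bar> \<longrightarrow>
     norm (f (of_real p + of_real q * u)) \<le> C * (1 + \<bar>Im u\<bar>) ^ N * exp (- (\<kappa> * \<bar>q\<bar>) * \<bar>Im u\<bar>))"
    using 1(1) by (intro exI[of _ "C * (1 + \<bar>q\<bar>) ^ N"] exI[of _ N] exI[of _ "Y / \<bar>q\<bar>"]) auto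
qed

lemma norm_pochhammer_le: "norm (pochhammer u n) \<le> (norm u + real n) ^ n" for u :: complex
proof -
  have "norm (pochhammer u n) = (\<Prod>i=0..<n. norm (u + of_nat i))"
    by (simp add: pochhammer_prod prod_norm)
  also have "\<dots> \<le> (\<Prod>i=0..<n. norm u + real n)"
    by (intro prod_mono) (auto intro!: order_trans[OF norm_triangle_ineq])
  finally show ?thesis by simp
qed

text \<open>The functional equation moves the strip to \<open>Re s \<ge> 1\<close> at the price of a polynomial factor; there \<open>norm_rGamma_le\<close> applies.\<close>

lemma strip_bound_rGamma: "strip_bound (- (pi / 2)) rGamma"
  unfolding strip_bound_def
proof (intro allI)
  fix a b :: real
  obtain M :: nat where M: "1 - a \<le> real M" using real_arch_simple by blast
  have "bounded (rGamma ` {1..b + real M})"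
    by (intro compact_imp_bounded compact_continuous_image continuous_intros) auto
  then obtain B where B: "B > 0" "\<And>x. x \<in> {1..b + real M} \<Longrightarrow> norm (rGamma x :: real) \<le> B"
    unfolding bounded_pos by auto
  define A where "A = \<bar>a\<bar> + \<bar>b\<bar> + real M + 1"
  have "norm (rGamma u) \<le> (A ^ M * B) * (1 + \<bar>Im u\<bar>) ^ M * exp (- (- (pi / 2)) * \<bar>Im u\<bar>)"
    if u: "a \<le> Re u" "Re u \<le> b" for u
  proof -
    let ?v = "u + of_nat M"
    have "norm u + real M \<le> \<bar>Re u\<bar> + \<bar>Im u\<bar> + real M" using cmod_le by auto
    also have "\<dots> \<le> A + \<bar>Im u\<bar>" using u by (auto simp: A_def)
    also have "\<dots> \<le> A * (1 + \<bar>Im u\<bar>)" by (auto simp: A_def algebra_simps)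
    finally have "norm (pochhammer u M) \<le> (A * (1 + \<bar>Im u\<bar>)) ^ M"
      by (intro order_trans[OF norm_pochhammer_le] power_mono) auto
    moreover have "norm (rGamma ?v) \<le> B * exp (pi / 2 * \<bar>Im u\<bar>)"
    proof -
      have "norm (rGamma ?v) \<le> exp (pi / 2 * \<bar>Im u\<bar>) / Gamma (Re ?v)"
        using norm_rGamma_le[of ?v] u M by simp
      also have "\<dots> = rGamma (Re ?v) * exp (pi / 2 * \<bar>Im u\<bar>)"
        by (simp add: rGamma_inverse_Gamma field_simps)
      also have "\<dots> \<le> B * exp (pi / 2 * \<bar>Im u\<bar>)"
        using B(2)[of "Re ?v"] u M by (intro mult_right_mono) auto
      finally show ?thesis .
    qed
    ultimately have "norm (rGamma u) \<le> (A * (1 + \<bar>Im u\<bar>)) ^ M * (B * exp (pi / 2 * \<bar>Im u\<bar>))"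
      unfolding pochhammer_rGamma[of u M] norm_mult by (intro mult_mono) (auto simp: A_def)
    then show ?thesis by (simp add: power_mult_distrib mult_ac)
  qed
  then show "\<exists>C N Y. 0 \<le> C \<and> (\<forall>u. a \<le> Re u \<longrightarrow> Re u \<le> b \<longrightarrow> Y \<le> \<bar>Im u\<bar> \<longrightarrow>
     norm (rGamma u) \<le> C * (1 + \<bar>Im u\<bar>) ^ N * exp (- (- (pi / 2)) * \<bar>Im u\<bar>))"
    using B(1) by (intro exI[of _ "A ^ M * B"] exI[of _ M] exI[of _ 0]) (auto simp: A_def)
qed

text \<open>Shifting to the right by an integer does not decrease \<open>\<bar>\<Gamma>\<bar>\<close> where \<open>\<bar>Im s\<bar> \<ge> 1\<close>. In the shifted strip \<open>\<Gamma>\<close> is compared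
with a line \<open>Re s = N + 1/2\<close>, which the functional equation connects to \<open>Re s = 1/2\<close>.\<close>

lemma strip_bound_Gamma: "strip_bound (pi / 2) Gamma"
  unfolding strip_bound_def
proof (intro allI)
  fix a b :: real
  obtain M :: nat where M: "1 - a \<le> real M" using real_arch_simple by blast
  obtain N :: nat where N: "b + real M \<le> real N" using real_arch_simple by blast
  have "bounded ((Gamma :: real \<Rightarrow> real) ` {1..b + real M})"
  proof (intro compact_imp_bounded compact_continuous_image continuous_on_Gamma)
    show "{1..b + real M} \<inter> \<int>\<^sub>\<le>\<^sub>0 = {}"
      by (auto elim!: nonpos_Ints_cases)
  qed auto
  then obtain B where B: "B > 0" "\<And>x. x \<in> {1..b + real M} \<Longrightarrow> norm (Gamma x :: real) \<le> B"
    unfolding bounded_pos by auto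
  define D where "D = Gamma (1/2 + real N)"
  have D: "D > 0" unfolding D_def by (intro Gamma_real_pos) auto
  have "norm (Gamma u) \<le> (B / D * sqrt (2 * pi) * (real N + 1) ^ N) * (1 + \<bar>Im u\<bar>) ^ N
          * exp (- (pi / 2) * \<bar>Im u\<bar>)"
    if u: "a \<le> Re u" "Re u \<le> b" "1 \<le> \<bar>Im u\<bar>" for u
  proof -
    let ?y = "Im u"
    let ?v = "u + of_nat M" and ?h = "Complex (1/2) (Im u)"
    have notint: "w \<notin> \<int>\<^sub>\<le>\<^sub>0" if "Im w = ?y" for w :: complex
      using that u(3) by (auto elim!: nonpos_Ints_cases)
    have "norm (Gamma u) \<le> norm (Gamma ?v)"
    proof -
      have "1 \<le> norm (pochhammer u M)"
      proof -
        have "norm (pochhammer u M) = (\<Prod>i=0..<M. norm (u + of_nat i))"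
          by (simp add: pochhammer_prod prod_norm)
        also have "1 \<le> \<dots>"
        proof (intro prod_ge_1)
          fix i assume "i \<in> {0..<M}"
          show "1 \<le> norm (u + of_nat i)" using u(3) abs_Im_le_cmod[of "u + of_nat i"] by simp
        qed
        finally show ?thesis .
      qed
      moreover have "Gamma ?v = pochhammer u M * Gamma u"
        using pochhammer_Gamma[OF notint[of u], of M] Gamma_eq_zero_iff[of u] notint[of u] by simp
      ultimately show ?thesis by (simp add: norm_mult mult_le_cancel_right1)
    qed
    also have "norm (Gamma ?v) \<le> B / D * norm (Gamma (?h + of_nat N))"
    proof -
      have "norm (Gamma (Complex (Re ?v) ?y)) * D
          \<le> Gamma (Re ?v) * norm (Gamma (Complex (1/2 + real N) ?y))"
        unfolding D_def using u M N by (intro norm_Gamma_ratio_mono) auto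
      also have "\<dots> \<le> B * norm (Gamma (Complex (1/2 + real N) ?y))"
        using B(2)[of "Re ?v"] u M by (intro mult_right_mono) auto
      also have "Complex (1/2 + real N) ?y = ?h + of_nat N" by (simp add: complex_eq_iff)
      also have "Complex (Re ?v) ?y = ?v" by (simp add: complex_eq_iff)
      finally show ?thesis using D by (simp add: field_simps)
    qed
    also have "\<dots> \<le> B / D * (((real N + 1) * (1 + \<bar>?y\<bar>)) ^ N *
        (sqrt (2 * pi) * exp (- (pi / 2) * \<bar>?y\<bar>)))"
    proof (rule mult_left_mono)
      have "Gamma (?h + of_nat N) = pochhammer ?h N * Gamma ?h"
        using pochhammer_Gamma[OF notint[of ?h], of N] Gamma_eq_zero_iff[of ?h] notint[of ?h] by simp
      moreover have "norm (pochhammer ?h N) \<le> ((real N + 1) * (1 + \<bar>?y\<bar>)) ^ N"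
      proof (intro order_trans[OF norm_pochhammer_le] power_mono)
        have nh: "norm ?h \<le> 1/2 + \<bar>?y\<bar>" using cmod_le[of ?h] by simp
        show "norm ?h + real N \<le> (real N + 1) * (1 + \<bar>?y\<bar>)"
        proof -
          have "(real N + 1) * (1 + \<bar>?y\<bar>) = real N + 1 + \<bar>?y\<bar> + real N * \<bar>?y\<bar>"
            by (simp add: algebra_simps)
          moreover have "0 \<le> real N * \<bar>?y\<bar>" by simp
          ultimately show ?thesis using nh by linarith
        qed
      qed auto
      ultimately show "norm (Gamma (?h + of_nat N)) \<le> ((real N + 1) * (1 + \<bar>?y\<bar>)) ^ N *
        (sqrt (2 * pi) * exp (- (pi / 2) * \<bar>?y\<bar>))" using norm_Gamma_half_upper[of ?y]
        by (auto simp: norm_mult intro!: mult_mono)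
    qed (use B D in auto)
    finally show ?thesis by (simp add: power_mult_distrib mult_ac)
  qed
  then show "\<exists>C N Y. 0 \<le> C \<and> (\<forall>u. a \<le> Re u \<longrightarrow> Re u \<le> b \<longrightarrow> Y \<le> \<bar>Im u\<bar> \<longrightarrow>
     norm (Gamma u) \<le> C * (1 + \<bar>Im u\<bar>) ^ N * exp (- (pi / 2) * \<bar>Im u\<bar>))"
    using B(1) D by (intro exI[of _ "B / D * sqrt (2 * pi) * (real N + 1) ^ N"] exI[of _ N] exI[of _ 1]) auto
qed

lemma norm_sin_pi_ge: "\<bar>sin (pi * Re u)\<bar> * exp (pi * \<bar>Im u\<bar>) / 2 \<le> norm (sin (of_real pi * u))"
proof -
  have "norm (sin (of_real pi * u))^2 = (sin (pi * Re u))\<^sup>2 + (sinh (pi * Im u))\<^sup>2"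
  proof -
    have "(norm (sin (of_real pi * u)))\<^sup>2 = (sin (pi * Re u) * cosh (pi * Im u))\<^sup>2
        + (cos (pi * Re u) * sinh (pi * Im u))\<^sup>2"
      by (simp add: cmod_power2 Re_sin Im_sin cosh_def sinh_def exp_minus)
    also have "\<dots> = (sin (pi * Re u))\<^sup>2 * (1 + (sinh (pi * Im u))\<^sup>2)
        + (1 - (sin (pi * Re u))\<^sup>2) * (sinh (pi * Im u))\<^sup>2"
      by (simp add: power_mult_distrib cosh_square_eq cos_squared_eq)
    finally show ?thesis by (simp add: algebra_simps)
  qed
  also have "\<dots> \<ge> (sin (pi * Re u))\<^sup>2 * (1 + (sinh (pi * Im u))\<^sup>2)"
  proof -
    have "(sin (pi * Re u))\<^sup>2 * (sinh (pi * Im u))\<^sup>2 \<le> 1 * (sinh (pi * Im u))\<^sup>2"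
      by (intro mult_right_mono) (auto simp: abs_square_le_1)
    then show ?thesis by (simp add: algebra_simps)
  qed
  also have "(sin (pi * Re u))\<^sup>2 * (1 + (sinh (pi * Im u))\<^sup>2) = (\<bar>sin (pi * Re u)\<bar> * cosh (pi * Im u))\<^sup>2"
    by (simp add: power_mult_distrib cosh_square_eq)
  finally have "\<bar>sin (pi * Re u)\<bar> * cosh (pi * Im u) \<le> norm (sin (of_real pi * u))"
    by (rule power2_le_imp_le) auto
  moreover have "\<bar>sin (pi * Re u)\<bar> * (exp \<bar>pi * Im u\<bar> / 2) \<le> \<bar>sin (pi * Re u)\<bar> * cosh (pi * Im u)"
    by (intro mult_left_mono cosh_bounds) auto
  ultimately show ?thesis by (simp add: abs_mult)
qed

text \<open>Reflection bounds \<open>\<Gamma>\<close> on vertical lines between its poles; the sine measures how far the line keeps away from them, and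
the value of \<open>\<Gamma>\<close> in the denominator makes the bound small far to the left. The exponent is \<open>\<pi>/2\<close>, since the growth
\<open>exp(\<pi> \<bar>Im u\<bar> / 2)\<close> of \<open>1/\<Gamma>\<close> uses up half of the decay of \<open>1/sin\<close>.\<close>

lemma norm_Gamma_reflected_le:
  fixes h :: real
  assumes "sin (pi * (Re u - h)) \<noteq> 0" "Re u + 1 - h \<ge> 1/2"
  shows "norm (Gamma (of_real h - u)) \<le> 2 * pi / \<bar>sin (pi * (Re u - h))\<bar>
           * exp (- (pi / 2) * \<bar>Im u\<bar>) / Gamma (Re u + 1 - h)"
proof -
  let ?z = "of_real h - u"
  have s: "\<bar>sin (pi * (Re u - h))\<bar> * exp (pi * \<bar>Im u\<bar>) / 2 \<le> norm (sin (of_real pi * ?z))"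
    using norm_sin_pi_ge[of ?z] sin_minus[of "pi * (Re u - h)"]
    by (simp add: algebra_simps minus_mult_right[symmetric])
  have "0 < \<bar>sin (pi * (Re u - h))\<bar> * exp (pi * \<bar>Im u\<bar>) / 2" using assms(1) by simp
  then have s0: "sin (of_real pi * ?z) \<noteq> 0" using s by (metis less_le_trans zero_less_norm_iff)
  have inverse_eq: "inverse x = p * y / S" if "x * y = S / p" "S \<noteq> 0" "p \<noteq> 0" for x y p S :: complex
    using that by (auto simp: field_simps)
  have "Gamma ?z = of_real pi * rGamma (1 - ?z) / sin (of_real pi * ?z)"
    unfolding Gamma_def by (rule inverse_eq[OF rGamma_reflection_complex s0]) simp
  then have "norm (Gamma ?z) = pi * norm (rGamma (1 - ?z)) / norm (sin (of_real pi * ?z))"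
    by (simp add: norm_mult norm_divide)
  also have "\<dots> \<le> pi * (exp (pi / 2 * \<bar>Im u\<bar>) / Gamma (Re u + 1 - h))
      / (\<bar>sin (pi * (Re u - h))\<bar> * exp (pi * \<bar>Im u\<bar>) / 2)"
  proof (intro frac_le mult_left_mono s)
    show "norm (rGamma (1 - ?z)) \<le> exp (pi / 2 * \<bar>Im u\<bar>) / Gamma (Re u + 1 - h)"
      using norm_rGamma_le[of "1 - ?z"] assms(2) by (simp add: algebra_simps)
    show "0 \<le> pi * (exp (pi / 2 * \<bar>Im u\<bar>) / Gamma (Re u + 1 - h))"
      using assms(2) by (intro mult_nonneg_nonneg divide_nonneg_nonneg Gamma_real_nonneg) auto
  qed (use assms(1) in auto)
  also have "\<dots> = 2 * pi / \<bar>sin (pi * (Re u - h))\<bar>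
           * (exp (pi / 2 * \<bar>Im u\<bar>) / exp (pi * \<bar>Im u\<bar>)) / Gamma (Re u + 1 - h)"
    by (simp add: field_simps)
  also have "exp (pi / 2 * \<bar>Im u\<bar>) / exp (pi * \<bar>Im u\<bar>) = exp (- (pi / 2) * \<bar>Im u\<bar>)"
    by (simp flip: exp_diff add: algebra_simps)
  finally show ?thesis .
qed

section \<open>Moving a vertical line of integration\<close>

abbreviation vline_int :: "real \<Rightarrow> (complex \<Rightarrow> complex) \<Rightarrow> complex" where
  "vline_int a f \<equiv> (LINT y|lborel. f (Complex a y))"

lemma continuous_on_vline:
  assumes "\<And>y. isCont f (Complex a y)"
  shows "continuous_on UNIV (\<lambda>y. f (Complex a y))"
proof -
  have "continuous_on UNIV (\<lambda>y. Complex a y)"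
    unfolding Complex_eq by (intro continuous_intros)
  moreover have "continuous_on (range (Complex a)) f"
    using assms by (intro continuous_at_imp_continuous_on) auto
  ultimately show ?thesis by (intro continuous_on_compose2[where f = "Complex a" and g = f]) auto
qed

lemma integrable_exp_neg_abs:
  assumes "\<eta> > (0 :: real)"
  shows "integrable lborel (\<lambda>y::real. exp (- \<eta> * \<bar>y\<bar>))"
proof -
  have "set_integrable lborel {0..} (\<lambda>y::real. exp (- \<eta> * y))"
  proof -
    have "((\<lambda>y::real. exp (- \<eta> * y)) has_integral exp (- \<eta> * 0) / \<eta>) {0..}"
      using has_integral_exp_minus_to_infinity[OF assms, of 0] by simp
    then have "(\<lambda>y::real. exp (- \<eta> * y)) absolutely_integrable_on {0..}"
      by (intro nonnegative_absolutely_integrable_1) (auto intro: has_integral_integrable)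
    then show ?thesis
      unfolding set_integrable_def by (rule integrable_completion[THEN iffD1, rotated]) auto
  qed
  then have p: "integrable lborel (\<lambda>y::real. indicator {0..} y * exp (- \<eta> * y))"
    unfolding set_integrable_def by simp
  have m: "integrable lborel (\<lambda>y::real. indicator {0..} (- y) * exp (- \<eta> * (- y)))"
    using lborel_integrable_real_affine[OF p, of "-1" 0] by simp
  show ?thesis
    by (rule Bochner_Integration.integrable_bound[OF Bochner_Integration.integrable_add[OF p m]])
      (auto simp: indicator_def)
qed

lemma strip_bound_exp:
  assumes "strip_bound \<kappa> f" "\<eta> < \<kappa>"
  shows "\<exists>C Y. \<forall>u. a \<le> Re u \<longrightarrow> Re u \<le> b \<longrightarrow> Y \<le> \<bar>Im u\<bar> \<longrightarrow> norm (f u) \<le> C * exp (- \<eta> * \<bar>Im u\<bar>)"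
proof -
  obtain C N Y where 1: "0 \<le> C" "\<And>u. a \<le> Re u \<Longrightarrow> Re u \<le> b \<Longrightarrow> Y \<le> \<bar>Im u\<bar> \<Longrightarrow>
     norm (f u) \<le> C * (1 + \<bar>Im u\<bar>) ^ N * exp (- \<kappa> * \<bar>Im u\<bar>)"
    using assms(1) unfolding strip_bound_def by metis
  have "((\<lambda>y::real. (1 + y) ^ N * exp (- (\<kappa> - \<eta>) * y)) \<longlongrightarrow> 0) at_top"
    using assms(2) by real_asymp
  then have "eventually (\<lambda>y::real. (1 + y) ^ N * exp (- (\<kappa> - \<eta>) * y) < 1) at_top"
    by (rule order_tendstoD) simp
  then obtain Z where Z: "\<And>y. Z \<le> y \<Longrightarrow> (1 + y) ^ N * exp (- (\<kappa> - \<eta>) * y) < (1::real)"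
    by (auto simp: eventually_at_top_linorder)
  have "norm (f u) \<le> C * exp (- \<eta> * \<bar>Im u\<bar>)"
    if u: "a \<le> Re u" "Re u \<le> b" "max Y Z \<le> \<bar>Im u\<bar>" for u
  proof -
    have "norm (f u) \<le> C * (1 + \<bar>Im u\<bar>) ^ N * exp (- \<kappa> * \<bar>Im u\<bar>)" using u by (intro 1) auto
    also have "exp (- \<kappa> * \<bar>Im u\<bar>) = exp (- (\<kappa> - \<eta>) * \<bar>Im u\<bar>) * exp (- \<eta> * \<bar>Im u\<bar>)"
      by (simp flip: exp_add add: algebra_simps)
    also have "C * (1 + \<bar>Im u\<bar>) ^ N * \<dots>
        = C * ((1 + \<bar>Im u\<bar>) ^ N * exp (- (\<kappa> - \<eta>) * \<bar>Im u\<bar>)) * exp (- \<eta> * \<bar>Im u\<bar>)" by simp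
    also have "\<dots> \<le> C * 1 * exp (- \<eta> * \<bar>Im u\<bar>)"
      using Z[of "\<bar>Im u\<bar>"] u 1(1) by (intro mult_right_mono mult_left_mono) auto
    finally show ?thesis by simp
  qed
  then show ?thesis by blast
qed

lemma integrable_vline:
  assumes sb: "strip_bound \<kappa> f" and "0 < \<kappa>" and cont: "\<And>y. isCont f (Complex a y)"
  shows "integrable lborel (\<lambda>y. f (Complex a y))"
proof -
  obtain C Y where C: "\<And>y. Y \<le> \<bar>y\<bar> \<Longrightarrow> norm (f (Complex a y)) \<le> C * exp (- (\<kappa>/2) * \<bar>y\<bar>)"
  proof -
    obtain C Y where *: "\<forall>u. a \<le> Re u \<longrightarrow> Re u \<le> a \<longrightarrow> Y \<le> \<bar>Im u\<bar> \<longrightarrow>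
        norm (f u) \<le> C * exp (- (\<kappa>/2) * \<bar>Im u\<bar>)"
      using strip_bound_exp[OF sb, of "\<kappa>/2" a a] \<open>0 < \<kappa>\<close> by auto
    show ?thesis by (rule that[of Y C]) (use *[rule_format, of "Complex a _"] in auto)
  qed
  note c = continuous_on_vline[OF cont]
  have "bounded ((\<lambda>y. f (Complex a y)) ` {-Y..Y})"
    by (intro compact_imp_bounded compact_continuous_image continuous_on_subset[OF c]) auto
  then obtain B where B: "B > 0" "\<And>y. y \<in> {-Y..Y} \<Longrightarrow> norm (f (Complex a y)) \<le> B"
    unfolding bounded_pos by auto
  have "integrable lborel (\<lambda>y. \<bar>C\<bar> * exp (- (\<kappa>/2) * \<bar>y\<bar>) + B * exp (\<kappa>/2 * Y) * exp (- (\<kappa>/2) * \<bar>y\<bar>))"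
    using \<open>0 < \<kappa>\<close> by (intro Bochner_Integration.integrable_add integrable_mult_right
        integrable_exp_neg_abs) auto
  then show ?thesis
  proof (rule Bochner_Integration.integrable_bound)
    show "(\<lambda>y. f (Complex a y)) \<in> borel_measurable lborel"
      using borel_measurable_continuous_onI[OF c] by simp
    have "norm (f (Complex a y)) \<le> \<bar>C\<bar> * exp (- (\<kappa>/2) * \<bar>y\<bar>) + B * exp (\<kappa>/2 * Y) * exp (- (\<kappa>/2) * \<bar>y\<bar>)"
      for y
    proof (cases "Y \<le> \<bar>y\<bar>")
      case True
      have "norm (f (Complex a y)) \<le> C * exp (- (\<kappa>/2) * \<bar>y\<bar>)" by (rule C[OF True])
      also have "\<dots> \<le> \<bar>C\<bar> * exp (- (\<kappa>/2) * \<bar>y\<bar>)" by (intro mult_right_mono) auto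
      finally show ?thesis using B(1) by (simp add: add_increasing2)
    next
      case False
      then have "y \<in> {-Y..Y}" by auto
      then have "norm (f (Complex a y)) \<le> B * 1" using B(2)[of y] by simp
      also have "1 \<le> exp (\<kappa>/2 * Y) * exp (- (\<kappa>/2) * \<bar>y\<bar>)"
        using False \<open>0 < \<kappa>\<close> by (simp flip: exp_add add: mult_left_mono)
      finally show ?thesis using B(1) by (simp add: add_increasing mult.assoc mult_left_mono)
    qed
    then show "AE y in lborel. norm (f (Complex a y))
        \<le> norm (\<bar>C\<bar> * exp (- (\<kappa>/2) * \<bar>y\<bar>) + B * exp (\<kappa>/2 * Y) * exp (- (\<kappa>/2) * \<bar>y\<bar>))"
      by (intro AE_I2) (auto intro: order_trans[OF _ abs_ge_self])
  qed
qed

text \<open>Contour integrals are gauge integrals over segments, the vertical line integrals are Lebesgue integrals; this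
passes from the ones to the others.\<close>

lemma tendsto_interval_integral_lborel:
  fixes g :: "real \<Rightarrow> complex"
  assumes "integrable lborel g"
  shows "(\<lambda>n. integral {- real n..real n} g) \<longlonglongrightarrow> (LINT y|lborel. g y)"
proof -
  have m: "g \<in> borel_measurable borel" using borel_measurable_integrable[OF assms] by simp
  have "(\<lambda>n. LINT y|lborel. indicator {- real n..real n} y *\<^sub>R g y) \<longlonglongrightarrow> (LINT y|lborel. g y)"
  proof (rule integral_dominated_convergence[where w = "\<lambda>y. norm (g y)"])
    show "integrable lborel (\<lambda>y. norm (g y))" using assms by simp
    show "AE y in lborel. (\<lambda>n. indicator {- real n..real n} y *\<^sub>R g y) \<longlonglongrightarrow> g y"
    proof (intro AE_I2 tendsto_eventually)
      fix y :: real
      obtain N :: nat where "\<bar>y\<bar> \<le> real N" using real_arch_simple by blast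
      then show "eventually (\<lambda>n. indicator {- real n..real n} y *\<^sub>R g y = g y) sequentially"
        by (intro eventually_sequentiallyI[of N]) (auto simp: indicator_def)
    qed
  qed (use m in \<open>auto simp: indicator_def\<close>)
  moreover have "(LINT y|lborel. indicator {- real n..real n} y *\<^sub>R g y) = integral {- real n..real n} g" for n
  proof -
    have "set_integrable lborel {- real n..real n} g"
      unfolding set_integrable_def by (intro integrable_mult_indicator assms) auto
    from set_borel_integral_eq_integral(2)[OF this] show ?thesis
      unfolding set_lebesgue_integral_def .
  qed
  ultimately show ?thesis by simp
qed

text \<open>Cauchy's residue theorem on rectangles with corners at height \<open>\<plusminus>n\<close>; the horizontal sides disappear in the limit because
of the exponential decay in the strip. In the positive orientation the right edge is run upwards and the left edge
downwards, hence the minus sign.\<close>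

lemma vline_shift_residues:
  fixes f :: "complex \<Rightarrow> complex"
  assumes "open S" and strip: "\<And>s. a \<le> Re s \<Longrightarrow> Re s \<le> b \<Longrightarrow> s \<in> S" and "convex S"
    and "a < b" and fin: "finite pts" and holo: "f holomorphic_on S - pts"
    and pts: "\<And>p. p \<in> pts \<Longrightarrow> a < Re p \<and> Re p < b"
    and sb: "strip_bound \<kappa> f" and "0 < \<kappa>"
  shows "integrable lborel (\<lambda>y. f (Complex a y))" "integrable lborel (\<lambda>y. f (Complex b y))"
    and "vline_int a f = vline_int b f - 2 * of_real pi * (\<Sum>p\<in>pts. residue f p)"
proof -
  have op: "open (S - pts)" using \<open>open S\<close> fin by (simp add: open_Diff finite_imp_closed)
  have cont: "isCont f s" if "a \<le> Re s" "Re s \<le> b" "s \<notin> pts" for s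
    using holomorphic_on_imp_continuous_on[OF holo] continuous_on_eq_continuous_at[OF op] strip that
    by blast
  have ca: "isCont f (Complex a y)" and cb: "isCont f (Complex b y)" for y
    using pts[of "Complex a y"] pts[of "Complex b y"] \<open>a < b\<close> by (auto intro!: cont)
  show ia: "integrable lborel (\<lambda>y. f (Complex a y))"
    and ib: "integrable lborel (\<lambda>y. f (Complex b y))"
    by (rule integrable_vline[OF sb \<open>0 < \<kappa>\<close>], rule ca cb)+
  obtain C Y where CY: "\<And>u. a \<le> Re u \<Longrightarrow> Re u \<le> b \<Longrightarrow> Y \<le> \<bar>Im u\<bar> \<Longrightarrow>
      norm (f u) \<le> C * exp (- (\<kappa>/2) * \<bar>Im u\<bar>)"
    using strip_bound_exp[OF sb, of "\<kappa>/2" a b] \<open>0 < \<kappa>\<close> by (auto simp del: mult_minus_left)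
  define P where "P = Max (insert 0 ((\<lambda>p. \<bar>Im p\<bar>) ` pts))"
  have P: "\<bar>Im p\<bar> \<le> P" if "p \<in> pts" for p
    unfolding P_def using fin that by (intro Max_ge) auto
  obtain n0 :: nat where n0: "max Y (P + 1) \<le> real n0" using real_arch_simple by blast
  have P0: "0 \<le> P" unfolding P_def using fin by (intro Max_ge) auto
  define hor where "hor t = contour_integral (linepath (Complex a t) (Complex b t)) f" for t
  have rect: "\<i> * integral {-real n..real n} (\<lambda>y. f (Complex b y))
      - \<i> * integral {-real n..real n} (\<lambda>y. f (Complex a y)) + hor (- real n) - hor (real n)
      = 2 * of_real pi * \<i> * (\<Sum>p\<in>pts. residue f p)" if n: "n0 \<le> n" for n
  proof -
    let ?T = "real n"
    have T: "Y \<le> ?T" "P + 1 \<le> ?T" "0 < ?T" using n n0 P0 by (auto simp: max_def split: if_splits)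
    let ?A = "Complex a (- ?T)" and ?B = "Complex b (- ?T)" and ?C = "Complex b ?T" and ?D = "Complex a ?T"
    have sub: "path_image (rectpath ?A ?C) \<subseteq> S - pts"
    proof
      fix s assume s: "s \<in> path_image (rectpath ?A ?C)"
      then have "s \<in> cbox ?A ?C"
        using path_image_rectpath_subset_cbox[of ?A ?C] \<open>a < b\<close> T by auto
      then have "a \<le> Re s" "Re s \<le> b" by (auto simp: in_cbox_complex_iff)
      moreover have "s \<notin> pts"
      proof
        assume p: "s \<in> pts"
        then have "s \<in> box ?A ?C" using pts[OF p] P[OF p] T by (auto simp: in_box_complex_iff)
        then show False using path_image_rectpath_inter_box[of ?A ?C] s \<open>a < b\<close> T by auto
      qed
      ultimately show "s \<in> S - pts" using strip by auto
    qed
    have "contour_integral (rectpath ?A ?C) f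
        = 2 * pi * \<i> * (\<Sum>p\<in>pts. winding_number (rectpath ?A ?C) p * residue f p)"
    proof (rule Residue_theorem[OF \<open>open S\<close> convex_connected[OF \<open>convex S\<close>] fin holo])
      show "\<forall>z. z \<notin> S \<longrightarrow> winding_number (rectpath ?A ?C) z = 0"
        using sub \<open>convex S\<close>
        by (intro allI impI winding_number_zero_outside[of _ S]) auto
    qed (use sub in auto)
    also have "(\<Sum>p\<in>pts. winding_number (rectpath ?A ?C) p * residue f p) = (\<Sum>p\<in>pts. residue f p)"
    proof (rule sum.cong)
      fix p assume p: "p \<in> pts"
      then have "p \<in> box ?A ?C" using pts[OF p] P[OF p] T by (auto simp: in_box_complex_iff)
      then show "winding_number (rectpath ?A ?C) p * residue f p = residue f p"
        by (simp add: winding_number_rectpath)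
    qed simp
    also have "contour_integral (rectpath ?A ?C) f = contour_integral (linepath ?A ?B) f
        + contour_integral (linepath ?B ?C) f + contour_integral (linepath ?C ?D) f
        + contour_integral (linepath ?D ?A) f"
    proof -
      have pi: "path_image (rectpath ?A ?C) = closed_segment ?A ?B \<union> closed_segment ?B ?C
          \<union> closed_segment ?C ?D \<union> closed_segment ?D ?A"
        by (auto simp: rectpath_def Let_def path_image_join)
      have ci: "f contour_integrable_on linepath u v" if "closed_segment u v \<subseteq> S - pts" for u v
        using holo that by (intro contour_integrable_continuous_linepath
            continuous_on_subset[OF holomorphic_on_imp_continuous_on])
      have "f contour_integrable_on linepath ?A ?B" "f contour_integrable_on linepath ?B ?C"
        "f contour_integrable_on linepath ?C ?D" "f contour_integrable_on linepath ?D ?A"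
        using sub unfolding pi by (auto intro!: ci)
      then show ?thesis unfolding rectpath_def Let_def by (simp add: contour_integrable_joinI add.assoc)
    qed
    also have "contour_integral (linepath ?B ?C) f = \<i> * integral {-?T..?T} (\<lambda>y. f (Complex b y))"
      using contour_integral_linepath_same_Re[of ?B b ?C "- ?T" ?T f] T by simp
    also have "contour_integral (linepath ?D ?A) f = - (\<i> * integral {-?T..?T} (\<lambda>y. f (Complex a y)))"
    proof -
      have "contour_integral (linepath ?D ?A) f = - contour_integral (linepath ?A ?D) f"
        using contour_integral_reversepath[of "linepath ?A ?D" f] by simp
      then show ?thesis using contour_integral_linepath_same_Re[of ?A a ?D "- ?T" ?T f] T by simp
    qed
    also have "contour_integral (linepath ?C ?D) f = - hor ?T"
      using contour_integral_reversepath[of "linepath ?D ?C" f] by (simp add: hor_def)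
    finally show ?thesis by (simp add: hor_def algebra_simps)
  qed
  have hor_bound: "norm (hor t) \<le> \<bar>C\<bar> * exp (- (\<kappa>/2) * \<bar>t\<bar>) * (b - a)" if t: "max Y (P + 1) \<le> \<bar>t\<bar>" for t
  proof -
    have seg: "a \<le> Re s \<and> Re s \<le> b \<and> Im s = t" if "s \<in> closed_segment (Complex a t) (Complex b t)" for s
      using that \<open>a < b\<close> by (auto simp: closed_segment_same_Im closed_segment_eq_real_ivl)
    have nz: "s \<notin> pts" if "Im s = t" for s using P[of s] t that by auto
    have "f contour_integrable_on linepath (Complex a t) (Complex b t)"
      using seg nz by (intro contour_integrable_continuous_linepath continuous_at_imp_continuous_on
          ballI cont) blast+
    then have "norm (hor t) \<le> \<bar>C\<bar> * exp (- (\<kappa>/2) * \<bar>t\<bar>) * norm (Complex b t - Complex a t)"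
      unfolding hor_def
    proof (rule contour_integral_bound_linepath)
      fix s assume "s \<in> closed_segment (Complex a t) (Complex b t)"
      then have "norm (f s) \<le> C * exp (- (\<kappa>/2) * \<bar>t\<bar>)" using CY[of s] seg[of s] t by auto
      also have "\<dots> \<le> \<bar>C\<bar> * exp (- (\<kappa>/2) * \<bar>t\<bar>)" by (intro mult_right_mono) auto
      finally show "norm (f s) \<le> \<bar>C\<bar> * exp (- (\<kappa>/2) * \<bar>t\<bar>)" .
    qed auto
    also have "norm (Complex b t - Complex a t) = b - a" using \<open>a < b\<close> by (simp add: cmod_def)
    finally show ?thesis .
  qed
  have dec: "(\<lambda>n. \<bar>C\<bar> * exp (- (\<kappa>/2) * \<bar>real n\<bar>) * (b - a)) \<longlonglongrightarrow> 0"
    using \<open>0 < \<kappa>\<close> by real_asymp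
  have hp: "(\<lambda>n. hor (real n)) \<longlonglongrightarrow> 0"
  proof (rule Lim_null_comparison[OF eventually_sequentiallyI[of n0] dec])
    show "norm (hor (real n)) \<le> \<bar>C\<bar> * exp (- (\<kappa>/2) * \<bar>real n\<bar>) * (b - a)" if "n0 \<le> n" for n
      using hor_bound[of "real n"] n0 that by simp
  qed
  have hm: "(\<lambda>n. hor (- real n)) \<longlonglongrightarrow> 0"
  proof (rule Lim_null_comparison[OF eventually_sequentiallyI[of n0] dec])
    show "norm (hor (- real n)) \<le> \<bar>C\<bar> * exp (- (\<kappa>/2) * \<bar>real n\<bar>) * (b - a)" if "n0 \<le> n" for n
      using hor_bound[of "- real n"] n0 that by simp
  qed
  have "(\<lambda>n. \<i> * integral {-real n..real n} (\<lambda>y. f (Complex b y))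
      - \<i> * integral {-real n..real n} (\<lambda>y. f (Complex a y)) + hor (- real n) - hor (real n))
      \<longlonglongrightarrow> \<i> * vline_int b f - \<i> * vline_int a f + 0 - 0"
    by (intro tendsto_intros tendsto_interval_integral_lborel ia ib hp hm)
  moreover have "(\<lambda>n. \<i> * integral {-real n..real n} (\<lambda>y. f (Complex b y))
      - \<i> * integral {-real n..real n} (\<lambda>y. f (Complex a y)) + hor (- real n) - hor (real n))
      \<longlonglongrightarrow> 2 * of_real pi * \<i> * (\<Sum>p\<in>pts. residue f p)"
    by (rule tendsto_eventually, rule eventually_sequentiallyI[of n0], rule rect)
  ultimately have "\<i> * vline_int b f - \<i> * vline_int a f = 2 * of_real pi * \<i> * (\<Sum>p\<in>pts. residue f p)"
    using LIMSEQ_unique by fastforce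
  then have "\<i> * (vline_int a f) = \<i> * (vline_int b f - 2 * of_real pi * (\<Sum>p\<in>pts. residue f p))"
    by (simp add: algebra_simps)
  then show "vline_int a f = vline_int b f - 2 * of_real pi * (\<Sum>p\<in>pts. residue f p)"
    by simp
qed

section \<open>Real powers with complex exponent and residues of Gamma factors\<close>

text \<open>\<open>x^s\<close> for \<open>x > 0\<close>. Defined through \<open>exp\<close> and the real logarithm, it is entire in \<open>s\<close> and jointly measurable without case
distinctions.\<close>

definition rpow :: "real \<Rightarrow> complex \<Rightarrow> complex" where
  "rpow x s = exp (s * of_real (ln x))"

lemma norm_rpow: "x > 0 \<Longrightarrow> norm (rpow x s) = x powr Re s"
  by (simp add: rpow_def powr_def)

lemma rpow_of_real: "x > 0 \<Longrightarrow> rpow x (of_real a) = of_real (x powr a)"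
  by (simp add: rpow_def powr_def flip: exp_of_real)

lemma rpow_add: "rpow x (s + t) = rpow x s * rpow x t"
  by (simp add: rpow_def algebra_simps exp_add)

lemma rpow_mult: "x > 0 \<Longrightarrow> y > 0 \<Longrightarrow> rpow (x * y) s = rpow x s * rpow y s"
  by (simp add: rpow_def ln_mult algebra_simps exp_add)

lemma rpow_powr: "x > 0 \<Longrightarrow> rpow (x powr a) s = rpow x (of_real a * s)"
  by (simp add: rpow_def ln_powr algebra_simps)

lemma rpow_inverse: "x > 0 \<Longrightarrow> rpow (inverse x) s = rpow x (- s)"
  by (simp add: rpow_def ln_inverse)

lemma holomorphic_rpow [holomorphic_intros]:
  "f holomorphic_on A \<Longrightarrow> (\<lambda>s. rpow x (f s)) holomorphic_on A"
  unfolding rpow_def by (intro holomorphic_intros)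

lemma strip_bound_rpow:
  fixes q :: real
  assumes "x > 0"
  shows "strip_bound 0 (\<lambda>s. rpow x (of_real q * s))"
  unfolding strip_bound_def
proof (intro allI)
  fix a b :: real
  define M where "M = \<bar>q * ln x\<bar> * (\<bar>a\<bar> + \<bar>b\<bar>)"
  have "norm (rpow x (of_real q * u)) \<le> exp M" if "a \<le> Re u" "Re u \<le> b" for u
  proof -
    have "q * ln x * Re u \<le> \<bar>q * ln x\<bar> * \<bar>Re u\<bar>" by (metis abs_ge_self abs_mult)
    also have "\<dots> \<le> M" unfolding M_def using that by (intro mult_left_mono) auto
    finally show ?thesis by (simp add: rpow_def mult_ac)
  qed
  then show "\<exists>C N Y. 0 \<le> C \<and> (\<forall>u. a \<le> Re u \<longrightarrow> Re u \<le> b \<longrightarrow> Y \<le> \<bar>Im u\<bar> \<longrightarrow>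
     norm (rpow x (of_real q * u)) \<le> C * (1 + \<bar>Im u\<bar>) ^ N * exp (- 0 * \<bar>Im u\<bar>))"
    by (intro exI[of _ "exp M"] exI[of _ 0]) auto
qed

text \<open>The pole of \<open>\<Gamma>\<close> at \<open>-n\<close> has residue \<open>(-1)^n / n!\<close>; the substitution \<open>h - q s\<close> contributes the factor \<open>-1/q\<close>.\<close>

lemma residue_Gamma_affine:
  fixes h q :: real and n :: nat
  assumes "open U" and s0: "of_real h - of_real q * s0 = - of_nat n" "s0 \<in> U" and "q \<noteq> 0"
    and G: "G holomorphic_on U" and f: "(\<lambda>s. Gamma (of_real h - of_real q * s) * G s) holomorphic_on U - {s0}"
  shows "residue (\<lambda>s. Gamma (of_real h - of_real q * s) * G s) s0
       = - ((-1) ^ n / fact n / of_real q * G s0)"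
proof (rule residue_simple'[OF \<open>open U\<close> \<open>s0 \<in> U\<close> f])
  let ?m = "\<lambda>s. of_real h - of_real q * s :: complex"
  have "filterlim ?m (at (- of_nat n)) (at s0)"
  proof (rule filterlim_atI)
    have "?m \<midarrow>s0\<rightarrow> ?m s0" by (intro tendsto_intros)
    then show "?m \<midarrow>s0\<rightarrow> - of_nat n" by (simp only: s0)
    show "\<forall>\<^sub>F s in at s0. ?m s \<noteq> - of_nat n"
      unfolding eventually_at
    proof (intro exI[of _ 1] conjI ballI impI)
      fix s assume s: "s \<noteq> s0 \<and> dist s s0 < 1"
      have "of_real q * (s - s0) \<noteq> (0 :: complex)" using s \<open>q \<noteq> 0\<close> by simp
      then show "?m s \<noteq> - of_nat n" unfolding s0(1)[symmetric] by (auto simp: algebra_simps)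
    qed auto
  qed
  from filterlim_compose[OF Gamma_residues this]
  have 1: "(\<lambda>s. Gamma (?m s) * (?m s + of_nat n)) \<midarrow>s0\<rightarrow> (-1) ^ n / fact n" .
  have "isCont G s0"
    using holomorphic_on_imp_continuous_on[OF G] \<open>open U\<close> s0(2)
    by (simp add: continuous_on_eq_continuous_at)
  then have "(\<lambda>s. Gamma (?m s) * (?m s + of_nat n) * (- (G s / of_real q)))
      \<midarrow>s0\<rightarrow> (-1) ^ n / fact n * (- (G s0 / of_real q))"
    using \<open>q \<noteq> 0\<close> by (intro tendsto_intros 1) (auto simp: isCont_def)
  moreover have "Gamma (?m s) * (?m s + of_nat n) * (- (G s / of_real q)) = Gamma (?m s) * G s * (s - s0)" for s
  proof -
    have "?m s + of_nat n = - (of_real q * (s - s0))"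
      using s0(1) by (simp add: algebra_simps eq_neg_iff_add_eq_0)
    then show ?thesis using \<open>q \<noteq> 0\<close> by simp
  qed
  ultimately show "(\<lambda>s. Gamma (?m s) * G s * (s - s0)) \<midarrow>s0\<rightarrow> - ((-1) ^ n / fact n / of_real q * G s0)"
    by simp
qed

lemma vline_int_tendsto_0:
  assumes \<eta>: "\<eta> > 0" and int: "\<And>k. integrable lborel (\<lambda>y. f (Complex (R k) y))"
    and bnd: "eventually (\<lambda>k. \<forall>y. norm (f (Complex (R k) y)) \<le> B k * exp (- \<eta> * \<bar>y\<bar>)) sequentially"
    and B: "B \<longlonglongrightarrow> 0"
  shows "(\<lambda>k. vline_int (R k) f) \<longlonglongrightarrow> 0"
proof (rule Lim_null_comparison)
  let ?E = "LINT y|lborel. exp (- \<eta> * \<bar>y\<bar>)"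
  show "eventually (\<lambda>k. norm (vline_int (R k) f) \<le> B k * ?E) sequentially"
    using bnd
  proof eventually_elim
    case (elim k)
    have "norm (vline_int (R k) f) \<le> (LINT y|lborel. B k * exp (- \<eta> * \<bar>y\<bar>))"
    proof (rule Bochner_Integration.integral_norm_bound_integral[OF int integrable_mult_right])
      show "integrable lborel (\<lambda>y. exp (- \<eta> * \<bar>y\<bar>))" by (rule integrable_exp_neg_abs[OF \<eta>])
    qed (use elim in auto)
    then show ?case by simp
  qed
  show "(\<lambda>k. B k * ?E) \<longlonglongrightarrow> 0" using tendsto_mult_right[OF B, of ?E] by simp
qed

lemma Gamma_real_mono: "3/2 \<le> x \<Longrightarrow> x \<le> y \<Longrightarrow> Gamma x \<le> Gamma y" for x y :: real
  using Gamma_real_strict_mono[of x y] by (cases "x = y") auto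

lemma Gamma_ge_1: "Gamma x \<ge> 1" if "x \<ge> 2" for x :: real
  using Gamma_real_mono[of 2 x] that by (simp add: Gamma_numeral)

text \<open>A crude polynomial bound suffices: the other factors of the integrands decay at least exponentially in \<open>x\<close>, the
abscissa of the line.\<close>

lemma Gamma_quotient_le:
  fixes x \<alpha> :: real
  assumes "0 < \<alpha>" "\<alpha> \<le> real N" "real N + 1 \<le> x"
  shows "Gamma x / Gamma (x + 1 - \<alpha>) \<le> x ^ N"
proof -
  let ?z = "x + 1 - real N"
  have "N > 0" using assms by (cases N) auto
  have z: "?z \<ge> 2" using assms by simp
  have "Gamma x = pochhammer ?z (N - 1) * Gamma ?z"
  proof -
    have "?z \<notin> \<int>\<^sub>\<le>\<^sub>0" using z by (auto elim!: nonpos_Ints_cases)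
    moreover have "?z + real (N - 1) = x" using \<open>N > 0\<close> by (simp add: of_nat_diff)
    ultimately show ?thesis
      using pochhammer_Gamma[of ?z "N - 1"] z less_imp_neq[OF Gamma_real_pos[of ?z]] by simp
  qed
  also have "pochhammer ?z (N - 1) \<le> x ^ (N - 1)"
  proof -
    have "pochhammer ?z (N - 1) = (\<Prod>i=0..<N - 1. ?z + real i)" by (simp add: pochhammer_prod)
    also have "\<dots> \<le> (\<Prod>i=0..<N - 1. x)" using z by (intro prod_mono) auto
    finally show ?thesis by simp
  qed
  also have "x ^ (N - 1) \<le> x ^ N" using assms by (intro power_increasing) auto
  also have "Gamma ?z \<le> Gamma (x + 1 - \<alpha>)" using assms z by (intro Gamma_real_mono) auto
  finally have "Gamma x \<le> x ^ N * Gamma (x + 1 - \<alpha>)"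
    using z assms Gamma_real_pos[of ?z] by (auto intro: mult_mono)
  then show ?thesis using assms Gamma_real_pos[of "x + 1 - \<alpha>"] by (simp add: field_simps)
qed

lemma powr_over_Gamma_tendsto_0:
  fixes Z :: real
  assumes "Z > 0"
  shows "((\<lambda>u. Z powr u / Gamma u) \<longlongrightarrow> 0) at_top"
proof -
  define W where "W = max 1 Z"
  have W: "W \<ge> 1" "Z \<le> W" by (auto simp: W_def)
  have a: "(\<lambda>n. W\<^sup>2 * (W ^ n / fact n)) \<longlonglongrightarrow> W\<^sup>2 * 0"
    by (intro tendsto_intros summable_LIMSEQ_zero) (use summable_exp_generic[of W] in \<open>simp add: divide_inverse mult.commute\<close>)
  have b: "filterlim (\<lambda>u::real. nat \<lfloor>u - 1\<rfloor>) sequentially at_top"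
    by (intro filterlim_compose[OF filterlim_nat_sequentially] filterlim_compose[OF filterlim_floor_sequentially])
       real_asymp
  have lim: "((\<lambda>u::real. W\<^sup>2 * (W ^ nat \<lfloor>u - 1\<rfloor> / fact (nat \<lfloor>u - 1\<rfloor>))) \<longlongrightarrow> 0) at_top"
    using filterlim_compose[OF a b] by simp
  show ?thesis
  proof (rule Lim_null_comparison[OF _ lim])
    show "\<forall>\<^sub>F u in at_top. norm (Z powr u / Gamma u) \<le> W\<^sup>2 * (W ^ nat \<lfloor>u - 1\<rfloor> / fact (nat \<lfloor>u - 1\<rfloor>))"
      using eventually_ge_at_top[of 3]
    proof eventually_elim
      case (elim u)
      define n where "n = nat \<lfloor>u - 1\<rfloor>"
      have n: "real n \<le> u - 1" "u - 1 < real n + 1" "2 \<le> n" using elim unfolding n_def by linarith+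
      have "Z powr u \<le> W powr u" using assms W elim by (intro powr_mono2) auto
      also have "\<dots> \<le> W powr real (n + 2)" using W n by (intro powr_mono) auto
      also have "\<dots> = W\<^sup>2 * W ^ n" using W powr_realpow[of W "n + 2"] by (simp add: power_add power2_eq_square)
      finally have a: "Z powr u \<le> W\<^sup>2 * W ^ n" .
      have "fact n = Gamma (1 + real n)" by (simp add: Gamma_fact)
      also have "\<dots> \<le> Gamma u" using n by (intro Gamma_real_mono) auto
      finally have b: "fact n \<le> Gamma u" .
      have "norm (Z powr u / Gamma u) = Z powr u / Gamma u"
        using b fact_gt_zero[of n, where 'a = real] by (simp add: abs_of_pos less_le_trans[of 0 "fact n"])
      also have "\<dots> \<le> W\<^sup>2 * W ^ n / fact n"
        using a b W by (intro frac_le) auto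
      finally show ?case by (simp add: n_def)
    qed
  qed
qed

section \<open>Closing the contours\<close>

lemma abs_sin_add_pi_multiple: "\<bar>sin (pi * (real k + x))\<bar> = \<bar>sin (pi * x)\<bar>"
proof -
  have "sin (pi * (real k + x)) = (-1) ^ k * sin (pi * x)"
    by (simp add: distrib_left sin_add sin_npi2 cos_npi2 mult.commute[of pi "real k"])
  then show ?thesis by (simp add: abs_mult power_abs)
qed

text \<open>For \<open>x > 1\<close> the line can be moved to the right, and the residues at \<open>\<alpha> + n\<close> form the binomial series of
\<open>x powr -\<alpha> (1 + 1/x) powr -\<alpha>\<close>. The lines \<open>Re s = \<alpha> + k + 1/2\<close> run half-way between the poles.\<close>

lemma mellin_barnes_binomial_gt_1:
  fixes \<alpha> c x :: real
  assumes "0 < c" "c < \<alpha>" "1 < x"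
  shows "vline_int c (\<lambda>s. Gamma s * Gamma (of_real \<alpha> - s) * rpow x (- s))
       = of_real (2 * pi * Gamma \<alpha> * (1 + x) powr (- \<alpha>))"
proof -
  define f where "f = (\<lambda>s. Gamma s * Gamma (of_real \<alpha> - s) * rpow x (- s))"
  define G where "G = (\<lambda>s. Gamma s * rpow x (- s))"
  have f_eq: "f = (\<lambda>s. Gamma (of_real \<alpha> - of_real 1 * s) * G s)"
    by (auto simp: f_def G_def mult_ac)
  define R where "R k = \<alpha> + real k + 1/2" for k
  define pole where "pole n = complex_of_real (\<alpha> + real n)" for n
  define S where "S k = {s. 0 < Re s} \<inter> {s. Re s < \<alpha> + real k + 1}" for k
  have S: "open (S k)" "convex (S k)" for k
    unfolding S_def by (auto intro!: open_Int open_halfspace_Re_gt open_halfspace_Re_lt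
        convex_Int convex_halfspace_Re_gt convex_halfspace_Re_lt)
  have inj: "inj pole" by (auto simp: inj_def pole_def)
  have G: "G holomorphic_on S k" for k
    unfolding G_def S_def by (intro holomorphic_intros) (auto elim!: nonpos_Ints_cases)
  have f: "f holomorphic_on S k - pole ` {..k}" for k
    unfolding f_eq
  proof (intro holomorphic_on_mult holomorphic_on_subset[OF G] holomorphic_Gamma' holomorphic_intros)
    fix s assume s: "s \<in> S k - pole ` {..k}"
    show "of_real \<alpha> - of_real 1 * s \<notin> \<int>\<^sub>\<le>\<^sub>0"
    proof
      assume "of_real \<alpha> - of_real 1 * s \<in> \<int>\<^sub>\<le>\<^sub>0"
      then obtain n where "of_real \<alpha> - s = - of_nat n" by (auto elim!: nonpos_Ints_cases')
      then have "s = pole n" by (simp add: pole_def algebra_simps)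
      moreover from this have "n \<le> k" using s by (auto simp: S_def pole_def)
      ultimately show False using s by auto
    qed
  qed auto
  have sb: "strip_bound pi f"
  proof -
    have "strip_bound (pi/2 + pi/2 * \<bar>-1\<bar> + 0)
        (\<lambda>s. Gamma s * Gamma (of_real \<alpha> + of_real (-1) * s) * rpow x (of_real (-1) * s))"
      using \<open>1 < x\<close> by (intro strip_bound_mult strip_bound_Gamma strip_bound_affine strip_bound_rpow) auto
    then show ?thesis by (simp add: f_def)
  qed
  have res: "residue f (pole n) = - of_real ((-1) ^ n / fact n * (Gamma (\<alpha> + real n) * x powr (- (\<alpha> + real n))))"
    (is "_ = - of_real (?r n)") for n
  proof -
    let ?U = "S n - pole ` {..<n}"
    have "residue (\<lambda>s. Gamma (of_real \<alpha> - of_real 1 * s) * G s) (pole n)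
        = - ((-1) ^ n / fact n / of_real 1 * G (pole n))"
    proof (rule residue_Gamma_affine)
      show "open ?U" using S by (intro open_Diff finite_imp_closed) auto
      show "of_real \<alpha> - of_real 1 * pole n = - of_nat n" by (simp add: pole_def)
      show "pole n \<in> ?U" using assms inj by (auto simp: S_def pole_def inj_def)
      show "G holomorphic_on ?U" by (rule holomorphic_on_subset[OF G]) auto
      have "{..n} = insert n {..<n}" by auto
      then show "(\<lambda>s. Gamma (of_real \<alpha> - of_real 1 * s) * G s) holomorphic_on ?U - {pole n}"
        using f[of n] unfolding f_eq by (rule_tac holomorphic_on_subset) auto
    qed simp
    moreover have "G (pole n) = of_real (Gamma (\<alpha> + real n) * x powr (- (\<alpha> + real n)))"
      using rpow_of_real[of x "- (\<alpha> + real n)"] \<open>1 < x\<close> Gamma_complex_of_real[of "\<alpha> + real n"]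
      by (simp add: G_def pole_def)
    ultimately show ?thesis by (simp add: f_eq)
  qed
  have shift: "integrable lborel (\<lambda>y. f (Complex (R k) y))"
    "vline_int c f = vline_int (R k) f - 2 * of_real pi * (\<Sum>p\<in>pole ` {..k}. residue f p)" for k
  proof -
    have 1: "\<And>s. c \<le> Re s \<Longrightarrow> Re s \<le> R k \<Longrightarrow> s \<in> S k" using assms by (auto simp: S_def R_def)
    have 2: "c < R k" using assms by (auto simp: R_def)
    have 3: "\<And>p. p \<in> pole ` {..k} \<Longrightarrow> c < Re p \<and> Re p < R k"
      using assms by (auto simp: R_def pole_def)
    show "integrable lborel (\<lambda>y. f (Complex (R k) y))"
      by (rule vline_shift_residues(2)[OF S(1) 1 S(2) 2 _ f 3 sb]) auto
    show "vline_int c f = vline_int (R k) f - 2 * of_real pi * (\<Sum>p\<in>pole ` {..k}. residue f p)"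
      by (rule vline_shift_residues(3)[OF S(1) 1 S(2) 2 _ f 3 sb]) auto
  qed
  obtain N :: nat where N: "\<alpha> \<le> real N" using real_arch_simple by blast
  have lim: "(\<lambda>k. vline_int (R k) f) \<longlonglongrightarrow> 0"
  proof (rule vline_int_tendsto_0[of "pi/2", OF _ shift(1)])
    show "\<forall>\<^sub>F k in sequentially. \<forall>y. norm (f (Complex (R k) y))
        \<le> (2 * pi * (R k ^ N * x powr (- R k))) * exp (- (pi/2) * \<bar>y\<bar>)"
      using eventually_ge_at_top[of "N + 1"]
    proof eventually_elim
      case (elim k)
      have R: "real N + 1 \<le> R k" "0 < R k" using assms elim by (auto simp: R_def)
      show ?case
      proof
        fix y
        let ?s = "Complex (R k) y"
        have sin1: "\<bar>sin (pi * (Re ?s - \<alpha>))\<bar> = 1"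
          using abs_sin_add_pi_multiple[of k "1/2"] by (simp add: R_def algebra_simps)
        have "norm (f ?s) = norm (Gamma ?s) * norm (Gamma (of_real \<alpha> - ?s)) * x powr (- R k)"
          using \<open>1 < x\<close> by (simp add: f_def norm_mult norm_rpow)
        also have "\<dots> \<le> Gamma (R k) * (2 * pi / \<bar>sin (pi * (Re ?s - \<alpha>))\<bar>
           * exp (- (pi / 2) * \<bar>Im ?s\<bar>) / Gamma (Re ?s + 1 - \<alpha>)) * x powr (- R k)"
          using R N sin1 norm_Gamma_le[of ?s] elim
          by (intro mult_right_mono mult_mono norm_Gamma_reflected_le) auto
        also have "\<dots> = (Gamma (R k) / Gamma (R k + 1 - \<alpha>)) * (2 * pi * x powr (- R k) * exp (- (pi / 2) * \<bar>y\<bar>))"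
          unfolding sin1 by simp
        also have "\<dots> \<le> R k ^ N * (2 * pi * x powr (- R k) * exp (- (pi / 2) * \<bar>y\<bar>))"
          using R N assms by (intro mult_right_mono Gamma_quotient_le) auto
        finally show "norm (f ?s) \<le> (2 * pi * (R k ^ N * x powr (- R k))) * exp (- (pi/2) * \<bar>y\<bar>)"
          by (simp add: mult_ac)
      qed
    qed
    have "((\<lambda>t. 2 * pi * (t ^ N * x powr (- t))) \<longlongrightarrow> 0) at_top"
      using \<open>1 < x\<close> by real_asymp
    moreover have "filterlim R at_top sequentially" unfolding R_def by real_asymp
    ultimately show "(\<lambda>k. 2 * pi * (R k ^ N * x powr (- R k))) \<longlonglongrightarrow> 0"
      by (rule filterlim_compose)
  qed auto
  have sums: "?r sums (Gamma \<alpha> * (1 + x) powr (- \<alpha>))"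
  proof -
    have "(\<lambda>n. (- \<alpha> gchoose n) * (1/x) ^ n) sums (1 + 1/x) powr (- \<alpha>)"
      using \<open>1 < x\<close> by (intro gen_binomial_real) auto
    from sums_mult[OF this, of "Gamma \<alpha> * x powr (- \<alpha>)"]
    have "(\<lambda>n. Gamma \<alpha> * x powr (- \<alpha>) * ((- \<alpha> gchoose n) * (1/x) ^ n)) sums
        (Gamma \<alpha> * x powr (- \<alpha>) * (1 + 1/x) powr (- \<alpha>))" .
    also have "(\<lambda>n. Gamma \<alpha> * x powr (- \<alpha>) * ((- \<alpha> gchoose n) * (1/x) ^ n)) = ?r"
    proof
      fix n
      have "\<alpha> \<notin> \<int>\<^sub>\<le>\<^sub>0" using assms by (auto elim!: nonpos_Ints_cases)
      then have "Gamma (\<alpha> + real n) = pochhammer \<alpha> n * Gamma \<alpha>"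
        using pochhammer_Gamma[of \<alpha> n] Gamma_eq_zero_iff[of \<alpha>] by simp
      moreover have "x powr (- (\<alpha> + real n)) = x powr (- \<alpha>) * (1/x) ^ n"
        using \<open>1 < x\<close> powr_add[of x "- \<alpha>" "- real n"]
        by (simp add: powr_minus powr_realpow power_inverse divide_inverse)
      ultimately show "Gamma \<alpha> * x powr (- \<alpha>) * ((- \<alpha> gchoose n) * (1/x) ^ n) = ?r n"
        by (simp add: gbinomial_pochhammer)
    qed
    also have "Gamma \<alpha> * x powr (- \<alpha>) * (1 + 1/x) powr (- \<alpha>) = Gamma \<alpha> * (1 + x) powr (- \<alpha>)"
    proof -
      have "x powr (- \<alpha>) * (1 + 1/x) powr (- \<alpha>) = (x * (1 + 1/x)) powr (- \<alpha>)"
        by (rule powr_mult[symmetric])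
      also have "x * (1 + 1/x) = 1 + x" using \<open>1 < x\<close> by (simp add: field_simps)
      finally show ?thesis by simp
    qed
    finally show ?thesis .
  qed
  have "vline_int c f = vline_int (R k) f + 2 * of_real pi * of_real (\<Sum>n\<le>k. ?r n)" for k
    unfolding shift(2)[of k] using inj by (subst sum.reindex) (auto simp: inj_on_def inj_def res sum_negf)
  moreover have "(\<lambda>k. vline_int (R k) f + 2 * of_real pi * of_real (\<Sum>n\<le>k. ?r n))
      \<longlonglongrightarrow> 0 + 2 * of_real pi * of_real (Gamma \<alpha> * (1 + x) powr (- \<alpha>))"
    using sums unfolding sums_def_le by (intro tendsto_intros lim)
  ultimately have "(\<lambda>k::nat. vline_int c f) \<longlonglongrightarrow> 0 + 2 * of_real pi * of_real (Gamma \<alpha> * (1 + x) powr (- \<alpha>))"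
    by simp
  then have "vline_int c f = 2 * of_real pi * of_real (Gamma \<alpha> * (1 + x) powr (- \<alpha>))"
    by (simp add: LIMSEQ_const_iff)
  then show ?thesis by (simp add: f_def)
qed

text \<open>The substitution \<open>s \<mapsto> \<alpha> - s\<close> exchanges \<open>x\<close> and \<open>1/x\<close> and so reduces \<open>x < 1\<close> to \<open>x > 1\<close>. The point \<open>x = 1\<close>, where neither
series converges absolutely in general, is a null set for all later purposes.\<close>

lemma mellin_barnes_binomial:
  fixes \<alpha> c x :: real
  assumes "0 < c" "c < \<alpha>" "0 < x" "x \<noteq> 1"
  shows "vline_int c (\<lambda>s. Gamma s * Gamma (of_real \<alpha> - s) * rpow x (- s))
       = of_real (2 * pi * Gamma \<alpha> * (1 + x) powr (- \<alpha>))"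
proof (cases "x > 1")
  case True
  then show ?thesis using assms by (intro mellin_barnes_binomial_gt_1)
next
  case False
  let ?F = "\<lambda>c x. (\<lambda>s. Gamma s * Gamma (of_real \<alpha> - s) * rpow x (- s))"
  have "vline_int c (?F c x) = (LINT y|lborel. rpow x (- of_real \<alpha>) * ?F c (inverse x) (Complex (\<alpha> - c) (- y)))"
  proof (rule Bochner_Integration.integral_cong)
    fix y
    have e: "complex_of_real \<alpha> - Complex c y = Complex (\<alpha> - c) (- y)"
      "complex_of_real \<alpha> - Complex (\<alpha> - c) (- y) = Complex c y" by (simp_all add: complex_eq_iff)
    have "rpow x (- Complex c y) = rpow x (- of_real \<alpha>) * rpow x (of_real \<alpha> - Complex c y)"
      unfolding rpow_add[symmetric] by simp
    then show "?F c x (Complex c y) = rpow x (- of_real \<alpha>) * ?F c (inverse x) (Complex (\<alpha> - c) (- y))"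
      using \<open>0 < x\<close> by (simp add: e rpow_inverse mult_ac)
  qed simp
  also have "\<dots> = rpow x (- of_real \<alpha>) * vline_int (\<alpha> - c) (?F c (inverse x))"
    using lborel_integral_real_affine[of "-1" "\<lambda>y. ?F c (inverse x) (Complex (\<alpha> - c) y)" 0] by simp
  also have "vline_int (\<alpha> - c) (?F c (inverse x)) = of_real (2 * pi * Gamma \<alpha> * (1 + inverse x) powr (- \<alpha>))"
    using assms False by (intro mellin_barnes_binomial_gt_1) (auto simp: field_simps)
  also have "rpow x (- of_real \<alpha>) = of_real (x powr (- \<alpha>))"
    using rpow_of_real[of x "- \<alpha>"] \<open>0 < x\<close> by simp
  also have "of_real (x powr (- \<alpha>)) * of_real (2 * pi * Gamma \<alpha> * (1 + inverse x) powr (- \<alpha>))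
      = complex_of_real (2 * pi * Gamma \<alpha> * (x powr (- \<alpha>) * (1 + inverse x) powr (- \<alpha>)))" by simp
  also have "x powr (- \<alpha>) * (1 + inverse x) powr (- \<alpha>) = (1 + x) powr (- \<alpha>)"
  proof -
    have "x * (1 + inverse x) = 1 + x" using \<open>0 < x\<close> by (simp add: field_simps)
    then show ?thesis using \<open>0 < x\<close> powr_mult[of x "1 + inverse x" "- \<alpha>"] by simp
  qed
  finally show ?thesis .
qed

text \<open>On \<open>Re s = R\<close> reflection turns \<open>\<Gamma>(h - \<theta> s) / \<Gamma>(\<theta> s)\<close>, with \<open>h = d/2\<close> and \<open>\<theta> = \<delta>/2\<close>, into
\<open>\<pi> / (sin(\<pi> (h - \<theta> s)) \<Gamma>(1 - h + \<theta> s) \<Gamma>(\<theta> s))\<close>, which is superexponentially small in \<open>R\<close> unless the sine is close to \<open>0\<close>. Since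
\<open>\<delta> < 2\<close>, the lines \<open>R = \<alpha> + k + 1/4\<close> and \<open>R = \<alpha> + k + 3/4\<close> cannot both be close to zeros of the sine, and both keep
distance \<open>1/4\<close> from the poles \<open>\<alpha> + n\<close>.\<close>

lemma cauchy_contour_closing:
  fixes d :: nat and \<delta> l X c :: real
  assumes "d > 0" "0 < \<delta>" "\<delta> < 2" "l > 0" "X > 0"
    and no_pole: "\<And>n::nat. real d / 2 - (l / \<delta> + real n) * \<delta> / 2 \<notin> \<int>\<^sub>\<le>\<^sub>0"
    and conv1: "summable (cauchy_term1 d \<delta> l X)"
    and conv2: "summable (cauchy_term2 d \<delta> l X)"
    and c: "0 < c" "c < l / \<delta>" "c < real d / \<delta>"
  shows "vline_int c (\<lambda>s. Gamma s * Gamma (of_real (l / \<delta>) - s) *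
             (Gamma (of_real (real d / 2) - of_real (\<delta> / 2) * s) * rGamma (of_real (\<delta> / 2) * s))
             * rpow X (of_real \<delta> * s))
    = of_real (2 * pi * (suminf (cauchy_term1 d \<delta> l X) + 2 / \<delta> * suminf (cauchy_term2 d \<delta> l X)))"
proof -
  define \<alpha> where "\<alpha> = l / \<delta>"
  define h where "h = real d / 2"
  define \<theta> where "\<theta> = \<delta> / 2"
  have \<alpha>: "\<alpha> > 0" and h: "h > 0" and \<theta>: "0 < \<theta>" "\<theta> < 1" "2 * \<theta> = \<delta>"
    using assms by (auto simp: \<alpha>_def h_def \<theta>_def)
  have c': "0 < c" "c < \<alpha>" "c < h / \<theta>" using c by (auto simp: \<alpha>_def h_def \<theta>_def)
  define E where "E = (\<lambda>s. rGamma (of_real \<theta> * s) * rpow X (of_real \<delta> * s))"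
  define f where "f = (\<lambda>s. Gamma s * Gamma (of_real \<alpha> - s) * (Gamma (of_real h - of_real \<theta> * s)
      * rGamma (of_real \<theta> * s)) * rpow X (of_real \<delta> * s))"
  define G1 where "G1 = (\<lambda>s. Gamma s * Gamma (of_real h - of_real \<theta> * s) * E s)"
  define G2 where "G2 = (\<lambda>s. Gamma s * Gamma (of_real \<alpha> - s) * E s)"
  have f1: "f = (\<lambda>s. Gamma (of_real \<alpha> - of_real 1 * s) * G1 s)"
    and f2: "f = (\<lambda>s. Gamma (of_real h - of_real \<theta> * s) * G2 s)"
    by (auto simp: f_def G1_def G2_def E_def mult_ac)
  define p where "p n = complex_of_real (\<alpha> + real n)" for n
  define q where "q n = complex_of_real ((h + real n) / \<theta>)" for n
  have inj: "inj p" "inj q" using \<theta> by (auto simp: inj_def p_def q_def)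
  have pq: "p n \<noteq> q m" for n m
  proof
    assume "p n = q m"
    then have "real d / 2 - (l / \<delta> + real n) * \<delta> / 2 = - real m"
      using \<theta> unfolding p_def q_def of_real_eq_iff \<alpha>_def h_def \<theta>_def by (simp add: field_simps)
    then show False using no_pole[of n] by simp
  qed
  have poles1: "s \<in> range p" if "of_real \<alpha> - s \<in> \<int>\<^sub>\<le>\<^sub>0" for s
    using that by (auto elim!: nonpos_Ints_cases' simp: p_def image_def algebra_simps)
  have poles2: "s \<in> range q" if "of_real h - of_real \<theta> * s \<in> \<int>\<^sub>\<le>\<^sub>0" for s
  proof -
    note int = that
    obtain n where "of_real h - of_real \<theta> * s = - of_nat n" by (rule nonpos_Ints_cases'[OF int])
    then have "s = q n" using \<theta> by (simp add: q_def field_simps)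
    then show ?thesis by simp
  qed
  have right: "s \<notin> \<int>\<^sub>\<le>\<^sub>0" if "0 < Re s" for s using that by (auto elim!: nonpos_Ints_cases)
  have holE: "E holomorphic_on A" for A unfolding E_def by (intro holomorphic_intros)
  have holG1: "G1 holomorphic_on {s. 0 < Re s} - range q"
    unfolding G1_def using right poles2 by (intro holomorphic_intros holE) auto
  have holG2: "G2 holomorphic_on {s. 0 < Re s} - range p"
    unfolding G2_def using right poles1 by (intro holomorphic_intros holE) auto
  have holf: "f holomorphic_on {s. 0 < Re s} - range p - range q"
    unfolding f1 using poles1 by (intro holomorphic_intros holomorphic_on_subset[OF holG1]) auto
  have closed: "closed (p ` A)" "closed (q ` A)" for A
  proof -
    have "p ` A = (+) (of_real \<alpha>) ` of_nat ` A"
      by (simp add: image_image p_def)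
    then show "closed (p ` A)" by (simp only: closed_translation closed_of_nat_image)
    have "q ` A = (+) (of_real (h / \<theta>)) ` (\<lambda>x. (1 / \<theta>) *\<^sub>R x) ` of_nat ` A"
      by (simp add: image_image q_def scaleR_conv_of_real add_divide_distrib)
    then show "closed (q ` A)" by (simp only: closed_translation closed_scaling closed_of_nat_image)
  qed
  have resp: "residue f (p n) = - of_real (cauchy_term1 d \<delta> l X n)" for n
  proof -
    let ?U = "{s. 0 < Re s} - range q - p ` (- {n})"
    have "residue f (p n) = - ((-1) ^ n / fact n / of_real 1 * G1 (p n))"
      unfolding f1
    proof (rule residue_Gamma_affine)
      show "open ?U" by (intro open_Diff open_halfspace_Re_gt closed)
      show "of_real \<alpha> - of_real 1 * p n = - of_nat n" by (simp add: p_def)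
      show "p n \<in> ?U" using \<alpha> inj pq by (auto simp: p_def inj_def)
      show "G1 holomorphic_on ?U" by (rule holomorphic_on_subset[OF holG1]) auto
      have "?U - {p n} \<subseteq> {s. 0 < Re s} - range p - range q" by auto
      from holomorphic_on_subset[OF holf this]
      show "(\<lambda>s. Gamma (of_real \<alpha> - of_real 1 * s) * G1 s) holomorphic_on ?U - {p n}"
        unfolding f1 .
    qed simp
    moreover have "G1 (p n) = of_real (Gamma (\<alpha> + real n) * Gamma (h - \<theta> * (\<alpha> + real n))
        * (rGamma (\<theta> * (\<alpha> + real n)) * X powr (\<delta> * (\<alpha> + real n))))"
      unfolding G1_def E_def p_def of_real_mult[symmetric] of_real_diff[symmetric] rGamma_complex_of_real
        Gamma_complex_of_real rpow_of_real[OF \<open>X > 0\<close>] ..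
    moreover have "cauchy_term1 d \<delta> l X n = (-1) ^ n / fact n * (Gamma (\<alpha> + real n) * Gamma (h - \<theta> * (\<alpha> + real n))
        * (rGamma (\<theta> * (\<alpha> + real n)) * X powr (\<delta> * (\<alpha> + real n))))"
    proof -
      have "(\<alpha> + real n) * \<delta> / 2 = \<theta> * (\<alpha> + real n)" "(\<alpha> + real n) * \<delta> = \<delta> * (\<alpha> + real n)"
        unfolding \<theta>_def by simp_all
      then show ?thesis
        unfolding cauchy_term1_def \<alpha>_def[symmetric] h_def[symmetric]
        by (simp only: rGamma_inverse_Gamma divide_inverse mult.assoc)
    qed
    ultimately show ?thesis by simp
  qed
  have resq: "residue f (q n) = - of_real (2 / \<delta> * cauchy_term2 d \<delta> l X n)" for n
  proof -
    let ?U = "{s. 0 < Re s} - range p - q ` (- {n})"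
    have res: "residue f (q n) = - ((-1) ^ n / fact n / of_real \<theta> * G2 (q n))"
      unfolding f2
    proof (rule residue_Gamma_affine)
      show "open ?U" by (intro open_Diff open_halfspace_Re_gt closed)
      show "of_real h - of_real \<theta> * q n = - of_nat n" using \<theta> by (simp add: q_def)
      show "q n \<in> ?U" using h \<theta> inj pq[THEN not_sym] by (auto simp: q_def inj_def)
      show "G2 holomorphic_on ?U" by (rule holomorphic_on_subset[OF holG2]) auto
      have "?U - {q n} \<subseteq> {s. 0 < Re s} - range p - range q" by auto
      from holomorphic_on_subset[OF holf this]
      show "(\<lambda>s. Gamma (of_real h - of_real \<theta> * s) * G2 s) holomorphic_on ?U - {q n}"
        unfolding f2 .
    qed (use \<theta> in simp)
    moreover have "G2 (q n) = of_real (Gamma ((h + real n) / \<theta>) * Gamma (\<alpha> - (h + real n) / \<theta>)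
        * (rGamma (\<theta> * ((h + real n) / \<theta>)) * X powr (\<delta> * ((h + real n) / \<theta>))))"
      unfolding G2_def E_def q_def of_real_mult[symmetric] of_real_diff[symmetric] rGamma_complex_of_real
        Gamma_complex_of_real rpow_of_real[OF \<open>X > 0\<close>] ..
    moreover have "(h + real n) / \<theta> = real (2 * n + d) / \<delta>" "\<theta> * ((h + real n) / \<theta>) = real n + real d / 2"
      "\<delta> * ((h + real n) / \<theta>) = real (2 * n + d)"
      using assms by (auto simp: h_def \<theta>_def field_simps)
    moreover have "X powr real (2 * n + d) = X ^ (2 * n + d)" using \<open>X > 0\<close> by (rule powr_realpow)
    ultimately have G2q: "G2 (q n) = of_real (Gamma (real (2 * n + d) / \<delta>) * Gamma (\<alpha> - real (2 * n + d) / \<delta>)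
        * (rGamma (real n + real d / 2) * X ^ (2 * n + d)))" by (simp only:)
    have "cauchy_term2 d \<delta> l X n = (-1) ^ n / fact n * (Gamma (real (2 * n + d) / \<delta>)
        * Gamma (\<alpha> - real (2 * n + d) / \<delta>) * (rGamma (real n + real d / 2) * X ^ (2 * n + d)))"
      unfolding cauchy_term2_def \<alpha>_def[symmetric]
      by (simp only: rGamma_inverse_Gamma divide_inverse mult.assoc)
    moreover have "2 / \<delta> = inverse \<theta>" by (simp add: \<theta>_def)
    moreover have "(-1) ^ n / fact n / of_real \<theta> * of_real K
        = complex_of_real (inverse \<theta> * ((-1) ^ n / fact n * K))" for K
      by (simp add: divide_inverse mult_ac)
    ultimately show ?thesis unfolding res G2q by (simp only:)
  qed
  have sb: "strip_bound pi f"
  proof -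
    have "strip_bound (pi/2 + pi/2 * \<bar>-1\<bar> + (pi/2 * \<bar>- \<theta>\<bar> + - (pi/2) * \<bar>\<theta>\<bar>) + 0)
        (\<lambda>s. Gamma s * Gamma (of_real \<alpha> + of_real (-1) * s) *
          (Gamma (of_real h + of_real (- \<theta>) * s) * rGamma (of_real 0 + of_real \<theta> * s)) * rpow X (of_real \<delta> * s))"
      using \<open>X > 0\<close> \<theta> by (intro strip_bound_mult strip_bound_Gamma strip_bound_rGamma strip_bound_affine
          strip_bound_rpow) auto
    then show ?thesis by (simp add: f_def)
  qed
  \<comment> \<open>The arguments of the sine on the two candidate lines differ by \<open>\<pi> \<theta> / 2\<close>, so by the addition
      theorem one of the two sines is at least half of \<open>sin (\<pi> \<theta> / 2)\<close>.\<close>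
  define \<sigma> where "\<sigma> = sin (pi * (\<theta> / 2)) / 2"
  have \<sigma>: "\<sigma> > 0" using \<theta> by (auto simp: \<sigma>_def intro!: sin_gt_zero)
  have "\<exists>r\<in>{1/4, 3/4}. \<sigma> \<le> \<bar>sin (pi * (\<theta> * (\<alpha> + real k + r) - h))\<bar>" for k
  proof -
    define u v where "u = pi * (\<theta> * (\<alpha> + real k + 1/4) - h)" and "v = pi * (\<theta> * (\<alpha> + real k + 3/4) - h)"
    have vu: "pi * (\<theta> / 2) = v - u" by (simp add: u_def v_def algebra_simps)
    have "2 * \<sigma> = sin (v - u)" unfolding \<sigma>_def vu by simp
    also have "\<dots> = sin v * cos u - cos v * sin u" by (rule sin_diff)
    also have "\<dots> \<le> \<bar>sin v\<bar> * \<bar>cos u\<bar> + \<bar>cos v\<bar> * \<bar>sin u\<bar>"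
    proof -
      have "sin v * cos u \<le> \<bar>sin v\<bar> * \<bar>cos u\<bar>" "- (cos v * sin u) \<le> \<bar>cos v\<bar> * \<bar>sin u\<bar>"
        unfolding abs_mult[symmetric] by (rule abs_ge_self, rule abs_ge_minus_self)
      then show ?thesis by linarith
    qed
    also have "\<dots> \<le> \<bar>sin v\<bar> * 1 + 1 * \<bar>sin u\<bar>" by (intro add_mono mult_mono) auto
    finally have "\<sigma> \<le> \<bar>sin u\<bar> \<or> \<sigma> \<le> \<bar>sin v\<bar>" by linarith
    then show ?thesis by (auto simp: u_def v_def)
  qed
  then obtain r where r: "\<And>k. r k \<in> {1/4, 3/4}"
    "\<And>k. \<sigma> \<le> \<bar>sin (pi * (\<theta> * (\<alpha> + real k + r k) - h))\<bar>" by metis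
  define R where "R k = \<alpha> + real k + r k" for k
  have r01: "1/4 \<le> r k" "r k \<le> 3/4" for k using r(1)[of k] by auto
  have R_top: "filterlim R at_top sequentially"
  proof (rule filterlim_at_top_mono)
    show "filterlim (\<lambda>k. real k) at_top sequentially" by (rule filterlim_real_sequentially)
    show "\<forall>\<^sub>F k in sequentially. real k \<le> R k"
    proof (intro always_eventually allI)
      show "real k \<le> R k" for k using r01[of k] \<alpha> by (simp add: R_def)
    qed
  qed
  have sin_alpha: "\<bar>sin (pi * (R k - \<alpha>))\<bar> = sqrt 2 / 2" for k
  proof -
    have "sin (pi * (3/4)) = sin (pi / 4)"
      using sin_pi_minus[of "pi/4"] by (simp add: field_simps)
    then have s: "sin (pi * (1/4)) = sqrt 2 / 2" "sin (pi * (3/4)) = sqrt 2 / 2"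
      by (simp_all add: sin_45)
    have "r k = 1/4 \<or> r k = 3/4" using r(1)[of k] by blast
    then have "sin (pi * r k) = sqrt 2 / 2" using s by metis
    then have "\<bar>sin (pi * r k)\<bar> = sqrt 2 / 2" by (metis abs_of_nonneg divide_nonneg_nonneg real_sqrt_ge_zero zero_le_numeral)
    then show ?thesis using abs_sin_add_pi_multiple[of k "r k"] by (simp add: R_def)
  qed
  \<comment> \<open>The number of poles \<open>(h + n) / \<theta>\<close> to the left of the line \<open>Re s = R k\<close>.\<close>
  define N where "N k = nat \<lceil>\<theta> * R k - h\<rceil>" for k
  have N: "n < N k \<longleftrightarrow> h + real n < \<theta> * R k" for n k unfolding N_def by linarith
  have Nge: "h + real n \<noteq> \<theta> * R k" for n k
  proof
    assume "h + real n = \<theta> * R k"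
    then have "\<theta> * (\<alpha> + real k + r k) - h = real n + 0" by (simp add: R_def)
    then have "\<sigma> \<le> \<bar>sin (pi * (real n + 0))\<bar>" using r(2)[of k] by simp
    then show False unfolding abs_sin_add_pi_multiple using \<sigma> by simp
  qed
  define pts where "pts k = p ` {..k} \<union> q ` {..<N k}" for k
  \<comment> \<open>The abscissa of the first pole beyond \<open>R k\<close>: up to it there are only finitely many poles.\<close>
  define b where "b k = min (\<alpha> + real k + 1) ((h + real (N k)) / \<theta>)" for k
  define S where "S k = {s. 0 < Re s} \<inter> {s. Re s < b k}" for k
  have S: "open (S k)" "convex (S k)" for k
    unfolding S_def by (auto intro!: open_Int open_halfspace_Re_gt open_halfspace_Re_lt
        convex_Int convex_halfspace_Re_gt convex_halfspace_Re_lt)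
  have holS: "f holomorphic_on S k - pts k" for k
  proof (rule holomorphic_on_subset[OF holf])
    have "n \<le> k" if "p n \<in> S k" for n using that by (auto simp: S_def b_def p_def)
    moreover have "n < N k" if "q n \<in> S k" for n using that \<theta> by (auto simp: S_def b_def q_def divide_less_cancel)
    ultimately show "S k - pts k \<subseteq> {s. 0 < Re s} - range p - range q"
      by (auto simp: pts_def) (auto simp: S_def)
  qed
  have shift: "integrable lborel (\<lambda>y. f (Complex (R k) y))"
    "vline_int c f = vline_int (R k) f - 2 * of_real pi * (\<Sum>p\<in>pts k. residue f p)" for k
  proof -
    have "\<theta> * R k < h + real (N k)" using N[of "N k" k] Nge[of "N k" k] by auto
    then have "R k < (h + real (N k)) / \<theta>" using \<theta> by (simp add: field_simps)
    then have 1: "\<And>s. c \<le> Re s \<Longrightarrow> Re s \<le> R k \<Longrightarrow> s \<in> S k"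
      using c' r01[of k] by (auto simp: S_def b_def R_def)
    have 2: "c < R k" using c' r01[of k] by (auto simp: R_def)
    have 3: "c < Re z \<and> Re z < R k" if "z \<in> pts k" for z
    proof -
      consider n where "n \<le> k" "z = p n" | n where "n < N k" "z = q n" using \<open>z \<in> pts k\<close> by (auto simp: pts_def)
      then show ?thesis
      proof cases
        case 1
        then show ?thesis using c' r01[of k] by (simp add: p_def R_def)
      next
        case 2
        have "h / \<theta> \<le> (h + real n) / \<theta>" using \<theta> by (intro divide_right_mono) auto
        moreover have "(h + real n) / \<theta> < R k" using 2 N[of n k] \<theta> by (simp add: field_simps)
        ultimately show ?thesis using 2 c' by (simp add: q_def)
      qed
    qed
    have 4: "finite (pts k)" by (auto simp: pts_def)
    show "integrable lborel (\<lambda>y. f (Complex (R k) y))"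
      by (rule vline_shift_residues(2)[OF S(1) 1 S(2) 2 4 holS 3 sb]) auto
    show "vline_int c f = vline_int (R k) f - 2 * of_real pi * (\<Sum>p\<in>pts k. residue f p)"
      by (rule vline_shift_residues(3)[OF S(1) 1 S(2) 2 4 holS 3 sb]) auto
  qed
  obtain M :: nat where M: "\<alpha> \<le> real M" using real_arch_simple by blast
  define B where "B x = x ^ M * X powr (\<delta> * x) / Gamma (\<theta> * x)" for x
  define C where "C = 2 * pi / (sqrt 2 / 2) * (2 * pi / \<sigma>)"
  have "(B \<longlongrightarrow> 0) at_top"
  proof -
    \<comment> \<open>The power \<open>Z powr (\<theta> x)\<close> equals \<open>exp x * X powr (\<delta> x)\<close>; the factor \<open>exp x\<close> absorbs \<open>x ^ M\<close>.\<close>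
    define Z where "Z = exp (1 / \<theta>) * X\<^sup>2"
    have "Z > 0" using \<open>X > 0\<close> by (simp add: Z_def)
    have B_eq: "B x = (x ^ M * exp (- x)) * (Z powr (\<theta> * x) / Gamma (\<theta> * x))" for x
    proof -
      have "Z powr (\<theta> * x) = exp x * X powr (\<delta> * x)"
        using \<open>X > 0\<close> \<theta> by (simp add: Z_def powr_def ln_mult ln_realpow field_simps flip: exp_add)
      then show ?thesis by (simp add: B_def exp_minus)
    qed
    have "((\<lambda>x::real. x ^ M * exp (- x)) \<longlongrightarrow> 0) at_top" by real_asymp
    moreover have "filterlim (\<lambda>x. \<theta> * x) at_top at_top" using \<theta>(1) by real_asymp
    ultimately have "((\<lambda>x. (x ^ M * exp (- x)) * (Z powr (\<theta> * x) / Gamma (\<theta> * x))) \<longlongrightarrow> 0 * 0) at_top"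
      by (intro tendsto_mult filterlim_compose[OF powr_over_Gamma_tendsto_0[OF \<open>Z > 0\<close>]])
    then show ?thesis unfolding B_eq[abs_def] by simp
  qed
  then have B0: "(\<lambda>k. C * B (R k)) \<longlonglongrightarrow> 0"
    using tendsto_mult_right_zero[OF filterlim_compose[OF _ R_top]] by blast
  have lim: "(\<lambda>k. vline_int (R k) f) \<longlonglongrightarrow> 0"
  proof (rule vline_int_tendsto_0[of "pi/2", OF _ shift(1) _ B0])
    have "eventually (\<lambda>x::real. real M + 1 \<le> x \<and> 1 / \<theta> \<le> x \<and> (1 + h) / \<theta> \<le> x) at_top"
      by (intro eventually_conj eventually_ge_at_top)
    from filterlim_iff[THEN iffD1, OF R_top, rule_format, OF this]
    show "\<forall>\<^sub>F k in sequentially. \<forall>y. norm (f (Complex (R k) y)) \<le> C * B (R k) * exp (- (pi/2) * \<bar>y\<bar>)"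
    proof eventually_elim
      case (elim k)
      define x where "x = R k"
      have x: "real M + 1 \<le> x" "1 \<le> \<theta> * x" "2 \<le> \<theta> * x + 1 - h" "0 < x"
        using elim \<theta> \<alpha> M by (auto simp: x_def field_simps)
      show ?case
      proof
        fix y
        let ?s = "Complex x y"
        have "norm (f ?s) = norm (Gamma ?s) * norm (Gamma (of_real \<alpha> - ?s)) *
            (norm (Gamma (of_real h - of_real \<theta> * ?s)) * norm (rGamma (of_real \<theta> * ?s))) * X powr (\<delta> * x)"
          using \<open>X > 0\<close> by (simp add: f_def norm_mult norm_rpow)
        also have "\<dots> \<le> Gamma x * (2 * pi / (sqrt 2 / 2) * exp (- (pi / 2) * \<bar>y\<bar>) / Gamma (x + 1 - \<alpha>)) *
           ((2 * pi / \<sigma> * exp (- (pi / 2) * (\<theta> * \<bar>y\<bar>)) / 1) * (exp (pi / 2 * (\<theta> * \<bar>y\<bar>)) / Gamma (\<theta> * x))) * X powr (\<delta> * x)"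
        proof (intro mult_right_mono mult_mono)
          show "norm (Gamma ?s) \<le> Gamma x" using norm_Gamma_le[of ?s] x by simp
          have g: "Gamma (x + 1 - \<alpha>) > 0" "Gamma (\<theta> * x) > 0" "Gamma (\<theta> * x + 1 - h) \<ge> 1"
            using x M by (auto intro!: Gamma_real_pos Gamma_ge_1)
          show "norm (Gamma (of_real \<alpha> - ?s)) \<le> 2 * pi / (sqrt 2 / 2) * exp (- (pi / 2) * \<bar>y\<bar>) / Gamma (x + 1 - \<alpha>)"
          proof -
            have sx: "\<bar>sin (pi * (Re ?s - \<alpha>))\<bar> = sqrt 2 / 2" using sin_alpha[of k] by (simp add: x_def)
            then have nz: "sin (pi * (Re ?s - \<alpha>)) \<noteq> 0" by auto
            have ge: "1/2 \<le> Re ?s + 1 - \<alpha>" using x M by simp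
            from norm_Gamma_reflected_le[OF nz ge] show ?thesis unfolding sx by simp
          qed
          have "norm (Gamma (of_real h - of_real \<theta> * ?s)) \<le> 2 * pi / \<bar>sin (pi * (\<theta> * x - h))\<bar>
              * exp (- (pi / 2) * (\<theta> * \<bar>y\<bar>)) / Gamma (\<theta> * x + 1 - h)"
            using norm_Gamma_reflected_le[of "of_real \<theta> * ?s" h] r(2)[of k] \<sigma> x \<theta>
            by (auto simp: x_def R_def abs_mult)
          also have "\<dots> \<le> 2 * pi / \<sigma> * exp (- (pi / 2) * (\<theta> * \<bar>y\<bar>)) / 1"
            using g r(2)[of k] \<sigma> by (intro frac_le mult_right_mono) (auto simp: x_def R_def)
          finally show "norm (Gamma (of_real h - of_real \<theta> * ?s)) \<le> \<dots>" .
          show "norm (rGamma (of_real \<theta> * ?s)) \<le> exp (pi / 2 * (\<theta> * \<bar>y\<bar>)) / Gamma (\<theta> * x)"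
            using norm_rGamma_le[of "of_real \<theta> * ?s"] x \<theta> by (simp add: abs_mult)
          show "0 \<le> Gamma x" using x by (intro Gamma_real_nonneg) auto
          show "0 \<le> Gamma x * (2 * pi / (sqrt 2 / 2) * exp (- (pi / 2) * \<bar>y\<bar>) / Gamma (x + 1 - \<alpha>))"
            using g x M by (intro mult_nonneg_nonneg divide_nonneg_nonneg Gamma_real_nonneg) auto
          show "0 \<le> 2 * pi / \<sigma> * exp (- (pi / 2) * (\<theta> * \<bar>y\<bar>)) / 1" using \<sigma> by simp
        qed auto
        also have "\<dots> = C * ((Gamma x / Gamma (x + 1 - \<alpha>)) * X powr (\<delta> * x) / Gamma (\<theta> * x)) * exp (- (pi / 2) * \<bar>y\<bar>)
            * (exp (- (pi / 2) * (\<theta> * \<bar>y\<bar>)) * exp (pi / 2 * (\<theta> * \<bar>y\<bar>)))"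
          by (simp only: C_def divide_inverse inverse_1 mult_1_right mult_1_left mult_ac)
        also have "\<dots> = C * ((Gamma x / Gamma (x + 1 - \<alpha>)) * X powr (\<delta> * x) / Gamma (\<theta> * x)) * exp (- (pi / 2) * \<bar>y\<bar>)"
          by (simp flip: exp_add)
        also have "\<dots> \<le> C * B x * exp (- (pi / 2) * \<bar>y\<bar>)"
          unfolding B_def using x M \<alpha> \<sigma>
          by (intro mult_right_mono mult_left_mono divide_right_mono Gamma_quotient_le Gamma_real_nonneg)
            (auto simp: C_def)
        finally show "norm (f (Complex (R k) y)) \<le> C * B (R k) * exp (- (pi/2) * \<bar>y\<bar>)"
          by (simp add: x_def)
      qed
    qed
  qed auto
  let ?t1 = "cauchy_term1 d \<delta> l X" and ?t2 = "cauchy_term2 d \<delta> l X"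
  have sumres: "(\<Sum>z\<in>pts k. residue f z) = - of_real ((\<Sum>n\<le>k. ?t1 n) + 2 / \<delta> * (\<Sum>n<N k. ?t2 n))" for k
  proof -
    have "(\<Sum>z\<in>pts k. residue f z) = (\<Sum>z\<in>p ` {..k}. residue f z) + (\<Sum>z\<in>q ` {..<N k}. residue f z)"
      unfolding pts_def using pq by (intro sum.union_disjoint) auto
    also have "\<dots> = (\<Sum>n\<le>k. residue f (p n)) + (\<Sum>n<N k. residue f (q n))"
      using inj by (simp add: sum.reindex inj_on_subset[OF _ subset_UNIV])
    finally show ?thesis by (simp add: resp resq sum_negf sum_distrib_left sum_subtractf)
  qed
  have "filterlim N sequentially sequentially"
    unfolding N_def
  proof (intro filterlim_compose[OF filterlim_nat_sequentially])
    have "filterlim (\<lambda>x. \<lceil>\<theta> * x - h\<rceil>) at_top at_top" using \<theta>(1) by real_asymp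
    then show "filterlim (\<lambda>k. \<lceil>\<theta> * R k - h\<rceil>) at_top sequentially"
      using R_top by (rule filterlim_compose)
  qed
  then have "(\<lambda>k. \<Sum>n<N k. ?t2 n) \<longlonglongrightarrow> suminf ?t2"
    using filterlim_compose[OF summable_LIMSEQ[OF conv2]] by blast
  then have "(\<lambda>k. vline_int (R k) f + 2 * of_real pi * of_real ((\<Sum>n\<le>k. ?t1 n) + 2 / \<delta> * (\<Sum>n<N k. ?t2 n)))
      \<longlonglongrightarrow> 0 + 2 * of_real pi * of_real (suminf ?t1 + 2 / \<delta> * suminf ?t2)"
    using conv1 by (intro tendsto_intros lim summable_LIMSEQ')
  moreover have "vline_int c f = vline_int (R k) f + 2 * of_real pi * of_real ((\<Sum>n\<le>k. ?t1 n) + 2 / \<delta> * (\<Sum>n<N k. ?t2 n))" for k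
    unfolding shift(2)[of k] sumres by (simp only: mult_minus_right diff_minus_eq_add)
  ultimately have "(\<lambda>k::nat. vline_int c f) \<longlonglongrightarrow> 0 + 2 * of_real pi * of_real (suminf ?t1 + 2 / \<delta> * suminf ?t2)"
    by simp
  then have "vline_int c f = of_real (2 * pi * (suminf ?t1 + 2 / \<delta> * suminf ?t2))"
    by (simp add: LIMSEQ_const_iff)
  then show ?thesis by (simp add: f_def \<alpha>_def h_def \<theta>_def)
qed

section \<open>Integrals over the positive half-line\<close>

text \<open>Lebesgue measure on the positive half-line, as a density on the Borel sets of the whole line: measurability
is then that of functions on all of \<open>\<real>\<close>, and statements about positive arguments hold almost everywhere.\<close>

definition half_line :: "real measure" where
  "half_line = density lborel (indicator {0<..})"

lemma sets_half_line [measurable_cong, simp]: "sets half_line = sets borel"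
  and space_half_line [simp]: "space half_line = UNIV"
  by (simp_all add: half_line_def)

lemma AE_half_line_iff: "(AE t in half_line. P t) \<longleftrightarrow> (AE t in lborel. 0 < t \<longrightarrow> P t)"
  unfolding half_line_def by (subst AE_density) (auto simp: indicator_def)

lemma AE_half_lineI: "(\<And>t. 0 < t \<Longrightarrow> P t) \<Longrightarrow> AE t in half_line. P t"
  by (simp add: AE_half_line_iff)

interpretation half_line: sigma_finite_measure half_line
  unfolding half_line_def
  by (subst sigma_finite_measure.sigma_finite_iff_density_finite[OF sigma_finite_lborel])
    (auto simp: indicator_def)

interpretation half_line_pair: pair_sigma_finite half_line half_line ..

interpretation lborel_half_line: pair_sigma_finite lborel half_line ..

lemma half_line_set_integral:
  fixes f :: "real \<Rightarrow> 'a::{banach, second_countable_topology}"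
  assumes "f \<in> borel_measurable borel"
  shows "integrable half_line f \<longleftrightarrow> set_integrable lborel {0<..} f"
    and "(LINT t|half_line. f t) = (LINT t:{0<..}|lborel. f t)"
proof -
  have d: "half_line = density lborel (\<lambda>t. ennreal (indicator {0<..} t))"
    unfolding half_line_def by (simp add: ennreal_indicator)
  show "integrable half_line f \<longleftrightarrow> set_integrable lborel {0<..} f"
    unfolding d set_integrable_def using assms by (subst integrable_density) auto
  show "(LINT t|half_line. f t) = (LINT t:{0<..}|lborel. f t)"
    unfolding d set_lebesgue_integral_def using assms by (subst integral_density) auto
qed

lemma half_line_absolutely_integrable:
  fixes f :: "real \<Rightarrow> 'a::euclidean_space"
  assumes "f \<in> borel_measurable borel" "f absolutely_integrable_on {0<..}"
  shows "integrable half_line f" "(LINT t|half_line. f t) = integral {0<..} f"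
proof -
  have s: "set_integrable lborel {0<..} f"
    using assms(2) unfolding set_integrable_def
    using integrable_completion[of "\<lambda>t. indicator {0<..} t *\<^sub>R f t" lborel] assms(1) by auto
  then show "integrable half_line f" using half_line_set_integral(1)[OF assms(1)] by blast
  show "(LINT t|half_line. f t) = integral {0<..} f"
    using set_borel_integral_eq_integral(2)[OF s] by (simp add: half_line_set_integral assms(1))
qed

lemma half_line_has_integral:
  fixes f :: "real \<Rightarrow> 'a::euclidean_space"
  assumes "f \<in> borel_measurable borel" "integrable half_line f"
  shows "(f has_integral (LINT t|half_line. f t)) {0..}"
proof -
  have s: "set_integrable lborel {0<..} f" using half_line_set_integral(1)[OF assms(1)] assms(2) by blast
  have "(f has_integral (LINT t|half_line. f t)) {0<..}"
    using set_borel_integral_eq_integral[OF s] half_line_set_integral(2)[OF assms(1)]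
    by (simp add: has_integral_integrable_integral)
  then have "((\<lambda>t. if t \<in> {0<..} then f t else 0) has_integral (LINT t|half_line. f t)) {0..}"
    by (subst has_integral_restrict) auto
  then show ?thesis by (rule has_integral_spike[of "{0}", rotated 2]) auto
qed

lemma half_line_integrable_bound:
  fixes f :: "real \<Rightarrow> 'a::{banach, second_countable_topology}" and g :: "real \<Rightarrow> real"
  assumes "integrable half_line g" "f \<in> borel_measurable borel" "\<And>t. 0 < t \<Longrightarrow> norm (f t) \<le> g t"
  shows "integrable half_line f"
  by (rule Bochner_Integration.integrable_bound[OF assms(1)])
    (use assms in \<open>auto intro!: AE_half_lineI intro: order_trans[OF _ abs_ge_self]\<close>)

lemma half_line_integral_cong:
  fixes f g :: "real \<Rightarrow> 'a::{banach, second_countable_topology}"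
  assumes "f \<in> borel_measurable borel" "g \<in> borel_measurable borel" "\<And>t. 0 < t \<Longrightarrow> f t = g t"
  shows "(LINT t|half_line. f t) = (LINT t|half_line. g t)"
    and "integrable half_line f \<longleftrightarrow> integrable half_line g"
  by (rule integral_cong_AE integrable_cong_AE; use assms in \<open>simp add: AE_half_lineI\<close>)+

lemma rpow_measurable [measurable]:
  assumes [measurable]: "f \<in> borel_measurable M" "g \<in> borel_measurable M"
  shows "(\<lambda>x. rpow (f x) (g x)) \<in> borel_measurable M"
  unfolding rpow_def by measurable

lemma powr_eq_rpow: "t > 0 \<Longrightarrow> complex_of_real t powr s = rpow t s"
  by (simp add: powr_def rpow_def Ln_of_real)

lemma gamma_integral:
  assumes "Re a > 0" "p > 0"
  shows "integrable half_line (\<lambda>t. rpow t (a - 1) * of_real (exp (- p * t)))"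
    and "(LINT t|half_line. rpow t (a - 1) * of_real (exp (- p * t))) = Gamma a * rpow p (- a)"
proof -
  let ?f = "\<lambda>t. of_real t powr (a - 1) / of_real (exp t)"
  let ?g = "\<lambda>t. rpow t (a - 1) * complex_of_real (exp (- p * t))"
  have im: "(*) p ` {0<..} = {0<..}"
  proof (intro equalityI subsetI)
    fix x :: real assume "x \<in> {0<..}"
    then show "x \<in> (*) p ` {0<..}" using assms(2) by (intro image_eqI[of _ _ "x / p"]) auto
  qed (use assms(2) in auto)
  have cov: "(\<lambda>t. \<bar>p\<bar> *\<^sub>R ?f (p * t)) absolutely_integrable_on {0<..} \<and>
      integral {0<..} (\<lambda>t. \<bar>p\<bar> *\<^sub>R ?f (p * t)) = Gamma a"
  proof (subst has_absolute_integral_change_of_variables_real)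
    show "?f absolutely_integrable_on (*) p ` {0<..} \<and> integral ((*) p ` {0<..}) ?f = Gamma a"
      unfolding im using absolutely_integrable_Gamma_integral'[OF assms(1)]
        integral_unique[OF Gamma_integral_complex'[OF assms(1)]] by simp
  qed (use assms(2) in \<open>auto intro!: derivative_eq_intros simp: inj_on_def\<close>)
  have eq: "\<bar>p\<bar> *\<^sub>R ?f (p * t) = rpow p a * ?g t" if "t \<in> {0<..}" for t
  proof -
    have "rpow p a = of_real p * rpow p (a - 1)"
      using rpow_add[of p 1 "a - 1"] rpow_of_real[of p 1] assms(2) by simp
    moreover have "complex_of_real (p * t) powr (a - 1) = rpow p (a - 1) * rpow t (a - 1)"
      using assms(2) that by (simp only: powr_eq_rpow rpow_mult mult_pos_pos greaterThan_iff)
    moreover have "inverse (complex_of_real (exp (p * t))) = of_real (exp (- p * t))"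
      by (simp only: exp_minus of_real_inverse mult_minus_left)
    moreover have "\<bar>p\<bar> = p" using assms(2) by simp
    ultimately show ?thesis
      by (simp only: scaleR_conv_of_real divide_inverse mult_ac)
  qed
  have c1: "(\<lambda>t. \<bar>p\<bar> *\<^sub>R ?f (p * t)) absolutely_integrable_on {0<..} \<longleftrightarrow> (\<lambda>t. rpow p a * ?g t) absolutely_integrable_on {0<..}"
    by (rule set_integrable_cong[OF refl refl eq])
  have c2: "integral {0<..} (\<lambda>t. \<bar>p\<bar> *\<^sub>R ?f (p * t)) = integral {0<..} (\<lambda>t. rpow p a * ?g t)"
    by (rule integral_cong[OF eq])
  have ai: "(\<lambda>t. rpow p a * ?g t) absolutely_integrable_on {0<..}" and i: "integral {0<..} (\<lambda>t. rpow p a * ?g t) = Gamma a"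
    using cov unfolding c1 c2 by blast+
  have "(\<lambda>t. rpow p a * ?g t) \<in> borel_measurable borel" by measurable
  note * = half_line_absolutely_integrable[OF this ai]
  have nz: "rpow p a \<noteq> 0" by (simp add: rpow_def)
  have inv: "?g t = rpow p (- a) * (rpow p a * ?g t)" for t
    by (simp add: rpow_def exp_minus field_simps)
  show "integrable half_line ?g"
    by (subst inv, rule integrable_mult_right, rule *(1))
  have "(LINT t|half_line. ?g t) = rpow p (- a) * (LINT t|half_line. rpow p a * ?g t)"
    by (subst inv) (rule integral_mult_right_zero)
  then show "(LINT t|half_line. ?g t) = Gamma a * rpow p (- a)"
    unfolding *(2) i by simp
qed

lemma gaussian_moment_integral:
  assumes "Re w > 0" "v > 0"
  shows "integrable half_line (\<lambda>r. rpow r (w - 1) * of_real (exp (- v * r\<^sup>2)))"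
    and "(LINT r|half_line. rpow r (w - 1) * of_real (exp (- v * r\<^sup>2)))
          = Gamma (w / 2) / 2 * rpow v (- w / 2)"
proof -
  let ?a = "w / 2"
  let ?f = "\<lambda>t. of_real t powr (?a - 1) / of_real (exp t)"
  let ?g = "\<lambda>r. rpow r (w - 1) * complex_of_real (exp (- v * r\<^sup>2))"
  let ?\<phi> = "\<lambda>r::real. v * r\<^sup>2"
  have a: "Re ?a > 0" using assms(1) by simp
  have im: "?\<phi> ` {0<..} = {0<..}"
  proof (intro equalityI subsetI)
    fix x :: real assume "x \<in> {0<..}"
    then show "x \<in> ?\<phi> ` {0<..}" using assms(2) by (intro image_eqI[of _ _ "sqrt (x / v)"]) auto
  qed (use assms(2) in auto)
  have cov: "(\<lambda>r. \<bar>2 * v * r\<bar> *\<^sub>R ?f (?\<phi> r)) absolutely_integrable_on {0<..} \<and>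
      integral {0<..} (\<lambda>r. \<bar>2 * v * r\<bar> *\<^sub>R ?f (?\<phi> r)) = Gamma ?a"
  proof (subst has_absolute_integral_change_of_variables_real)
    show "?f absolutely_integrable_on ?\<phi> ` {0<..} \<and> integral (?\<phi> ` {0<..}) ?f = Gamma ?a"
      unfolding im using absolutely_integrable_Gamma_integral'[OF a]
        integral_unique[OF Gamma_integral_complex'[OF a]] by simp
  qed (use assms(2) in \<open>auto intro!: derivative_eq_intros simp: inj_on_def\<close>)
  have eq: "\<bar>2 * v * r\<bar> *\<^sub>R ?f (?\<phi> r) = (2 * rpow v ?a) * ?g r" if "r \<in> {0<..}" for r
  proof -
    have A: "rpow v ?a = of_real v * rpow v (?a - 1)"
      using rpow_add[of v 1 "?a - 1"] rpow_of_real[of v 1] assms(2) by simp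
    have Z: "of_real r * (rpow (r\<^sup>2) (?a - 1)) = rpow r (w - 1)"
      using rpow_powr[of r 2 "?a - 1"] rpow_add[of r 1 "w - 2"] rpow_of_real[of r 1] that
      by (simp add: right_diff_distrib)
    have B: "complex_of_real (v * r\<^sup>2) powr (?a - 1) = rpow v (?a - 1) * rpow (r\<^sup>2) (?a - 1)"
      using assms(2) that by (simp only: powr_eq_rpow rpow_mult mult_pos_pos zero_less_power greaterThan_iff)
    have C: "inverse (complex_of_real (exp (v * r\<^sup>2))) = of_real (exp (- v * r\<^sup>2))"
      by (simp only: exp_minus of_real_inverse mult_minus_left)
    have D: "complex_of_real \<bar>2 * v * r\<bar> = 2 * of_real v * of_real r" using assms(2) that by simp
    have F: "\<bar>2 * v * r\<bar> *\<^sub>R ?f (?\<phi> r) = 2 * rpow v ?a * (of_real r * rpow (r\<^sup>2) (?a - 1))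
        * of_real (exp (- v * r\<^sup>2))"
      unfolding scaleR_conv_of_real divide_inverse B[unfolded divide_inverse] C D A[unfolded divide_inverse] by (simp only: divide_inverse mult_ac)
    show ?thesis unfolding F Z by (simp only: mult_ac)
  qed
  have c1: "(\<lambda>t. \<bar>2 * v * t\<bar> *\<^sub>R ?f (?\<phi> t)) absolutely_integrable_on {0<..} \<longleftrightarrow> (\<lambda>t. (2 * rpow v ?a) * ?g t) absolutely_integrable_on {0<..}"
    by (rule set_integrable_cong[OF refl refl eq])
  have c2: "integral {0<..} (\<lambda>t. \<bar>2 * v * t\<bar> *\<^sub>R ?f (?\<phi> t)) = integral {0<..} (\<lambda>t. (2 * rpow v ?a) * ?g t)"
    by (rule integral_cong[OF eq])
  have ai: "(\<lambda>t. (2 * rpow v ?a) * ?g t) absolutely_integrable_on {0<..}" and i: "integral {0<..} (\<lambda>t. (2 * rpow v ?a) * ?g t) = Gamma ?a"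
    using cov unfolding c1 c2 by blast+
  have "(\<lambda>t. (2 * rpow v ?a) * ?g t) \<in> borel_measurable borel" by measurable
  note * = half_line_absolutely_integrable[OF this ai]
  have inv: "?g t = rpow v (- w / 2) / 2 * ((2 * rpow v ?a) * ?g t)" for t
    by (simp add: rpow_def exp_minus field_simps)
  show "integrable half_line ?g"
    by (subst inv, rule integrable_mult_right, rule *(1))
  have "(LINT t|half_line. ?g t) = rpow v (- w / 2) / 2 * (LINT t|half_line. (2 * rpow v ?a) * ?g t)"
    by (subst inv) (rule integral_mult_right_zero)
  then show "(LINT t|half_line. ?g t) = Gamma (w / 2) / 2 * rpow v (- w / 2)"
    unfolding *(2) i by simp
qed


lemma half_line_real_of_complex:
  fixes f :: "real \<Rightarrow> real"
  assumes "integrable half_line F" "(LINT t|half_line. F t) = complex_of_real c"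
    and "F \<in> borel_measurable borel" "f \<in> borel_measurable borel"
    and eq: "\<And>t. 0 < t \<Longrightarrow> F t = of_real (f t)"
  shows "integrable half_line f" "(LINT t|half_line. f t) = c"
proof -
  have m: "(\<lambda>t. complex_of_real (f t)) \<in> borel_measurable borel" using assms(4) by measurable
  have i: "integrable half_line (\<lambda>t. complex_of_real (f t))"
    using assms(1) half_line_integral_cong(2)[OF assms(3) m eq] by blast
  show "integrable half_line f" using integrable_Re[OF i] by simp
  have "complex_of_real (LINT t|half_line. f t) = (LINT t|half_line. complex_of_real (f t))"
    by (rule integral_complex_of_real[symmetric])
  also have "\<dots> = (LINT t|half_line. F t)"
    by (rule half_line_integral_cong(1)[OF m assms(3)]) (simp add: eq)
  finally show "(LINT t|half_line. f t) = c" using assms(2) by simp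
qed

lemma gamma_integral_real:
  fixes a p :: real
  assumes "a > 0" "p > 0"
  shows "integrable half_line (\<lambda>t. t powr (a - 1) * exp (- p * t))"
    and "(LINT t|half_line. t powr (a - 1) * exp (- p * t)) = Gamma a * p powr (- a)"
proof -
  let ?F = "\<lambda>t. rpow t (of_real a - 1) * complex_of_real (exp (- p * t))"
  have "Re (of_real a) > 0" using assms by simp
  note g = gamma_integral[OF this assms(2)]
  have v: "(LINT t|half_line. ?F t) = of_real (Gamma a * p powr (- a))"
    unfolding g(2) using rpow_of_real[of p "- a"] assms by (simp add: Gamma_complex_of_real)
  have m: "?F \<in> borel_measurable borel" "(\<lambda>t. t powr (a - 1) * exp (- p * t)) \<in> borel_measurable borel"
    by measurable
  have eq: "?F t = of_real (t powr (a - 1) * exp (- p * t))" if "0 < t" for t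
    using rpow_of_real[of t "a - 1"] that by simp
  show "integrable half_line (\<lambda>t. t powr (a - 1) * exp (- p * t))"
    and "(LINT t|half_line. t powr (a - 1) * exp (- p * t)) = Gamma a * p powr (- a)"
    using half_line_real_of_complex[OF g(1) v m eq] by auto
qed

lemma gaussian_moment_real:
  fixes w v :: real
  assumes "w > 0" "v > 0"
  shows "integrable half_line (\<lambda>r. r powr (w - 1) * exp (- v * r\<^sup>2))"
    and "(LINT r|half_line. r powr (w - 1) * exp (- v * r\<^sup>2)) = Gamma (w / 2) / 2 * v powr (- w / 2)"
proof -
  let ?F = "\<lambda>t. rpow t (of_real w - 1) * complex_of_real (exp (- v * t\<^sup>2))"
  have "Re (of_real w) > 0" using assms by simp
  note g = gaussian_moment_integral[OF this assms(2)]
  have v: "(LINT t|half_line. ?F t) = of_real (Gamma (w / 2) / 2 * v powr (- w / 2))"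
    unfolding g(2) using rpow_of_real[of v "- w / 2"] assms Gamma_complex_of_real[of "w / 2"] by simp
  have m: "?F \<in> borel_measurable borel" "(\<lambda>t. t powr (w - 1) * exp (- v * t\<^sup>2)) \<in> borel_measurable borel"
    by measurable
  have eq: "?F t = of_real (t powr (w - 1) * exp (- v * t\<^sup>2))" if "0 < t" for t
    using rpow_of_real[of t "w - 1"] that by simp
  show "integrable half_line (\<lambda>r. r powr (w - 1) * exp (- v * r\<^sup>2))"
    and "(LINT r|half_line. r powr (w - 1) * exp (- v * r\<^sup>2)) = Gamma (w / 2) / 2 * v powr (- w / 2)"
    using half_line_real_of_complex[OF g(1) v m eq] by auto
qed

text \<open>Write \<open>(r^2 + z^2) powr -q\<close> as a Gamma integral over \<open>v\<close> and interchange: the inner integral over \<open>r\<close> is then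
a Gaussian moment, and the remaining integral over \<open>v\<close> is again a Gamma integral.\<close>

lemma rational_moment_integral:
  fixes q z :: real
  assumes w: "0 < Re w" "Re w < 2 * q" and "z > 0"
  shows "integrable half_line (\<lambda>r. rpow r (w - 1) * of_real ((r\<^sup>2 + z\<^sup>2) powr (- q)))"
    and "(LINT r|half_line. rpow r (w - 1) * of_real ((r\<^sup>2 + z\<^sup>2) powr (- q)))
       = Gamma (w / 2) * Gamma (of_real q - w / 2) / (2 * of_real (Gamma q)) * rpow z (w - of_real (2 * q))"
proof -
  have q: "q > 0" using w by simp
  define F where "F v r = rpow r (w - 1) * rpow v (of_real q - 1) *
      complex_of_real (exp (- v * r\<^sup>2) * exp (- z\<^sup>2 * v))" for v r
  have Fm [measurable]: "case_prod F \<in> borel_measurable (half_line \<Otimes>\<^sub>M half_line)"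
    unfolding F_def case_prod_unfold by measurable
  have normF: "norm (F v r) = (v powr (q - 1) * exp (- z\<^sup>2 * v)) * (r powr (Re w - 1) * exp (- v * r\<^sup>2))"
    if "0 < v" "0 < r" for v r
    using that by (simp add: F_def norm_mult norm_rpow)
  have Fr: "F v r = (rpow v (of_real q - 1) * of_real (exp (- z\<^sup>2 * v))) *
      (rpow r (w - 1) * of_real (exp (- v * r\<^sup>2)))" for v r by (simp add: F_def)
  have Fv: "F v r = rpow r (w - 1) * (rpow v (of_real q - 1) * of_real (exp (- (r\<^sup>2 + z\<^sup>2) * v)))" for v r
  proof -
    have "exp (- v * r\<^sup>2) * exp (- z\<^sup>2 * v) = exp (- (r\<^sup>2 + z\<^sup>2) * v)"
      by (simp add: algebra_simps flip: exp_add)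
    then show ?thesis unfolding F_def by (simp only: mult_ac)
  qed
  have norm_inner: "(LINT r|half_line. norm (F v r))
      = Gamma (Re w / 2) / 2 * (v powr (q - Re w / 2 - 1) * exp (- z\<^sup>2 * v))" if v: "0 < v" for v
  proof -
    have "(LINT r|half_line. norm (F v r))
        = (LINT r|half_line. (v powr (q - 1) * exp (- z\<^sup>2 * v)) * (r powr (Re w - 1) * exp (- v * r\<^sup>2)))"
    proof (rule half_line_integral_cong(1))
      show "(\<lambda>r. norm (F v r)) \<in> borel_measurable borel" unfolding F_def by measurable
    qed (measurable, simp add: normF[OF v])
    also have "\<dots> = (v powr (q - 1) * exp (- z\<^sup>2 * v)) * (Gamma (Re w / 2) / 2 * v powr (- Re w / 2))"
      using gaussian_moment_real(2)[OF w(1) v] by simp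
    also have "v powr (q - 1) * v powr (- Re w / 2) = v powr (q - Re w / 2 - 1)"
      by (simp flip: powr_add add: algebra_simps)
    then have "(v powr (q - 1) * exp (- z\<^sup>2 * v)) * (Gamma (Re w / 2) / 2 * v powr (- Re w / 2))
        = Gamma (Re w / 2) / 2 * (v powr (q - Re w / 2 - 1) * exp (- z\<^sup>2 * v))"
      by (simp add: mult_ac)
    finally show ?thesis .
  qed
  have z2: "z\<^sup>2 > 0" using \<open>z > 0\<close> by simp
  have Fi: "integrable (half_line \<Otimes>\<^sub>M half_line) (case_prod F)"
  proof (rule half_line_pair.Fubini_integrable[OF Fm])
    have "integrable half_line (\<lambda>v. Gamma (Re w / 2) / 2 * (v powr (q - Re w / 2 - 1) * exp (- z\<^sup>2 * v)))"
      using w z2 by (intro integrable_mult_right gamma_integral_real(1)) auto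
    then show "integrable half_line (\<lambda>v. LINT r|half_line. norm (case_prod F (v, r)))"
      using w by (rule_tac half_line_integrable_bound)
        (auto simp: norm_inner intro!: mult_nonneg_nonneg Gamma_real_nonneg)
    show "AE v in half_line. integrable half_line (\<lambda>r. case_prod F (v, r))"
      unfolding case_prod_conv Fr
      by (intro AE_half_lineI integrable_mult_right gaussian_moment_integral(1) w)
  qed
  have r2z2: "0 < r\<^sup>2 + z\<^sup>2" for r using z2 by (simp add: add_nonneg_pos)
  have inner_v: "(LINT v|half_line. F v r) = of_real (Gamma q) * (rpow r (w - 1) * of_real ((r\<^sup>2 + z\<^sup>2) powr (- q)))" for r
  proof -
    have "(LINT v|half_line. F v r) = rpow r (w - 1) * (Gamma (of_real q) * rpow (r\<^sup>2 + z\<^sup>2) (- of_real q))"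
      unfolding Fv using gamma_integral(2)[of "of_real q", OF _ r2z2] q by simp
    then show ?thesis using rpow_of_real[OF r2z2[of r], of "- q"] by (simp add: Gamma_complex_of_real)
  qed
  have nz: "complex_of_real (Gamma q) \<noteq> 0" using Gamma_real_pos[OF q] by simp
  have "integrable half_line (\<lambda>r. LINT v|half_line. F v r)" by (rule half_line_pair.integrable_snd[OF Fi])
  then show "integrable half_line (\<lambda>r. rpow r (w - 1) * of_real ((r\<^sup>2 + z\<^sup>2) powr (- q)))"
  proof -
    assume "integrable half_line (\<lambda>r. LINT v|half_line. F v r)"
    then have "integrable half_line (\<lambda>r. inverse (of_real (Gamma q)) * (of_real (Gamma q) *
        (rpow r (w - 1) * complex_of_real ((r\<^sup>2 + z\<^sup>2) powr (- q)))))"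
      unfolding inner_v by (rule integrable_mult_right)
    then show ?thesis using nz by (simp flip: mult.assoc)
  qed
  have "of_real (Gamma q) * (LINT r|half_line. rpow r (w - 1) * of_real ((r\<^sup>2 + z\<^sup>2) powr (- q)))
      = (LINT r|half_line. LINT v|half_line. F v r)" unfolding inner_v by simp
  also have "\<dots> = (LINT v|half_line. LINT r|half_line. F v r)"
    by (rule half_line_pair.Fubini_integral[OF Fi])
  also have "\<dots> = (LINT v|half_line. Gamma (w / 2) / 2 * (rpow v ((of_real q - w / 2) - 1) * of_real (exp (- z\<^sup>2 * v))))"
  proof (rule half_line_integral_cong)
    show "(\<lambda>v. LINT r|half_line. F v r) \<in> borel_measurable borel"
      using borel_measurable_integrable[OF half_line_pair.integrable_fst[OF Fi]] by simp
    fix v :: real assume v: "0 < v"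
    have "(LINT r|half_line. F v r) = (rpow v (of_real q - 1) * of_real (exp (- z\<^sup>2 * v))) * (Gamma (w / 2) / 2 * rpow v (- w / 2))"
      unfolding Fr using gaussian_moment_integral(2)[OF w(1) v] by simp
    also have "\<dots> = Gamma (w / 2) / 2 * ((rpow v (of_real q - 1) * rpow v (- w / 2)) * of_real (exp (- z\<^sup>2 * v)))"
      by (simp only: mult_ac)
    also have "rpow v (of_real q - 1) * rpow v (- w / 2) = rpow v ((of_real q - w / 2) - 1)"
      unfolding rpow_add[symmetric] by (simp add: algebra_simps)
    finally show "(LINT r|half_line. F v r)
        = Gamma (w / 2) / 2 * (rpow v ((of_real q - w / 2) - 1) * of_real (exp (- z\<^sup>2 * v)))" .
  qed measurable
  also have "\<dots> = Gamma (w / 2) / 2 * (Gamma (of_real q - w / 2) * rpow (z\<^sup>2) (- (of_real q - w / 2)))"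
    using gamma_integral(2)[of "of_real q - w / 2" "z\<^sup>2"] w z2 by simp
  also have "rpow (z\<^sup>2) (- (of_real q - w / 2)) = rpow z (w - of_real (2 * q))"
    using rpow_powr[OF \<open>z > 0\<close>, of 2 "- (of_real q - w / 2)"] \<open>z > 0\<close> by (simp add: algebra_simps)
  finally show "(LINT r|half_line. rpow r (w - 1) * of_real ((r\<^sup>2 + z\<^sup>2) powr (- q)))
       = Gamma (w / 2) * Gamma (of_real q - w / 2) / (2 * of_real (Gamma q)) * rpow z (w - of_real (2 * q))"
    using nz by (simp add: field_simps)
qed

lemma norm_exp_minus_1_le: "norm (exp w - 1) \<le> norm w * exp (norm w)" for w :: complex
proof -
  have "norm (exp w - exp 0) \<le> exp (norm w) * norm (w - 0)"
  proof (rule field_differentiable_bound[where f' = exp and S = "closed_segment 0 w"])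
    show "norm (exp x) \<le> exp (norm w)" if "x \<in> closed_segment 0 w" for x
    proof -
      have "Re x \<le> norm w"
        using segment_bound1[OF that] complex_Re_le_cmod[of x] by simp
      then show ?thesis by simp
    qed
  qed (auto intro!: derivative_eq_intros)
  then show ?thesis by (simp add: mult.commute)
qed

text \<open>Differentiation under the integral sign, by dominated convergence of the difference quotients. With \<open>Re p = 2a\<close> and
\<open>\<bar>h\<bar> < a\<close> they are bounded by \<open>t exp(-a t) \<bar>g t\<bar>\<close>, and half of the exponential absorbs \<open>t\<close>.\<close>

lemma laplace_holomorphic:
  fixes g :: "real \<Rightarrow> real"
  assumes [measurable]: "g \<in> borel_measurable borel"
    and int: "\<And>a. a > 0 \<Longrightarrow> integrable half_line (\<lambda>t. exp (- a * t) * \<bar>g t\<bar>)"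
  shows "(\<lambda>p. LINT t|half_line. exp (- (p * of_real t)) * of_real (g t)) holomorphic_on {p. 0 < Re p}"
proof -
  let ?L = "\<lambda>p. LINT t|half_line. exp (- (p * of_real t)) * complex_of_real (g t)"
  have integ: "integrable half_line (\<lambda>t. exp (- (p * of_real t)) * complex_of_real (g t))"
    if "0 < Re p" for p
    by (rule half_line_integrable_bound[OF int[OF that]]) (auto simp: norm_mult mult_ac)
  have "(?L has_field_derivative (LINT t|half_line. - of_real t * exp (- (p * of_real t)) * complex_of_real (g t))) (at p)"
    if p: "0 < Re p" for p
  proof -
    define a where "a = Re p / 2"
    have a: "a > 0" "Re p = 2 * a" using p by (auto simp: a_def)
    show ?thesis
      unfolding has_field_derivative_iff tendsto_at_iff_sequentially comp_def
    proof (intro allI impI)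
      fix X :: "nat \<Rightarrow> complex" assume X: "\<forall>i. X i \<in> UNIV - {p}" "X \<longlonglongrightarrow> p"
      define h where "h i = X i - p" for i
      have h0: "h i \<noteq> 0" for i using X(1) by (simp add: h_def)
      have "h \<longlonglongrightarrow> 0" using X(2) unfolding h_def by (simp add: LIM_zero)
      then have "eventually (\<lambda>i. norm (h i) < a) sequentially"
        using a(1) by (metis order_tendstoD(2) tendsto_norm_zero)
      then obtain i0 where i0: "\<And>i. i \<ge> i0 \<Longrightarrow> norm (h i) < a" by (auto simp: eventually_sequentially)
      let ?k = "\<lambda>i t. exp (- (p * of_real t)) * ((exp (- (h i * of_real t)) - 1) / h i) * complex_of_real (g t)"
      have "(\<lambda>i. LINT t|half_line. ?k (i + i0) t)
          \<longlonglongrightarrow> (LINT t|half_line. - of_real t * exp (- (p * of_real t)) * complex_of_real (g t))"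
      proof (rule integral_dominated_convergence[where w = "\<lambda>t. 2 / a * (exp (- (a/2) * t) * \<bar>g t\<bar>)"])
        show "integrable half_line (\<lambda>t. 2 / a * (exp (- (a/2) * t) * \<bar>g t\<bar>))"
          using a by (intro integrable_mult_right int) auto
        show "AE t in half_line. (\<lambda>i. ?k (i + i0) t) \<longlonglongrightarrow> - of_real t * exp (- (p * of_real t)) * complex_of_real (g t)"
        proof (rule AE_half_lineI)
          fix t :: real
          have "((\<lambda>x. exp (- (x * of_real t))) has_field_derivative - of_real t) (at 0)"
            by (auto intro!: derivative_eq_intros)
          then have "((\<lambda>x. (exp (- (x * of_real t)) - 1) / x) \<longlongrightarrow> - of_real t) (at (0::complex))"
            unfolding has_field_derivative_iff by simp
          moreover have "filterlim (\<lambda>i. h (i + i0)) (at 0) sequentially"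
            using \<open>h \<longlonglongrightarrow> 0\<close> h0 by (intro filterlim_atI LIMSEQ_ignore_initial_segment) auto
          ultimately have "(\<lambda>i. (exp (- (h (i + i0) * of_real t)) - 1) / h (i + i0)) \<longlonglongrightarrow> - of_real t"
            by (rule filterlim_compose)
          from tendsto_mult[OF tendsto_mult[OF tendsto_const[of "exp (- (p * of_real t))"] this] tendsto_const[of "complex_of_real (g t)"]]
          show "(\<lambda>i. ?k (i + i0) t) \<longlonglongrightarrow> - of_real t * exp (- (p * of_real t)) * complex_of_real (g t)"
            by (simp add: mult_ac)
        qed
        show "AE t in half_line. norm (?k (i + i0) t) \<le> 2 / a * (exp (- (a/2) * t) * \<bar>g t\<bar>)" for i
        proof (rule AE_half_lineI)
          fix t :: real assume t: "0 < t"
          let ?h = "h (i + i0)"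
          have "norm (exp (- (?h * of_real t)) - 1) \<le> norm ?h * t * exp (norm ?h * t)"
            using norm_exp_minus_1_le[of "- (?h * of_real t)"] t by (simp add: norm_mult)
          also have "\<dots> \<le> norm ?h * t * exp (a * t)"
            using i0[of "i + i0"] t by (intro mult_left_mono) auto
          finally have 1: "norm ((exp (- (?h * of_real t)) - 1) / ?h) \<le> t * exp (a * t)"
            using h0[of "i + i0"] by (simp add: norm_divide field_simps)
          have 2: "t \<le> 2 / a * exp (a/2 * t)"
            using exp_ge_add_one_self[of "a/2 * t"] a(1) by (simp add: field_simps)
          have "norm (?k (i + i0) t) = exp (- (2 * a * t)) * norm ((exp (- (?h * of_real t)) - 1) / ?h) * \<bar>g t\<bar>"
            unfolding norm_mult using a(2) by simp
          also have "\<dots> \<le> exp (- (2 * a * t)) * ((2 / a * exp (a/2 * t)) * exp (a * t)) * \<bar>g t\<bar>"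
            using order_trans[OF 1 mult_right_mono[OF 2]] by (intro mult_right_mono mult_left_mono) auto
          also have "\<dots> = 2 / a * ((exp (- (2 * a * t)) * exp (a/2 * t) * exp (a * t)) * \<bar>g t\<bar>)" by simp
          also have "exp (- (2 * a * t)) * exp (a/2 * t) * exp (a * t) = exp (- (a/2) * t)"
            by (simp flip: exp_add add: algebra_simps)
          finally show "norm (?k (i + i0) t) \<le> 2 / a * (exp (- (a/2) * t) * \<bar>g t\<bar>)" .
        qed
      qed measurable
      moreover have "(?L (X (i + i0)) - ?L p) / (X (i + i0) - p) = (LINT t|half_line. ?k (i + i0) t)" for i
      proof -
        let ?h = "h (i + i0)"
        have "\<bar>Re ?h\<bar> < a" using i0[of "i + i0"] abs_Re_le_cmod[of ?h] by simp
        then have "0 < Re (X (i + i0))" using a by (simp add: h_def)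
        then have "(?L (X (i + i0)) - ?L p) / ?h = (LINT t|half_line. (exp (- (X (i + i0) * of_real t)) * complex_of_real (g t)
            - exp (- (p * of_real t)) * complex_of_real (g t)) / ?h)"
          using integ p by simp
        also have "\<dots> = (LINT t|half_line. ?k (i + i0) t)"
        proof (rule Bochner_Integration.integral_cong)
          fix t
          have "exp (- (X (i + i0) * of_real t)) = exp (- (p * of_real t)) * exp (- (?h * of_real t))"
            by (simp flip: exp_add add: h_def algebra_simps)
          then show "(exp (- (X (i + i0) * of_real t)) * complex_of_real (g t)
            - exp (- (p * of_real t)) * complex_of_real (g t)) / ?h = ?k (i + i0) t"
            by (simp add: algebra_simps diff_divide_distrib)
        qed simp
        finally show ?thesis by (simp add: h_def)
      qed
      ultimately have "(\<lambda>i. (?L (X (i + i0)) - ?L p) / (X (i + i0) - p))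
          \<longlonglongrightarrow> (LINT t|half_line. - of_real t * exp (- (p * of_real t)) * complex_of_real (g t))" by simp
      then show "(\<lambda>i. (?L (X i) - ?L p) / (X i - p))
          \<longlonglongrightarrow> (LINT t|half_line. - of_real t * exp (- (p * of_real t)) * complex_of_real (g t))"
        by (rule LIMSEQ_offset)
    qed
  qed
  then show ?thesis
    by (intro holomorphic_onI) (auto simp: field_differentiable_def intro: has_field_derivative_at_within)
qed

section \<open>The Bessel kernel and its Laplace transform\<close>

text \<open>These are the coefficients of the (alternating) Bessel--Clifford function \<open>C\<^sub>\<nu>(x) = x^(-\<nu>/2) J\<^sub>\<nu>(2 \<surd>x)\<close>. Removing the power makes it entire, with
\<open>C\<^sub>\<nu>' = -C\<^sub>\<nu>\<^sub>+\<^sub>1\<close>.\<close>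

definition clifford_coeff :: "real \<Rightarrow> nat \<Rightarrow> real" where
  "clifford_coeff \<nu> k = (-1) ^ k / fact k * rGamma (real k + \<nu> + 1)"

definition clifford :: "real \<Rightarrow> real \<Rightarrow> real" where
  "clifford \<nu> x = (\<Sum>k. clifford_coeff \<nu> k * x ^ k)"

lemma summable_clifford: "summable (\<lambda>k. norm (clifford_coeff \<nu> k * x ^ k))"
proof -
  obtain K :: nat where K: "1 - \<nu> \<le> real K" using real_arch_simple by blast
  have "summable (\<lambda>k. \<bar>x\<bar> ^ k / fact k)"
    using summable_exp_generic[of "\<bar>x\<bar>"] by (simp add: divide_inverse mult.commute)
  then show ?thesis
  proof (rule summable_comparison_test_ev[rotated])
    show "\<forall>\<^sub>F k in sequentially. norm (norm (clifford_coeff \<nu> k * x ^ k)) \<le> \<bar>x\<bar> ^ k / fact k"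
      using eventually_ge_at_top[of K]
    proof eventually_elim
      case (elim k)
      have "1 \<le> Gamma (real k + \<nu> + 1)" using elim K by (intro Gamma_ge_1) linarith
      then have "\<bar>rGamma (real k + \<nu> + 1)\<bar> \<le> 1"
        by (simp add: rGamma_inverse_Gamma inverse_le_1_iff)
      then have "\<bar>rGamma (real k + \<nu> + 1)\<bar> * (\<bar>x\<bar> ^ k / fact k) \<le> 1 * (\<bar>x\<bar> ^ k / fact k)"
        by (intro mult_right_mono) auto
      then show ?case by (simp add: clifford_coeff_def abs_mult power_abs mult_ac)
    qed
  qed
qed

lemma clifford_sums: "(\<lambda>k. clifford_coeff \<nu> k * x ^ k) sums clifford \<nu> x"
  unfolding clifford_def by (rule summable_sums[OF summable_norm_cancel[OF summable_clifford]])

lemma clifford_0: "clifford \<nu> 0 = rGamma (\<nu> + 1)"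
  using powser_zero[of "clifford_coeff \<nu>"] unfolding clifford_def by (simp add: clifford_coeff_def[of \<nu> 0])

lemma DERIV_clifford: "(clifford \<nu> has_real_derivative - clifford (\<nu> + 1) x) (at x)"
proof -
  have "diffs (clifford_coeff \<nu>) k = - clifford_coeff (\<nu> + 1) k" for k
  proof -
    have "real (Suc k) / fact (Suc k) = (1 :: real) / fact k" by (simp del: of_nat_Suc)
    then show ?thesis
      by (simp add: diffs_def clifford_coeff_def add_ac)
  qed
  then have "(\<Sum>k. diffs (clifford_coeff \<nu>) k * x ^ k) = - clifford (\<nu> + 1) x"
    using sums_unique[OF sums_minus[OF clifford_sums[of "\<nu> + 1" x]]] by simp
  then show ?thesis
    using termdiffs_strong_converges_everywhere[OF summable_norm_cancel[OF summable_clifford], of \<nu> x]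
    unfolding clifford_def[abs_def] by simp
qed

lemma clifford_recurrence: "clifford \<nu> x = (\<nu> + 1) * clifford (\<nu> + 1) x - x * clifford (\<nu> + 2) x"
proof -
  let ?t = "\<lambda>k. real k * clifford_coeff (\<nu> + 1) k * x ^ k"
  have "(\<lambda>k. - x * (clifford_coeff (\<nu> + 2) k * x ^ k)) sums (- x * clifford (\<nu> + 2) x)"
    by (intro sums_mult clifford_sums)
  moreover have "- x * (clifford_coeff (\<nu> + 2) k * x ^ k) = ?t (Suc k)" for k
  proof -
    have "real (Suc k) / fact (Suc k) = (1 :: real) / fact k" by (simp del: of_nat_Suc)
    then show ?thesis by (simp add: clifford_coeff_def add_ac)
  qed
  ultimately have "(\<lambda>k. ?t (Suc k)) sums (- x * clifford (\<nu> + 2) x)" by simp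
  then have "?t sums (- x * clifford (\<nu> + 2) x)" by (subst (asm) sums_Suc_iff) simp
  from sums_add[OF sums_mult[OF clifford_sums[of "\<nu> + 1" x], of "\<nu> + 1"] this]
  have "(\<lambda>k. (\<nu> + 1) * (clifford_coeff (\<nu> + 1) k * x ^ k) + ?t k)
      sums ((\<nu> + 1) * clifford (\<nu> + 1) x - x * clifford (\<nu> + 2) x)" by simp
  moreover have "(\<nu> + 1) * (clifford_coeff (\<nu> + 1) k * x ^ k) + ?t k = clifford_coeff \<nu> k * x ^ k" for k
  proof -
    have "rGamma (real k + \<nu> + 1) = (real k + \<nu> + 1) * rGamma (real k + \<nu> + 1 + 1)"
      by (rule rGamma_plus1[symmetric])
    then have "clifford_coeff \<nu> k = (real k + \<nu> + 1) * clifford_coeff (\<nu> + 1) k"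
      by (simp add: clifford_coeff_def add.assoc)
    then have "clifford_coeff \<nu> k = (\<nu> + 1) * clifford_coeff (\<nu> + 1) k + real k * clifford_coeff (\<nu> + 1) k"
      by (simp add: algebra_simps)
    then show ?thesis by (simp add: algebra_simps)
  qed
  ultimately have "(\<lambda>k. clifford_coeff \<nu> k * x ^ k)
      sums ((\<nu> + 1) * clifford (\<nu> + 1) x - x * clifford (\<nu> + 2) x)" by simp
  then show ?thesis by (rule sums_unique2[OF clifford_sums])
qed

text \<open>The energy \<open>C\<^sub>\<nu>(x)^2 + x C\<^sub>\<nu>\<^sub>+\<^sub>1(x)^2\<close> has derivative \<open>-(2\<nu> + 1) C\<^sub>\<nu>\<^sub>+\<^sub>1(x)^2\<close>, so it does not increase for \<open>\<nu> \<ge> -1/2\<close>,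
that is, in every dimension \<open>d \<ge> 1\<close>.\<close>

lemma abs_clifford_le:
  assumes "\<nu> \<ge> - 1/2" "x \<ge> 0"
  shows "\<bar>clifford \<nu> x\<bar> \<le> \<bar>clifford \<nu> 0\<bar>"
proof -
  let ?E = "\<lambda>x. (clifford \<nu> x)\<^sup>2 + x * (clifford (\<nu> + 1) x)\<^sup>2"
  have "?E x \<le> ?E 0"
  proof (rule DERIV_nonpos_imp_nonincreasing[OF assms(2)])
    fix t :: real
    let ?b = "clifford \<nu> t" and ?c = "clifford (\<nu> + 1) t"
    have d: "(clifford (\<nu> + 1) has_real_derivative - clifford (\<nu> + 2) t) (at t)"
      using DERIV_clifford[of "\<nu> + 1" t] by (simp add: add.assoc)
    have "(?E has_real_derivative 2 * ?b * (- ?c) + (?c\<^sup>2 + t * (2 * ?c * (- clifford (\<nu> + 2) t)))) (at t)"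
      by (auto intro!: derivative_eq_intros DERIV_clifford d simp: power2_eq_square)
    moreover have "2 * ?b * (- ?c) + (?c\<^sup>2 + t * (2 * ?c * (- clifford (\<nu> + 2) t))) = - ((2 * \<nu> + 1) * ?c\<^sup>2)"
    proof -
      have "2 * b * (- c) + (c\<^sup>2 + t * (2 * c * (- g))) = - ((2 * \<nu> + 1) * c\<^sup>2)"
        if "t * g = (\<nu> + 1) * c - b" for b c g :: real
      proof -
        have "t * (2 * c * (- g)) = - 2 * c * (t * g)" by simp
        then show ?thesis unfolding that by (simp add: algebra_simps power2_eq_square)
      qed
      moreover have "t * clifford (\<nu> + 2) t = (\<nu> + 1) * ?c - ?b"
        using clifford_recurrence[of \<nu> t] by linarith
      ultimately show ?thesis by blast
    qed
    moreover have "0 \<le> (2 * \<nu> + 1) * ?c\<^sup>2" using assms(1) by (intro mult_nonneg_nonneg) auto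
    ultimately show "\<exists>y. (?E has_real_derivative y) (at t) \<and> y \<le> 0" by auto
  qed
  moreover have "0 \<le> x * (clifford (\<nu> + 1) x)\<^sup>2" using assms(2) by simp
  ultimately have "(clifford \<nu> x)\<^sup>2 \<le> (clifford \<nu> 0)\<^sup>2" by simp
  then show ?thesis by (simp add: abs_le_square_iff)
qed

lemma bessel_J_clifford:
  assumes "x > 0"
  shows "bessel_J \<nu> x = (x / 2) powr \<nu> * clifford \<nu> ((x / 2)\<^sup>2)"
proof -
  have "(\<lambda>k. (x / 2) powr \<nu> * (clifford_coeff \<nu> k * ((x / 2)\<^sup>2) ^ k)) sums ((x / 2) powr \<nu> * clifford \<nu> ((x / 2)\<^sup>2))"
    by (intro sums_mult clifford_sums)
  moreover have "(x / 2) powr \<nu> * (clifford_coeff \<nu> k * ((x / 2)\<^sup>2) ^ k)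
      = (-1) ^ k / fact k * rGamma (real k + \<nu> + 1) * (x / 2) powr (2 * real k + \<nu>)" for k
  proof -
    have "(x / 2) powr (2 * real k + \<nu>) = (x / 2) powr \<nu> * (x / 2) powr real (2 * k)"
      by (simp add: powr_add)
    also have "(x / 2) powr real (2 * k) = ((x / 2)\<^sup>2) ^ k"
      using assms by (subst powr_realpow) (auto simp: power_mult)
    finally show ?thesis by (simp add: clifford_coeff_def)
  qed
  ultimately show ?thesis unfolding bessel_J_def by (simp add: sums_iff)
qed

text \<open>The kernel \<open>t powr (d/2) J(t z)\<close> of the radial transform without the constant \<open>(z/2) powr (d/2 - 1)\<close>. It is
continuous at \<open>0\<close> and bounded by a multiple of \<open>t ^ (d - 1)\<close>.\<close>

definition bessel_kernel :: "nat \<Rightarrow> real \<Rightarrow> real \<Rightarrow> real" where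
  "bessel_kernel d z t = t ^ (d - 1) * clifford (real d / 2 - 1) ((z * t / 2)\<^sup>2)"

lemma radial_integrand_bessel_kernel:
  assumes "d > 0" "z > 0" "t > 0"
  shows "radial_integrand d \<phi> z t = (z / 2) powr (real d / 2 - 1) * (bessel_kernel d z t * \<phi> t)"
proof -
  have "t powr (real d / 2) * (t * z / 2) powr (real d / 2 - 1) = (z / 2) powr (real d / 2 - 1) * t ^ (d - 1)"
  proof -
    have "(t * z / 2) powr (real d / 2 - 1) = t powr (real d / 2 - 1) * (z / 2) powr (real d / 2 - 1)"
      using powr_mult[of t "z / 2" "real d / 2 - 1"] by simp
    moreover have "t powr (real d / 2) * t powr (real d / 2 - 1) = t ^ (d - 1)"
      using assms by (simp flip: powr_add powr_realpow add: of_nat_diff)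
    ultimately show ?thesis by simp
  qed
  then show ?thesis
    using assms unfolding radial_integrand_def bessel_kernel_def
    by (simp add: bessel_J_clifford mult_ac)
qed

lemma continuous_on_bessel_kernel: "continuous_on A (bessel_kernel d z)"
proof -
  have "isCont (clifford \<nu>) x" for \<nu> x using DERIV_isCont[OF DERIV_clifford] .
  then have "isCont (bessel_kernel d z) t" for t
    unfolding bessel_kernel_def[abs_def] by (intro continuous_intros isCont_o2[of _ "\<lambda>t. (z * t / 2)\<^sup>2"]) auto
  then show ?thesis by (simp add: continuous_at_imp_continuous_on)
qed

lemma bessel_kernel_measurable [measurable]: "bessel_kernel d z \<in> borel_measurable borel"
  using borel_measurable_continuous_onI[OF continuous_on_bessel_kernel] .

lemma abs_bessel_kernel_le:
  assumes "d > 0" "t > 0"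
  shows "\<bar>bessel_kernel d z t\<bar> \<le> rGamma (real d / 2) * t powr (real d - 1)"
proof -
  have "0 \<le> rGamma (real d / 2)"
    using assms Gamma_real_pos[of "real d / 2"] by (simp add: rGamma_inverse_Gamma)
  then have "\<bar>clifford (real d / 2 - 1) ((z * t / 2)\<^sup>2)\<bar> \<le> rGamma (real d / 2)"
    using abs_clifford_le[of "real d / 2 - 1" "(z * t / 2)\<^sup>2"] assms by (simp add: clifford_0)
  moreover have "t ^ (d - 1) = t powr (real d - 1)"
    using assms by (simp flip: powr_realpow add: of_nat_diff)
  ultimately show ?thesis using assms
    by (simp add: bessel_kernel_def abs_mult mult.commute mult_left_mono)
qed

lemma bessel_kernel_laplace_integrable:
  assumes "d > 0" "p > 0"
  shows "integrable half_line (\<lambda>t. exp (- p * t) * \<bar>bessel_kernel d z t\<bar>)"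
proof (rule half_line_integrable_bound)
  show "integrable half_line (\<lambda>t. rGamma (real d / 2) * (t powr (real d - 1) * exp (- p * t)))"
    using assms by (intro integrable_mult_right gamma_integral_real(1)) auto
  show "norm (exp (- p * t) * \<bar>bessel_kernel d z t\<bar>) \<le> rGamma (real d / 2) * (t powr (real d - 1) * exp (- p * t))"
    if "0 < t" for t
    using mult_left_mono[OF abs_bessel_kernel_le[OF assms(1) that], of "exp (- p * t)" z] by (simp add: mult_ac)
qed measurable

lemma Gamma_legendre_duplication_rGamma:
  fixes u :: complex
  assumes "0 < Re u"
  shows "rGamma (2 * u) * Gamma (u + 1/2) = rpow 2 (1 - 2 * u) * of_real (sqrt pi) * rGamma u"
proof -
  have right: "w \<notin> \<int>\<^sub>\<le>\<^sub>0" if "0 < Re w" for w :: complex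
    using that by (auto elim!: nonpos_Ints_cases)
  have n: "u \<notin> \<int>\<^sub>\<le>\<^sub>0" "u + 1/2 \<notin> \<int>\<^sub>\<le>\<^sub>0" "2 * u \<notin> \<int>\<^sub>\<le>\<^sub>0"
    using assms by (auto intro!: right)
  then have "Gamma u \<noteq> 0" "Gamma (2 * u) \<noteq> 0" by (simp_all add: Gamma_eq_zero_iff)
  then show ?thesis using Gamma_legendre_duplication[OF n(1,2)]
    by (simp add: rGamma_inverse_Gamma rpow_def field_simps)
qed

text \<open>For \<open>p > z\<close> the Bessel series may be integrated term by term. By the duplication formula the result is the binomial
series of \<open>(1 + z^2/p^2) powr (-(d+1)/2)\<close>, whose absolute convergence justifies the interchange.\<close>

lemma bessel_kernel_laplace_large:
  assumes "d > 0" "z > 0" "p > z"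
  shows "(LINT t|half_line. exp (- p * t) * bessel_kernel d z t)
       = 2 ^ (d - 1) * Gamma ((real d + 1) / 2) / sqrt pi * (p * (p\<^sup>2 + z\<^sup>2) powr (- ((real d + 1) / 2)))"
proof -
  let ?q = "(real d + 1) / 2"
  let ?\<nu> = "real d / 2 - 1"
  define f where "f k t = clifford_coeff ?\<nu> k * (z / 2) ^ (2 * k) * (t powr (real (2 * k + d) - 1) * exp (- p * t))" for k t
  have p: "p > 0" using assms by simp
  have f_int: "integrable half_line (f k)" for k
    unfolding f_def using assms p by (intro integrable_mult_right gamma_integral_real(1)) auto
  define I where "I k = clifford_coeff ?\<nu> k * (z / 2) ^ (2 * k) * (Gamma (real (2 * k + d)) * p powr (- real (2 * k + d)))" for k
  have f_val: "(LINT t|half_line. f k t) = I k" for k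
    unfolding f_def I_def using gamma_integral_real(2)[of "real (2 * k + d)" p] assms p
    by (simp del: of_nat_add of_nat_mult)
  define A where "A = 2 ^ (d - 1) * Gamma ?q / sqrt pi * p powr (- real d)"
  have I_eq: "I k = A * ((- ?q gchoose k) * (z\<^sup>2 / p\<^sup>2) ^ k)" for k
  proof -
    let ?u = "real k + real d / 2"
    have u: "?u > 0" using assms by auto
    have g: "Gamma ?u > 0" "Gamma (2 * ?u) > 0" using u by simp_all
    have dup: "rGamma (2 * ?u) * Gamma (?u + 1/2) = 2 powr (1 - 2 * ?u) * sqrt pi * rGamma ?u"
    proof -
      have "complex_of_real (rGamma (2 * ?u) * Gamma (?u + 1/2))
          = rGamma (2 * of_real ?u) * Gamma (of_real ?u + 1/2)"
        using rGamma_complex_of_real[of "2 * ?u"] Gamma_complex_of_real[of "?u + 1/2"] by simp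
      also have "\<dots> = rpow 2 (1 - 2 * of_real ?u) * of_real (sqrt pi) * rGamma (of_real ?u)"
        by (rule Gamma_legendre_duplication_rGamma) (use u in simp)
      also have "\<dots> = of_real (2 powr (1 - 2 * ?u) * sqrt pi * rGamma ?u)"
        using rpow_of_real[of 2 "1 - 2 * ?u"] rGamma_complex_of_real[of ?u] by simp
      finally show ?thesis by (simp only: of_real_eq_iff)
    qed
    have two: "2 powr (1 - 2 * ?u) * (2 ^ (2 * k) * 2 ^ (d - 1)) = (1 :: real)"
    proof -
      have "2 ^ (2 * k) * 2 ^ (d - 1) = 2 powr (real (2 * k) + real (d - 1))"
        unfolding powr_add by (simp only: powr_realpow zero_less_numeral)
      moreover have "1 - 2 * ?u + (real (2 * k) + real (d - 1)) = 0"
        using assms by (simp add: of_nat_diff)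
      ultimately show ?thesis by (simp only: powr_add[symmetric]) simp
    qed
    have poch: "Gamma (?u + 1/2) = pochhammer ?q k * Gamma ?q"
    proof -
      have "?q \<notin> \<int>\<^sub>\<le>\<^sub>0" by (auto elim!: nonpos_Ints_cases)
      then show ?thesis using pochhammer_Gamma[of ?q k] Gamma_eq_zero_iff[of ?q] by (simp add: add_ac add_divide_distrib)
    qed
    have pp: "p powr (- real (2 * k + d)) = p powr (- real d) * inverse (p ^ (2 * k))"
      using p powr_add[of p "- real (2 * k)" "- real d"]
      by (simp only: powr_minus powr_realpow of_nat_add minus_add_distrib mult.commute)
    have zp: "(z\<^sup>2 / p\<^sup>2) ^ k = z ^ (2 * k) * inverse (p ^ (2 * k))"
      by (simp only: power_mult power_divide) (rule divide_inverse)
    have z2: "(z / 2) ^ (2 * k) = z ^ (2 * k) * inverse (2 ^ (2 * k))"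
      by (simp only: power_divide) (rule divide_inverse)
    have idx: "real (2 * k + d) = 2 * ?u" "real k + ?\<nu> + 1 = ?u" by auto
    have alg: "s / m * r * (Z * inverse T) * (G * (B * C)) = D * Q / S * B * (s * P / m * (Z * C))"
      if "inverse G * (P * Q) = W * S * r" "W * (T * D) = 1" "T \<noteq> 0" "S \<noteq> 0" "G \<noteq> 0"
      for s m r Z T G B C D Q S P W :: real
    proof -
      have "W = inverse (T * D)" using that(2) by (metis inverse_unique mult.commute)
      then have "r * G = T * D * (P * Q) / S" using that by (auto simp: field_simps)
      then have "s / m * (r * G) * (Z * inverse T) * (B * C) = s / m * (T * D * (P * Q) / S) * (Z * inverse T) * (B * C)"
        by (simp only:)
      then show ?thesis using that(3) by (simp add: mult_ac)
    qed
    show ?thesis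
      unfolding I_def clifford_coeff_def A_def gbinomial_pochhammer minus_minus z2 zp idx(2) pp
      unfolding idx(1)
      by (rule alg[OF _ two]) (use dup poch g in \<open>auto simp: rGamma_inverse_Gamma\<close>)
  qed
  have x: "0 \<le> z\<^sup>2 / p\<^sup>2" "z\<^sup>2 / p\<^sup>2 < 1" using assms p by (auto simp: power_strict_mono)
  have A: "A \<ge> 0" unfolding A_def by (intro mult_nonneg_nonneg divide_nonneg_nonneg Gamma_real_nonneg) auto
  have I_abs: "\<bar>I k\<bar> = A * ((- ?q gchoose k) * (- (z\<^sup>2 / p\<^sup>2)) ^ k)" for k
  proof -
    have "0 \<le> pochhammer ?q k" by (intro pochhammer_nonneg) auto
    moreover have "(- (z\<^sup>2 / p\<^sup>2)) ^ k = (- 1) ^ k * (z\<^sup>2 / p\<^sup>2) ^ k" by (rule power_minus)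
    ultimately show ?thesis unfolding I_eq gbinomial_pochhammer using A x(1)
      by (simp add: abs_mult power_abs abs_of_nonneg)
  qed
  have "summable (\<lambda>k. \<bar>I k\<bar>)"
    unfolding I_abs using x by (intro summable_mult sums_summable[OF gen_binomial_real]) auto
  moreover have "(LINT t|half_line. norm (f k t)) = \<bar>I k\<bar>" for k
  proof -
    have "norm (f k t) = \<bar>clifford_coeff ?\<nu> k\<bar> * (z / 2) ^ (2 * k) * (t powr (real (2 * k + d) - 1) * exp (- p * t))" for t
      using assms by (simp add: f_def abs_mult power_abs)
    then show ?thesis using gamma_integral_real(2)[of "real (2 * k + d)" p] assms p
      by (simp add: I_def abs_mult power_abs Gamma_real_nonneg abs_of_nonneg del: of_nat_add of_nat_mult)
  qed
  ultimately have norms: "summable (\<lambda>k. LINT t|half_line. norm (f k t))" by simp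
  have f_eq: "f k t = (exp (- p * t) * t ^ (d - 1)) * (clifford_coeff ?\<nu> k * ((z * t / 2)\<^sup>2) ^ k)" if "0 < t" for k t
  proof -
    have "t powr (real (2 * k + d) - 1) = t ^ (2 * k) * t ^ (d - 1)"
      using assms that by (simp flip: powr_realpow powr_add add: of_nat_diff algebra_simps)
    moreover have "((z * t / 2)\<^sup>2) ^ k = (z / 2) ^ (2 * k) * t ^ (2 * k)"
      by (simp add: power_mult power_mult_distrib power_divide)
    ultimately show ?thesis by (simp add: f_def)
  qed
  have f_sums: "(\<Sum>k. f k t) = exp (- p * t) * bessel_kernel d z t" if "0 < t" for t
  proof -
    have "(\<lambda>k. f k t) sums (exp (- p * t) * t ^ (d - 1) * clifford ?\<nu> ((z * t / 2)\<^sup>2))"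
      unfolding f_eq[OF that] by (intro sums_mult clifford_sums)
    then show ?thesis by (simp add: sums_iff bessel_kernel_def)
  qed
  have ae: "AE t in half_line. summable (\<lambda>k. norm (f k t))"
  proof (rule AE_half_lineI)
    show "summable (\<lambda>k. norm (f k t))" if "0 < t" for t
      unfolding f_eq[OF that] norm_mult[of "exp (- p * t) * t ^ (d - 1)"]
      by (intro summable_mult summable_clifford)
  qed
  have "(LINT t|half_line. exp (- p * t) * bessel_kernel d z t) = (LINT t|half_line. (\<Sum>k. f k t))"
  proof (rule half_line_integral_cong(1))
    show "(\<lambda>t. \<Sum>k. f k t) \<in> borel_measurable borel" unfolding f_def by measurable
  qed (auto simp: f_sums)
  moreover have "I sums (LINT t|half_line. (\<Sum>k. f k t))"
    using sums_integral[OF f_int ae norms] unfolding f_val .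
  moreover have "I sums (A * (1 + z\<^sup>2 / p\<^sup>2) powr (- ?q))"
    unfolding I_eq[abs_def] using x by (intro sums_mult gen_binomial_real) auto
  ultimately have "(LINT t|half_line. exp (- p * t) * bessel_kernel d z t) = A * (1 + z\<^sup>2 / p\<^sup>2) powr (- ?q)"
    using sums_unique2 by metis
  also have "1 + z\<^sup>2 / p\<^sup>2 = (p\<^sup>2 + z\<^sup>2) * p powr (- 2)"
    using p by (simp add: powr_minus_divide field_simps)
  also have "((p\<^sup>2 + z\<^sup>2) * p powr (- 2)) powr (- ?q) = (p\<^sup>2 + z\<^sup>2) powr (- ?q) * p powr (real d + 1)"
  proof -
    have "- 2 * - ?q = real d + 1" by (simp add: field_simps)
    then show ?thesis by (simp only: powr_mult powr_powr)
  qed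
  also have "A * \<dots> = 2 ^ (d - 1) * Gamma ?q / sqrt pi * ((p powr (- real d) * p powr (real d + 1)) * (p\<^sup>2 + z\<^sup>2) powr (- ?q))"
    by (simp add: A_def)
  also have "p powr (- real d) * p powr (real d + 1) = p" using p by (simp flip: powr_add)
  finally show ?thesis by simp
qed

text \<open>Both sides are holomorphic in the half-plane \<open>Re p > 0\<close>: the left one because the kernel grows only polynomially, the
right one because \<open>p^2 + z^2\<close> avoids the negative axis there. They agree for real \<open>p > z\<close>.\<close>

lemma bessel_kernel_laplace:
  assumes "d > 0" "z > 0" "p > 0"
  shows "(LINT t|half_line. exp (- p * t) * bessel_kernel d z t)
       = 2 ^ (d - 1) * Gamma ((real d + 1) / 2) / sqrt pi * (p * (p\<^sup>2 + z\<^sup>2) powr (- ((real d + 1) / 2)))"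
proof -
  define C where "C = 2 ^ (d - 1) * Gamma ((real d + 1) / 2) / sqrt pi"
  define S where "S = {p :: complex. 0 < Re p}"
  let ?L = "\<lambda>p. LINT t|half_line. exp (- (p * of_real t)) * complex_of_real (bessel_kernel d z t)"
  let ?R = "\<lambda>p :: complex. of_real C * (p * (p\<^sup>2 + of_real (z\<^sup>2)) powr (- of_real ((real d + 1) / 2)))"
  have Lr: "?L (of_real x) = of_real (LINT t|half_line. exp (- x * t) * bessel_kernel d z t)" for x
    by (simp flip: integral_complex_of_real exp_of_real add: mult_ac)
  have Rr: "?R (of_real x) = of_real (C * (x * (x\<^sup>2 + z\<^sup>2) powr (- ((real d + 1) / 2))))" for x
  proof -
    have "0 \<le> x\<^sup>2 + z\<^sup>2" by simp
    from powr_of_real[OF this, of "- ((real d + 1) / 2)"] show ?thesis by simp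
  qed
  have "?L (of_real p) - ?R (of_real p) = 0"
  proof (rule analytic_continuation[where f = "\<lambda>p. ?L p - ?R p" and w = "of_real p" and S = S and U = "of_real ` {z<..}" and \<xi> = "of_real (z + 1)"])
    show "(\<lambda>p. ?L p - ?R p) holomorphic_on S"
    proof (intro holomorphic_intros)
      show "?L holomorphic_on S" unfolding S_def
        by (rule laplace_holomorphic[OF bessel_kernel_measurable bessel_kernel_laplace_integrable[OF assms(1)]])
      fix w assume w: "w \<in> S"
      show "w\<^sup>2 + of_real (z\<^sup>2) \<notin> \<real>\<^sub>\<le>\<^sub>0"
      proof
        assume "w\<^sup>2 + of_real (z\<^sup>2) \<in> \<real>\<^sub>\<le>\<^sub>0"
        then have "Im (w\<^sup>2) = 0" "Re (w\<^sup>2) + z\<^sup>2 \<le> 0" by (auto simp: complex_nonpos_Reals_iff)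
        moreover have "Im w = 0" using calculation(1) w by (simp add: S_def power2_eq_square)
        moreover have "0 < Re w * Re w + z\<^sup>2"
          using w assms(2) by (intro add_pos_pos mult_pos_pos) (auto simp: S_def)
        ultimately show False by (simp add: power2_eq_square)
      qed
    qed
    show "open S" "connected S" unfolding S_def
      by (auto intro!: open_halfspace_Re_gt convex_connected convex_halfspace_Re_gt)
    show "of_real ` {z<..} \<subseteq> S" "of_real (z + 1) \<in> S" "of_real p \<in> S" using assms by (auto simp: S_def)
    show "complex_of_real (z + 1) islimpt of_real ` {z<..}"
    proof -
      have "(z + 1) islimpt {z<..}" by (rule open_imp_islimpt) auto
      then have "complex_of_real (z + 1) islimpt complex_of_real ` {z<..}"
        by (rule islimpt_isCont_image) (auto simp: eventually_at of_real_eq_iff simp del: of_real_add intro!: exI[of _ 1])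
      then show ?thesis .
    qed
    fix w :: complex assume "w \<in> of_real ` {z<..}"
    then obtain x where x: "w = of_real x" "z < x" by auto
    show "?L w - ?R w = 0"
      unfolding x(1) Lr Rr using bessel_kernel_laplace_large[OF assms(1,2) x(2)] by (simp add: C_def)
  qed
  then show ?thesis
    unfolding Lr Rr C_def[symmetric] of_real_diff[symmetric] of_real_eq_0_iff by simp
qed

section \<open>The Cauchy function as a Laplace transform\<close>

lemma Complex_measurable [measurable]:
  assumes [measurable]: "f \<in> borel_measurable M" "g \<in> borel_measurable M"
  shows "(\<lambda>x. Complex (f x) (g x)) \<in> borel_measurable M"
  unfolding Complex_eq by measurable

text \<open>Up to the factor \<open>2 \<pi> \<Gamma>(\<alpha>)\<close>, \<open>mixing_density\<close> is the function whose Laplace transform is the Cauchy function with exponent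
\<open>\<alpha> = l/\<delta>\<close>; \<open>mixing_weight\<close> is, up to normalisation, its Mellin transform, which is inverted along \<open>Re s = c\<close>. For \<open>0 < c < \<alpha>\<close> the value of the density does not depend
on \<open>c\<close>, but the bound for it does: \<open>r powr (\<delta> c - 1)\<close> controls it near \<open>0\<close> and near infinity at once.\<close>

definition mixing_weight :: "real \<Rightarrow> real \<Rightarrow> real \<Rightarrow> complex \<Rightarrow> complex" where
  "mixing_weight \<alpha> \<delta> \<beta> s =
     Gamma s * Gamma (of_real \<alpha> - s) * rGamma (of_real \<delta> * s) * rpow \<beta> (of_real \<delta> * s)"

definition mixing_density :: "real \<Rightarrow> real \<Rightarrow> real \<Rightarrow> real \<Rightarrow> real \<Rightarrow> complex" where
  "mixing_density \<alpha> \<delta> \<beta> c r =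
     vline_int c (\<lambda>s. mixing_weight \<alpha> \<delta> \<beta> s * rpow r (of_real \<delta> * s - 1))"

text \<open>The decay exponent is \<open>\<pi>/2 + \<pi>/2 - \<pi> \<delta>/2\<close>, which is positive for \<open>\<delta> < 2\<close>.\<close>

lemma mixing_weight_integrable:
  assumes "0 < c" "c < \<alpha>" "0 < \<delta>" "\<delta> < 2" "\<beta> > 0"
  shows "integrable lborel (\<lambda>y. mixing_weight \<alpha> \<delta> \<beta> (Complex c y))"
proof (rule integrable_vline)
  have "strip_bound (pi/2 + pi/2 * \<bar>-1\<bar> + - (pi/2) * \<bar>\<delta>\<bar> + 0)
      (\<lambda>s. Gamma s * Gamma (of_real \<alpha> + of_real (-1) * s) * rGamma (of_real 0 + of_real \<delta> * s) * rpow \<beta> (of_real \<delta> * s))"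
    using assms by (intro strip_bound_mult strip_bound_Gamma strip_bound_rGamma strip_bound_affine
        strip_bound_rpow) auto
  then show "strip_bound (pi - pi / 2 * \<delta>) (mixing_weight \<alpha> \<delta> \<beta>)"
    using assms by (simp add: mixing_weight_def[abs_def])
  show "0 < pi - pi / 2 * \<delta>" using assms by simp
  fix y
  let ?S = "{s. 0 < Re s} \<inter> {s. Re s < \<alpha>}"
  have "mixing_weight \<alpha> \<delta> \<beta> holomorphic_on ?S"
    unfolding mixing_weight_def[abs_def]
    by (intro holomorphic_intros) (auto elim!: nonpos_Ints_cases simp: complex_eq_iff)
  moreover have "open ?S" by (intro open_Int open_halfspace_Re_gt open_halfspace_Re_lt)
  moreover have "Complex c y \<in> ?S" using assms by simp
  ultimately show "isCont (mixing_weight \<alpha> \<delta> \<beta>) (Complex c y)"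
    by (metis continuous_on_eq_continuous_at holomorphic_on_imp_continuous_on)
qed

locale cauchy_mixture =
  fixes \<alpha> \<delta> \<beta> c :: real
  assumes c: "0 < c" "c < \<alpha>" and \<delta>: "0 < \<delta>" "\<delta> < 2" and \<beta>: "\<beta> > 0"
begin

abbreviation "\<omega> \<equiv> mixing_weight \<alpha> \<delta> \<beta>"
abbreviation "m \<equiv> mixing_density \<alpha> \<delta> \<beta> c"

lemma weight_integrable: "integrable lborel (\<lambda>y. \<omega> (Complex c y))"
  using c \<delta> \<beta> by (intro mixing_weight_integrable)

lemma weight_measurable [measurable]: "(\<lambda>y. \<omega> (Complex c y)) \<in> borel_measurable borel"
  using borel_measurable_integrable[OF weight_integrable] by simp

lemma density_measurable [measurable]: "m \<in> borel_measurable borel"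
  unfolding mixing_density_def[abs_def] by measurable

lemma density_bound:
  assumes "r > 0"
  shows "norm (m r) \<le> (LINT y|lborel. norm (\<omega> (Complex c y))) * r powr (\<delta> * c - 1)"
proof -
  have "norm (m r) \<le> (LINT y|lborel. norm (\<omega> (Complex c y) * rpow r (of_real \<delta> * Complex c y - 1)))"
    unfolding mixing_density_def by (rule integral_norm_bound)
  also have "\<dots> = (LINT y|lborel. norm (\<omega> (Complex c y)) * r powr (\<delta> * c - 1))"
    using assms by (simp add: norm_mult norm_rpow)
  finally show ?thesis by simp
qed

text \<open>Fubini for the density against a test function. It is used twice: with an exponential, to recognise the Cauchy function,
and with the Laplace transform of the Bessel kernel, to reach the final contour integral.\<close>

lemma density_integral:
  fixes \<psi> :: "real \<Rightarrow> real"
  assumes [measurable]: "\<psi> \<in> borel_measurable borel"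
    and int: "integrable half_line (\<lambda>r. r powr (\<delta> * c - 1) * \<bar>\<psi> r\<bar>)"
  shows "(LINT r|half_line. m r * of_real (\<psi> r))
       = vline_int c (\<lambda>s. \<omega> s * (LINT r|half_line. rpow r (of_real \<delta> * s - 1) * of_real (\<psi> r)))"
    and "integrable half_line (\<lambda>r. m r * of_real (\<psi> r))"
proof -
  define F where "F y r = \<omega> (Complex c y) * rpow r (of_real \<delta> * Complex c y - 1) * complex_of_real (\<psi> r)" for y r
  have Fm [measurable]: "case_prod F \<in> borel_measurable (lborel \<Otimes>\<^sub>M half_line)"
    unfolding F_def case_prod_unfold by measurable
  have normF: "norm (F y r) = norm (\<omega> (Complex c y)) * (r powr (\<delta> * c - 1) * \<bar>\<psi> r\<bar>)" if "0 < r" for y r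
    using that by (simp add: F_def norm_mult norm_rpow)
  have mF: "F y \<in> borel_measurable borel" for y unfolding F_def by measurable
  have inner: "(LINT r|half_line. norm (F y r))
      = norm (\<omega> (Complex c y)) * (LINT r|half_line. r powr (\<delta> * c - 1) * \<bar>\<psi> r\<bar>)" for y
  proof -
    have "(LINT r|half_line. norm (F y r))
        = (LINT r|half_line. norm (\<omega> (Complex c y)) * (r powr (\<delta> * c - 1) * \<bar>\<psi> r\<bar>))"
      by (rule half_line_integral_cong(1)) (use mF in \<open>measurable, auto simp: normF\<close>)
    then show ?thesis by simp
  qed
  have Fi: "integrable (lborel \<Otimes>\<^sub>M half_line) (case_prod F)"
  proof (rule lborel_half_line.Fubini_integrable[OF Fm])
    show "integrable lborel (\<lambda>y. LINT r|half_line. norm (case_prod F (y, r)))"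
      unfolding case_prod_conv inner by (intro integrable_mult_left integrable_norm weight_integrable)
    have "integrable half_line (F y)" for y
      by (rule half_line_integrable_bound[OF integrable_mult_right[OF int, of "norm (\<omega> (Complex c y))"] mF])
        (simp add: normF)
    then show "AE y in lborel. integrable half_line (\<lambda>r. case_prod F (y, r))" by simp
  qed
  have mr: "(LINT y|lborel. F y r) = m r * of_real (\<psi> r)" for r
    unfolding F_def mixing_density_def by simp
  show "integrable half_line (\<lambda>r. m r * of_real (\<psi> r))"
    using lborel_half_line.integrable_snd[OF Fi] unfolding mr .
  have "(LINT r|half_line. m r * of_real (\<psi> r)) = (LINT y|lborel. LINT r|half_line. F y r)"
    using lborel_half_line.Fubini_integral[OF Fi] unfolding mr .
  then show "(LINT r|half_line. m r * of_real (\<psi> r))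
       = vline_int c (\<lambda>s. \<omega> s * (LINT r|half_line. rpow r (of_real \<delta> * s - 1) * of_real (\<psi> r)))"
    unfolding F_def by (simp add: mult.assoc)
qed

lemma density_laplace:
  assumes "t > 0" "t \<noteq> \<beta>"
  shows "(LINT r|half_line. m r * of_real (exp (- t * r)))
       = of_real (2 * pi * Gamma \<alpha> * (1 + (t / \<beta>) powr \<delta>) powr (- \<alpha>))"
proof -
  have "integrable half_line (\<lambda>r. r powr (\<delta> * c - 1) * \<bar>exp (- t * r)\<bar>)"
    using gamma_integral_real(1)[of "\<delta> * c" t] c \<delta> assms by simp
  then have "(LINT r|half_line. m r * of_real (exp (- t * r)))
      = vline_int c (\<lambda>s. \<omega> s * (LINT r|half_line. rpow r (of_real \<delta> * s - 1) * of_real (exp (- t * r))))"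
    by (intro density_integral(1)) measurable
  also have "\<dots> = vline_int c (\<lambda>s. Gamma s * Gamma (of_real \<alpha> - s) * rpow ((t / \<beta>) powr \<delta>) (- s))"
  proof (rule Bochner_Integration.integral_cong)
    fix y
    let ?s = "Complex c y"
    have re: "0 < Re (of_real \<delta> * ?s)" using c \<delta> by simp
    then have "of_real \<delta> * ?s \<notin> \<int>\<^sub>\<le>\<^sub>0" by (auto elim!: nonpos_Ints_cases simp: complex_eq_iff)
    then have g: "rGamma (of_real \<delta> * ?s) * Gamma (of_real \<delta> * ?s) = 1"
      by (simp add: rGamma_inverse_Gamma Gamma_eq_zero_iff)
    have p: "rpow ((t / \<beta>) powr \<delta>) (- ?s) = rpow \<beta> (of_real \<delta> * ?s) * rpow t (- (of_real \<delta> * ?s))"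
    proof -
      have "rpow ((t / \<beta>) powr \<delta>) (- ?s) = rpow (t * inverse \<beta>) (- (of_real \<delta> * ?s))"
        using assms \<beta> rpow_powr[of "t / \<beta>" \<delta> "- ?s"] by (simp add: divide_inverse)
      then show ?thesis using assms \<beta> by (simp add: rpow_mult rpow_inverse)
    qed
    show "\<omega> ?s * (LINT r|half_line. rpow r (of_real \<delta> * ?s - 1) * of_real (exp (- t * r)))
        = Gamma ?s * Gamma (of_real \<alpha> - ?s) * rpow ((t / \<beta>) powr \<delta>) (- ?s)"
    proof -
      have "\<omega> ?s * (LINT r|half_line. rpow r (of_real \<delta> * ?s - 1) * of_real (exp (- t * r)))
          = (Gamma ?s * Gamma (of_real \<alpha> - ?s)) * (rGamma (of_real \<delta> * ?s) * Gamma (of_real \<delta> * ?s))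
            * (rpow \<beta> (of_real \<delta> * ?s) * rpow t (- (of_real \<delta> * ?s)))"
        unfolding gamma_integral(2)[OF re assms(1)] mixing_weight_def by (simp only: mult_ac)
      then show ?thesis unfolding g p by simp
    qed
  qed simp
  also have "\<dots> = of_real (2 * pi * Gamma \<alpha> * (1 + (t / \<beta>) powr \<delta>) powr (- \<alpha>))"
  proof (rule mellin_barnes_binomial[OF c])
    have "t / \<beta> > 0" "t / \<beta> \<noteq> 1" using assms \<beta> by auto
    then show "0 < (t / \<beta>) powr \<delta>" "(t / \<beta>) powr \<delta> \<noteq> 1"
      using \<delta> by (auto simp: powr_eq_one_iff_gen)
  qed
  finally show ?thesis .
qed

end

section \<open>The Abel integral\<close>

text \<open>If \<open>\<phi>\<close> is the Laplace transform of \<open>\<mu>\<close>, then \<open>exp(-\<epsilon> t) \<phi> t\<close> is that of \<open>\<mu>\<close> shifted by \<open>\<epsilon>\<close>, and integrating the kernel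
first replaces it by its Laplace transform \<open>P\<close>. For \<open>\<epsilon> > 0\<close> everything converges absolutely because of \<open>a < d\<close>; as
\<open>\<epsilon> \<rightarrow> 0\<close> the integrands are dominated by a multiple of \<open>r powr (a - 1) (r^2 + z^2) powr (-d/2)\<close>.\<close>

lemma abel_integral_bessel_mixture:
  fixes \<mu> \<phi> f :: "real \<Rightarrow> real" and P :: "real \<Rightarrow> real"
  assumes d: "d > 0" and z: "z > 0" and a: "0 < a" "a < real d"
    and [measurable]: "\<mu> \<in> borel_measurable borel" "\<phi> \<in> borel_measurable borel"
    and \<mu>: "\<And>r. 0 < r \<Longrightarrow> \<bar>\<mu> r\<bar> \<le> W * r powr (a - 1)"
    and \<phi>: "\<And>t. 0 < t \<Longrightarrow> t \<noteq> b \<Longrightarrow> \<phi> t = (LINT r|half_line. \<mu> r * exp (- t * r))"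
    and f: "\<And>t. 0 < t \<Longrightarrow> f t = K * (bessel_kernel d z t * \<phi> t)"
    and P: "\<And>p. 0 < p \<Longrightarrow> P p = C * (p * (p\<^sup>2 + z\<^sup>2) powr (- ((real d + 1) / 2)))"
    and L: "\<And>p. 0 < p \<Longrightarrow> (LINT t|half_line. exp (- p * t) * bessel_kernel d z t) = P p"
    and Pm [measurable]: "P \<in> borel_measurable borel"
  shows "has_abel_integral f (K * (LINT r|half_line. \<mu> r * P r))"
proof -
  let ?\<kappa> = "bessel_kernel d z"
  define B where "B = rGamma (real d / 2)"
  have \<kappa>: "\<bar>?\<kappa> t\<bar> \<le> B * t powr (real d - 1)" if "0 < t" for t
    unfolding B_def by (rule abs_bessel_kernel_le[OF d that])
  have BW: "0 \<le> B" "0 \<le> W" using \<kappa>[of 1] \<mu>[of 1] by auto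
  have main: "integrable half_line (\<lambda>t. exp (- \<epsilon> * t) * (?\<kappa> t * \<phi> t))"
    "(LINT t|half_line. exp (- \<epsilon> * t) * (?\<kappa> t * \<phi> t)) = (LINT r|half_line. \<mu> r * P (\<epsilon> + r))"
    if \<epsilon>: "\<epsilon> > 0" for \<epsilon>
  proof -
    define F where "F t r = exp (- \<epsilon> * t) * ?\<kappa> t * (\<mu> r * exp (- t * r))" for t r
    have Fm [measurable]: "case_prod F \<in> borel_measurable (half_line \<Otimes>\<^sub>M half_line)"
      unfolding F_def case_prod_unfold by measurable
    have mF: "F t \<in> borel_measurable borel" for t unfolding F_def by measurable
    have normF: "norm (F t r) \<le> (B * W * (t powr (real d - 1) * exp (- \<epsilon> * t))) * (r powr (a - 1) * exp (- t * r))"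
      if "0 < t" "0 < r" for t r
    proof -
      have "norm (F t r) = exp (- \<epsilon> * t) * exp (- t * r) * (\<bar>?\<kappa> t\<bar> * \<bar>\<mu> r\<bar>)" by (simp add: F_def abs_mult)
      also have "\<dots> \<le> exp (- \<epsilon> * t) * exp (- t * r) * ((B * t powr (real d - 1)) * (W * r powr (a - 1)))"
        using that BW by (intro mult_left_mono mult_mono \<kappa> \<mu>) auto
      finally show ?thesis by (simp add: mult_ac)
    qed
    have Fint: "integrable half_line (F t)" if t: "0 < t" for t
      by (rule half_line_integrable_bound[OF _ mF normF[OF t]])
        (intro integrable_mult_right gamma_integral_real(1) a t)
    have inner: "(LINT r|half_line. norm (F t r)) \<le> (B * W * Gamma a) * (t powr (real d - a - 1) * exp (- \<epsilon> * t))"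
      if t: "0 < t" for t
    proof -
      have "(LINT r|half_line. norm (F t r))
          \<le> (LINT r|half_line. (B * W * (t powr (real d - 1) * exp (- \<epsilon> * t))) * (r powr (a - 1) * exp (- t * r)))"
        by (intro integral_mono_AE integrable_norm Fint t integrable_mult_right gamma_integral_real(1) a
            AE_half_lineI normF)
      also have "\<dots> = (B * W * (t powr (real d - 1) * exp (- \<epsilon> * t))) * (Gamma a * t powr (- a))"
        using gamma_integral_real(2)[OF a(1) t] by simp
      also have "\<dots> = (B * W * Gamma a) * ((t powr (real d - 1) * t powr (- a)) * exp (- \<epsilon> * t))" by simp
      also have "t powr (real d - 1) * t powr (- a) = t powr (real d - a - 1)"
        by (simp flip: powr_add add: algebra_simps)
      finally show ?thesis .
    qed
    have Fi: "integrable (half_line \<Otimes>\<^sub>M half_line) (case_prod F)"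
    proof (rule half_line_pair.Fubini_integrable[OF Fm])
      have "integrable half_line (\<lambda>t. (B * W * Gamma a) * (t powr (real d - a - 1) * exp (- \<epsilon> * t)))"
        using a \<epsilon> by (intro integrable_mult_right gamma_integral_real(1)) auto
      then show "integrable half_line (\<lambda>t. LINT r|half_line. norm (case_prod F (t, r)))"
      proof (rule half_line_integrable_bound)
        show "(\<lambda>t. LINT r|half_line. norm (case_prod F (t, r))) \<in> borel_measurable borel"
          by measurable
        show "norm (LINT r|half_line. norm (case_prod F (t, r)))
            \<le> (B * W * Gamma a) * (t powr (real d - a - 1) * exp (- \<epsilon> * t))" if "0 < t" for t
          using inner[OF that] by simp
      qed
      show "AE t in half_line. integrable half_line (\<lambda>r. case_prod F (t, r))"
        by (rule AE_half_lineI) (simp add: Fint)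
    qed
    have nb: "AE t in half_line. (LINT r|half_line. F t r) = exp (- \<epsilon> * t) * (?\<kappa> t * \<phi> t)"
    proof -
      have "AE t in lborel. t \<noteq> b" by (rule AE_lborel_singleton)
      then show ?thesis unfolding AE_half_line_iff F_def
        by eventually_elim (simp add: \<phi>)
    qed
    have mL: "(\<lambda>t. LINT r|half_line. F t r) \<in> borel_measurable half_line"
      using borel_measurable_integrable[OF half_line_pair.integrable_fst[OF Fi]] .
    have mR: "(\<lambda>t. exp (- \<epsilon> * t) * (?\<kappa> t * \<phi> t)) \<in> borel_measurable half_line" by measurable
    show "integrable half_line (\<lambda>t. exp (- \<epsilon> * t) * (?\<kappa> t * \<phi> t))"
      using half_line_pair.integrable_fst[OF Fi] integrable_cong_AE[OF mL mR nb] by blast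
    have "(LINT t|half_line. exp (- \<epsilon> * t) * (?\<kappa> t * \<phi> t)) = (LINT t|half_line. LINT r|half_line. F t r)"
      using integral_cong_AE[OF mL mR nb] by simp
    also have "\<dots> = (LINT r|half_line. LINT t|half_line. F t r)"
      by (rule half_line_pair.Fubini_integral[OF Fi, symmetric])
    also have "\<dots> = (LINT r|half_line. \<mu> r * P (\<epsilon> + r))"
    proof (rule half_line_integral_cong(1))
      show "(\<lambda>r. LINT t|half_line. F t r) \<in> borel_measurable borel"
        using borel_measurable_integrable[OF half_line_pair.integrable_snd[OF Fi]] by simp
      fix r :: real assume r: "0 < r"
      have "F t r = \<mu> r * (exp (- (\<epsilon> + r) * t) * ?\<kappa> t)" for t
      proof -
        have "exp (- (\<epsilon> + r) * t) = exp (- \<epsilon> * t) * exp (- t * r)"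
          by (simp flip: exp_add add: algebra_simps)
        then show ?thesis by (simp add: F_def)
      qed
      then show "(LINT t|half_line. F t r) = \<mu> r * P (\<epsilon> + r)"
        using L[of "\<epsilon> + r"] \<epsilon> r by simp
    qed measurable
    finally show "(LINT t|half_line. exp (- \<epsilon> * t) * (?\<kappa> t * \<phi> t)) = (LINT r|half_line. \<mu> r * P (\<epsilon> + r))" .
  qed
  have HI: "((\<lambda>t. exp (- \<epsilon> * t) * f t) has_integral (K * (LINT r|half_line. \<mu> r * P (\<epsilon> + r)))) {0..}"
    if \<epsilon>: "\<epsilon> > 0" for \<epsilon>
  proof -
    have "((\<lambda>t. exp (- \<epsilon> * t) * (?\<kappa> t * \<phi> t)) has_integral (LINT r|half_line. \<mu> r * P (\<epsilon> + r))) {0..}"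
      using half_line_has_integral[OF _ main(1)[OF \<epsilon>]] unfolding main(2)[OF \<epsilon>] by measurable
    from has_integral_mult_right[OF this, of K]
    show ?thesis
      by (rule has_integral_spike[of "{0}", rotated 2]) (auto simp: f)
  qed
  have bound_int: "integrable half_line (\<lambda>r. W * (\<bar>C\<bar> * (r powr (a - 1) * (r\<^sup>2 + z\<^sup>2) powr (- (real d / 2)))))"
  proof -
    have "integrable half_line (\<lambda>r. norm (rpow r (of_real a - 1) * complex_of_real ((r\<^sup>2 + z\<^sup>2) powr (- (real d / 2)))))"
      using a z by (intro integrable_norm rational_moment_integral(1)) auto
    then have "integrable half_line (\<lambda>r. r powr (a - 1) * (r\<^sup>2 + z\<^sup>2) powr (- (real d / 2)))"
      by (rule half_line_integrable_bound) (auto simp: norm_mult norm_rpow)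
    then show ?thesis by (intro integrable_mult_right)
  qed
  have P_bound: "\<bar>P p\<bar> \<le> \<bar>C\<bar> * (r\<^sup>2 + z\<^sup>2) powr (- (real d / 2))" if "0 < r" "r \<le> p" for p r
  proof -
    have pos: "0 < p\<^sup>2 + z\<^sup>2" "0 < r\<^sup>2 + z\<^sup>2" using z by (simp_all add: add_nonneg_pos)
    have "p = sqrt (p\<^sup>2)" using that by simp
    also have "\<dots> \<le> sqrt (p\<^sup>2 + z\<^sup>2)" by simp
    also have "\<dots> = (p\<^sup>2 + z\<^sup>2) powr (1/2)" using pos by (simp add: powr_half_sqrt)
    finally have "p * (p\<^sup>2 + z\<^sup>2) powr (- ((real d + 1) / 2))
        \<le> (p\<^sup>2 + z\<^sup>2) powr (1/2) * (p\<^sup>2 + z\<^sup>2) powr (- ((real d + 1) / 2))"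
      by (intro mult_right_mono) auto
    also have "\<dots> = (p\<^sup>2 + z\<^sup>2) powr (- (real d / 2))"
      by (simp flip: powr_add add: field_simps)
    also have "\<dots> \<le> (r\<^sup>2 + z\<^sup>2) powr (- (real d / 2))"
      using that pos by (intro powr_mono2') (auto intro!: power_mono)
    finally have "p * (p\<^sup>2 + z\<^sup>2) powr (- ((real d + 1) / 2)) \<le> (r\<^sup>2 + z\<^sup>2) powr (- (real d / 2))" .
    then show ?thesis using that by (simp add: P abs_mult mult_left_mono)
  qed
  have lim: "((\<lambda>\<epsilon>. LINT r|half_line. \<mu> r * P (\<epsilon> + r)) \<longlongrightarrow> (LINT r|half_line. \<mu> r * P r)) (at_right 0)"
    unfolding tendsto_at_iff_sequentially comp_def
  proof (intro allI impI)
    fix X :: "nat \<Rightarrow> real" assume X: "\<forall>i. X i \<in> {0<..} - {0}" "X \<longlonglongrightarrow> 0"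
    show "(\<lambda>i. LINT r|half_line. \<mu> r * P (X i + r)) \<longlonglongrightarrow> (LINT r|half_line. \<mu> r * P r)"
    proof (rule integral_dominated_convergence[OF _ _ bound_int])
      show "AE r in half_line. (\<lambda>i. \<mu> r * P (X i + r)) \<longlonglongrightarrow> \<mu> r * P r"
      proof (rule AE_half_lineI)
        fix r :: real assume r: "0 < r"
        let ?Q = "\<lambda>p. C * (p * (p\<^sup>2 + z\<^sup>2) powr (- ((real d + 1) / 2)))"
        have "r\<^sup>2 + z\<^sup>2 \<noteq> 0" using z by (simp add: add_nonneg_eq_0_iff)
        then have "isCont ?Q r" by (intro continuous_intros) auto
        moreover have "(\<lambda>i. X i + r) \<longlonglongrightarrow> r" using tendsto_add[OF X(2) tendsto_const[of r]] by simp
        ultimately have "(\<lambda>i. ?Q (X i + r)) \<longlonglongrightarrow> ?Q r" by (rule isCont_tendsto_compose)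
        moreover have "?Q (X i + r) = P (X i + r)" for i
          using X(1)[rule_format, of i] r by (intro P[symmetric]) auto
        ultimately show "(\<lambda>i. \<mu> r * P (X i + r)) \<longlonglongrightarrow> \<mu> r * P r"
          using P[OF r] by (intro tendsto_intros) simp
      qed
      show "AE r in half_line. norm (\<mu> r * P (X i + r)) \<le> W * (\<bar>C\<bar> * (r powr (a - 1) * (r\<^sup>2 + z\<^sup>2) powr (- (real d / 2))))" for i
      proof (rule AE_half_lineI)
        fix r :: real assume r: "0 < r"
        have "norm (\<mu> r * P (X i + r)) \<le> (W * r powr (a - 1)) * (\<bar>C\<bar> * (r\<^sup>2 + z\<^sup>2) powr (- (real d / 2)))"
          unfolding real_norm_def abs_mult
          using X(1)[rule_format, of i] r BW by (intro mult_mono \<mu> P_bound) auto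
        then show "norm (\<mu> r * P (X i + r)) \<le> W * (\<bar>C\<bar> * (r powr (a - 1) * (r\<^sup>2 + z\<^sup>2) powr (- (real d / 2))))"
          by (simp add: mult_ac)
      qed
    qed measurable
  qed
  have "((\<lambda>\<epsilon>. integral {0..} (\<lambda>t. exp (- \<epsilon> * t) * f t)) \<longlongrightarrow> K * (LINT r|half_line. \<mu> r * P r)) (at_right 0)"
  proof (rule Lim_transform_eventually[OF tendsto_mult_left[OF lim, of K]])
    show "\<forall>\<^sub>F \<epsilon> in at_right 0. K * (LINT r|half_line. \<mu> r * P (\<epsilon> + r)) = integral {0..} (\<lambda>t. exp (- \<epsilon> * t) * f t)"
      by (rule eventually_at_rightI[of 0 1], rule integral_unique[OF HI, symmetric]) auto
  qed
  then show ?thesis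
    unfolding has_abel_integral_def using HI by (auto simp: integrable_on_def)
qed

section \<open>The transform of the Generalized Cauchy function\<close>

text \<open>The Mellin transform of \<open>P\<close> contains \<open>\<Gamma>(\<delta> s/2 + 1/2)\<close>, and the weight \<open>1/\<Gamma>(\<delta> s)\<close>; the duplication formula
combines them to \<open>1/\<Gamma>(\<delta> s/2)\<close>.\<close>

lemma bessel_mellin_weight:
  fixes d :: nat
  assumes d: "d > 0" and z: "z > 0" and \<beta>: "\<beta> > 0" and \<delta>: "\<delta> > 0" and s: "0 < Re s" "\<delta> * Re s < real d"
    and C: "C = 2 ^ (d - 1) * Gamma ((real d + 1) / 2) / sqrt pi"
    and P: "\<And>p. 0 < p \<Longrightarrow> P p = C * (p * (p\<^sup>2 + z\<^sup>2) powr (- ((real d + 1) / 2)))"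
    and Pm [measurable]: "P \<in> borel_measurable borel"
  shows "mixing_weight \<alpha> \<delta> \<beta> s * (LINT r|half_line. rpow r (of_real \<delta> * s - 1) * of_real (P r))
       = of_real (2 ^ (d - 1) * z powr (- real d)) *
          (Gamma s * Gamma (of_real \<alpha> - s) *
             (Gamma (of_real (real d / 2) - of_real (\<delta> / 2) * s) * rGamma (of_real (\<delta> / 2) * s))
             * rpow (z * \<beta> / 2) (of_real \<delta> * s))"
proof -
  let ?q = "(real d + 1) / 2"
  define u where "u = of_real (\<delta> / 2) * s"
  have du: "of_real \<delta> * s = 2 * u" by (simp add: u_def)
  have u: "0 < Re u" "2 * Re u < real d" using s \<delta> by (simp_all add: u_def)
  let ?w = "2 * u + 1"
  have "(LINT r|half_line. rpow r (2 * u - 1) * of_real (P r))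
      = (LINT r|half_line. of_real C * (rpow r (?w - 1) * of_real ((r\<^sup>2 + z\<^sup>2) powr (- ?q))))"
  proof (rule half_line_integral_cong(1))
    fix r :: real assume r: "0 < r"
    have "rpow r (?w - 1) = rpow r (2 * u - 1) * of_real r"
      using rpow_add[of r "2 * u - 1" 1] rpow_of_real[OF r, of 1] r by simp
    then show "rpow r (2 * u - 1) * of_real (P r) = of_real C * (rpow r (?w - 1) * of_real ((r\<^sup>2 + z\<^sup>2) powr (- ?q)))"
      using P[OF r] by (simp add: mult_ac)
  qed measurable
  also have "\<dots> = of_real C * (Gamma (?w / 2) * Gamma (of_real ?q - ?w / 2) / (2 * of_real (Gamma ?q)) * rpow z (?w - of_real (2 * ?q)))"
  proof -
    have "0 < Re ?w" "Re ?w < 2 * ?q" using u by auto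
    from rational_moment_integral(2)[OF this z] show ?thesis by (simp only: integral_mult_right_zero)
  qed
  also have "?w / 2 = u + 1/2" by (simp add: add_divide_distrib)
  also have "of_real ?q - (u + 1/2) = of_real (real d / 2) - u"
    by (simp only: add_divide_distrib of_real_add) simp
  also have "rpow z (?w - of_real (2 * ?q)) = rpow z (2 * u) * of_real (z powr (- real d))"
  proof -
    have "2 * ?q = real d + 1" by simp
    then have "?w - of_real (2 * ?q) = 2 * u + of_real (- real d)" by (simp only: of_real_add) simp
    then show ?thesis by (simp only: rpow_add rpow_of_real[OF z])
  qed
  finally have I: "(LINT r|half_line. rpow r (2 * u - 1) * of_real (P r)) = of_real C * (Gamma (u + 1/2)
      * Gamma (of_real (real d / 2) - u) / (2 * of_real (Gamma ?q)) * (rpow z (2 * u) * of_real (z powr (- real d))))" .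
  have dup: "rGamma (2 * u) * Gamma (u + 1/2) = rpow 2 (1 - 2 * u) * of_real (sqrt pi) * rGamma u"
    by (rule Gamma_legendre_duplication_rGamma[OF u(1)])
  have two: "rpow 2 (1 - 2 * u) = 2 * rpow (1/2) (2 * u)"
  proof -
    have "rpow 2 1 = 2" using rpow_of_real[of 2 1] by simp
    moreover have "rpow 2 (- (2 * u)) = rpow (1/2) (2 * u)"
      using rpow_inverse[of 2 "2 * u"] by (simp only: inverse_eq_divide zero_less_numeral)
    moreover have "1 - 2 * u = 1 + - (2 * u)" by simp
    ultimately show ?thesis by (simp only: rpow_add)
  qed
  have X: "rpow (z * \<beta> / 2) (2 * u) = rpow z (2 * u) * rpow \<beta> (2 * u) * rpow (1/2) (2 * u)"
  proof -
    have "z * \<beta> / 2 = z * \<beta> * (1/2)" by simp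
    moreover have "0 < z * \<beta>" using z \<beta> by simp
    ultimately show ?thesis using z \<beta> by (simp only: rpow_mult)
  qed
  have g: "Gamma ?q \<noteq> 0" using Gamma_real_pos[of ?q] less_imp_neq by fastforce
  have K: "of_real C * of_real (sqrt pi) / of_real (Gamma ?q) = complex_of_real (2 ^ (d - 1))"
  proof -
    have "C * sqrt pi / Gamma ?q = 2 ^ (d - 1)" using g unfolding C by simp
    then show ?thesis by (simp only: of_real_mult[symmetric] of_real_divide[symmetric])
  qed
  have alg: "A * R * v * (c * (g * h / (2 * q) * (x * w))) = k * w * (A * (h * t) * (x * v * y))"
    if "R * g = 2 * y * e * t" "c * e / q = k" for A R v c g h q x w k t y e :: complex
  proof -
    have "A * R * v * (c * (g * h / (2 * q) * (x * w))) = (R * g) * (A * v * c * h * x * w) / (2 * q)" by simp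
    also have "\<dots> = (c * e / q) * w * (A * (h * t) * (x * v * y))" unfolding that(1) by simp
    finally show ?thesis unfolding that(2) .
  qed
  show ?thesis
    unfolding mixing_weight_def du I of_real_mult[of "2 ^ (d - 1)" "z powr (- real d)"] X u_def[symmetric]
    by (rule alg[OF _ K]) (simp only: dup two)
qed


theorem theorem2p1:
  fixes d :: nat and \<beta> \<delta> l z :: real
  assumes "d > 0" and "\<beta> > 0" and "0 < \<delta>" and "\<delta> < 2" and "l > 0" and "z > 0"
    and no_pole1: "\<And>n::nat. real d / 2 - (l / \<delta> + real n) * \<delta> / 2 \<notin> \<int>\<^sub>\<le>\<^sub>0"
    and no_pole2: "\<And>n::nat. l / \<delta> - real (2 * n + d) / \<delta> \<notin> \<int>\<^sub>\<le>\<^sub>0"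
    and conv1: "summable (cauchy_term1 d \<delta> l (z * \<beta> / 2))"
    and conv2: "summable (cauchy_term2 d \<delta> l (z * \<beta> / 2))"
  shows "has_radial_ft d (\<lambda>t. gen_cauchy \<delta> l (t / \<beta>)) z
    (z powr (- real d) / pi powr (real d / 2) * (1 / Gamma (l / \<delta>)) *
       (\<Sum>n. cauchy_term1 d \<delta> l (z * \<beta> / 2) n)
     + z powr (- real d) / (pi powr (real d / 2) * \<delta>) * (2 / Gamma (l / \<delta>)) *
       (\<Sum>n. cauchy_term2 d \<delta> l (z * \<beta> / 2) n))"
proof -
  let ?\<phi> = "\<lambda>t. gen_cauchy \<delta> l (t / \<beta>)"
  define \<alpha> where "\<alpha> = l / \<delta>"
  have \<alpha>: "\<alpha> > 0" using assms by (simp add: \<alpha>_def)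
  obtain c where c0: "0 < c" "c < \<alpha>" "c < real d / \<delta>"
    using dense[of 0 "min \<alpha> (real d / \<delta>)"] \<alpha> assms by auto
  interpret cauchy_mixture \<alpha> \<delta> \<beta> c using c0 assms by unfold_locales
  have cd: "\<delta> * c < real d" using c0(3) \<open>0 < \<delta>\<close> by (simp add: field_simps)
  define G where "G = 2 * pi * Gamma \<alpha>"
  have G: "G > 0" using Gamma_real_pos[OF \<alpha>] by (simp add: G_def)
  define \<mu> where "\<mu> r = Re (m r) / G" for r
  define C where "C = 2 ^ (d - 1) * Gamma ((real d + 1) / 2) / sqrt pi"
  define P where "P p = C * (p * (p\<^sup>2 + z\<^sup>2) powr (- ((real d + 1) / 2)))" for p
  define K where "K = (z / 2) powr (real d / 2 - 1)"
  define W where "W = (LINT y|lborel. norm (\<omega> (Complex c y)))"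
  have [measurable]: "\<mu> \<in> borel_measurable borel" "P \<in> borel_measurable borel" "?\<phi> \<in> borel_measurable borel"
    unfolding \<mu>_def P_def gen_cauchy_def by measurable
  have re: "(LINT r|half_line. \<mu> r * \<psi> r) = Re (LINT r|half_line. m r * of_real (\<psi> r)) / G"
    if "\<psi> \<in> borel_measurable borel" "integrable half_line (\<lambda>r. r powr (\<delta> * c - 1) * \<bar>\<psi> r\<bar>)" for \<psi>
  proof -
    have "(LINT r|half_line. \<mu> r * \<psi> r) = (LINT r|half_line. Re (m r * of_real (\<psi> r)) / G)"
      by (simp add: \<mu>_def)
    then show ?thesis using integral_Re[OF density_integral(2)[OF that]] by simp
  qed
  have abel: "has_abel_integral (radial_integrand d ?\<phi> z) (K * (LINT r|half_line. \<mu> r * P r))"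
  proof (rule abel_integral_bessel_mixture[where a = "\<delta> * c" and b = \<beta> and \<phi> = ?\<phi> and W = "W / G"])
    show "\<bar>\<mu> r\<bar> \<le> W / G * r powr (\<delta> * c - 1)" if "0 < r" for r
    proof -
      have "\<bar>Re (m r)\<bar> \<le> W * r powr (\<delta> * c - 1)"
        using abs_Re_le_cmod[of "m r"] density_bound[OF that] unfolding W_def by linarith
      then show ?thesis using G by (simp add: \<mu>_def abs_divide divide_right_mono)
    qed
    show "?\<phi> t = (LINT r|half_line. \<mu> r * exp (- t * r))" if t: "0 < t" "t \<noteq> \<beta>" for t
    proof -
      have "integrable half_line (\<lambda>r. r powr (\<delta> * c - 1) * \<bar>exp (- t * r)\<bar>)"
        using gamma_integral_real(1)[of "\<delta> * c" t] c \<open>0 < \<delta>\<close> t by simp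
      then have "(LINT r|half_line. \<mu> r * exp (- t * r)) = Re (LINT r|half_line. m r * of_real (exp (- t * r))) / G"
        by (intro re) measurable
      also have "\<dots> = (1 + (t / \<beta>) powr \<delta>) powr (- \<alpha>)"
        using G unfolding density_laplace[OF t] G_def[symmetric] Re_complex_of_real by simp
      finally show ?thesis by (simp add: gen_cauchy_def \<alpha>_def)
    qed
    show "radial_integrand d ?\<phi> z t = K * (bessel_kernel d z t * ?\<phi> t)" if "0 < t" for t
      unfolding K_def by (rule radial_integrand_bessel_kernel) (use assms that in auto)
    show "(LINT t|half_line. exp (- p * t) * bessel_kernel d z t) = P p" if "0 < p" for p
      unfolding P_def C_def using assms that by (intro bessel_kernel_laplace)
  qed (use assms c0 cd in \<open>auto simp: P_def\<close>)
  let ?S1 = "suminf (cauchy_term1 d \<delta> l (z * \<beta> / 2))" and ?S2 = "suminf (cauchy_term2 d \<delta> l (z * \<beta> / 2))"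
  have I: "(LINT r|half_line. \<mu> r * P r) = 2 ^ (d - 1) * z powr (- real d) * (?S1 + 2 / \<delta> * ?S2) / Gamma \<alpha>"
  proof -
    have "integrable half_line (\<lambda>r. norm (of_real C * (rpow r (of_real (\<delta> * c + 1) - 1) *
        complex_of_real ((r\<^sup>2 + z\<^sup>2) powr (- ((real d + 1) / 2))))))"
      using c0 cd assms by (intro integrable_norm integrable_mult_right rational_moment_integral(1))
        (auto intro!: add_pos_pos mult_pos_pos)
    then have Pint: "integrable half_line (\<lambda>r. r powr (\<delta> * c - 1) * \<bar>P r\<bar>)"
    proof (rule half_line_integrable_bound)
      fix r :: real assume r: "0 < r"
      have "r powr (\<delta> * c) = r powr (\<delta> * c - 1) * r"
        using r powr_add[of r "\<delta> * c - 1" 1] by simp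
      then show "norm (r powr (\<delta> * c - 1) * \<bar>P r\<bar>) \<le> norm (of_real C * (rpow r (of_real (\<delta> * c + 1) - 1) *
        complex_of_real ((r\<^sup>2 + z\<^sup>2) powr (- ((real d + 1) / 2)))))"
        using r by (simp add: P_def norm_mult norm_rpow abs_mult mult_ac)
    qed measurable
    define H where "H = (\<lambda>s. Gamma s * Gamma (of_real (l / \<delta>) - s) *
             (Gamma (of_real (real d / 2) - of_real (\<delta> / 2) * s) * rGamma (of_real (\<delta> / 2) * s))
             * rpow (z * \<beta> / 2) (of_real \<delta> * s))"
    have "(LINT r|half_line. m r * of_real (P r))
        = vline_int c (\<lambda>s. \<omega> s * (LINT r|half_line. rpow r (of_real \<delta> * s - 1) * of_real (P r)))"
      by (rule density_integral(1)[OF _ Pint]) measurable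
    also have "\<dots> = vline_int c (\<lambda>s. of_real (2 ^ (d - 1) * z powr (- real d)) * H s)"
    proof (rule Bochner_Integration.integral_cong)
      fix y
      show "\<omega> (Complex c y) * (LINT r|half_line. rpow r (of_real \<delta> * Complex c y - 1) * of_real (P r))
          = of_real (2 ^ (d - 1) * z powr (- real d)) * H (Complex c y)"
        unfolding H_def \<alpha>_def[symmetric]
        by (rule bessel_mellin_weight[OF _ _ _ _ _ _ C_def]) (use assms c0 cd in \<open>auto simp: P_def\<close>)
    qed simp
    also have "\<dots> = of_real (2 ^ (d - 1) * z powr (- real d)) * vline_int c H" by simp
    also have "vline_int c H = of_real (2 * pi * (?S1 + 2 / \<delta> * ?S2))"
      unfolding H_def using assms c0 by (intro cauchy_contour_closing) (auto simp: \<alpha>_def)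
    also have "of_real (2 ^ (d - 1) * z powr (- real d)) * of_real (2 * pi * (?S1 + 2 / \<delta> * ?S2))
        = complex_of_real (2 ^ (d - 1) * z powr (- real d) * (2 * pi * (?S1 + 2 / \<delta> * ?S2)))"
      by (rule of_real_mult[symmetric])
    finally show ?thesis using re[OF _ Pint] by (simp add: G_def)
  qed
  have const: "radial_factor d z * (K * 2 ^ (d - 1)) = 1 / pi powr (real d / 2)"
  proof -
    have alg: "x / (f * p) * (y / e * (e * f)) = 1 / p" if "x * y = 1" "e \<noteq> 0" "f \<noteq> 0" for x y e f p :: real
    proof -
      have "x / (f * p) * (y / e * (e * f)) = x * y / p" using that(2,3) by simp
      then show ?thesis using that(1) by simp
    qed
    have "2 ^ (d - 1) = 2 powr real (d - 1)" by (rule powr_realpow[symmetric]) simp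
    also have "real (d - 1) = (real d / 2 - 1) + real d / 2" using \<open>d > 0\<close> by (simp add: of_nat_diff)
    finally have "2 ^ (d - 1) = 2 powr (real d / 2 - 1) * 2 powr (real d / 2)" by (simp only: powr_add)
    moreover have "K = z powr (real d / 2 - 1) / 2 powr (real d / 2 - 1)"
      unfolding K_def by (rule powr_divide)
    moreover have "(2 * pi) powr (real d / 2) = 2 powr (real d / 2) * pi powr (real d / 2)" by (rule powr_mult)
    moreover have "z powr (1 - real d / 2) * z powr (real d / 2 - 1) = 1"
      unfolding powr_add[symmetric] using \<open>z > 0\<close> by simp
    ultimately show ?thesis unfolding radial_factor_def by (simp only: alg powr_eq_0_iff)
  qed
  \<comment> \<open>By \<open>const\<close> the powers of \<open>2\<close> cancel, and so do the powers of \<open>z\<close> other than \<open>z powr -d\<close>.\<close>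
  have regroup: "a * (k * (e * w * S / g)) = (a * (k * e)) * (w * S / g)" for a k e w S g :: real by simp
  have split: "1 / p * (w * (A + 2 / \<delta> * B) / g) = w / p * (1 / g) * A + w / (p * \<delta>) * (2 / g) * B"
    for p w A B g :: real
    by (simp add: distrib_left add_divide_distrib)
  have "radial_factor d z * (K * (LINT r|half_line. \<mu> r * P r))
      = (radial_factor d z * (K * 2 ^ (d - 1))) * (z powr (- real d) * (?S1 + 2 / \<delta> * ?S2) / Gamma \<alpha>)"
    unfolding I by (rule regroup)
  also have "\<dots> = 1 / pi powr (real d / 2) * (z powr (- real d) * (?S1 + 2 / \<delta> * ?S2) / Gamma \<alpha>)"
    by (rule arg_cong2[OF const refl])
  also have "\<dots> = z powr (- real d) / pi powr (real d / 2) * (1 / Gamma \<alpha>) * ?S1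
     + z powr (- real d) / (pi powr (real d / 2) * \<delta>) * (2 / Gamma \<alpha>) * ?S2"
    by (rule split)
  finally have v: "radial_factor d z * (K * (LINT r|half_line. \<mu> r * P r)) = \<dots>" .
  show ?thesis
    unfolding has_radial_ft_def \<alpha>_def[symmetric] using abel v[symmetric] by blast
qed

end
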